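(* Let $\underline L=(L,\beta)$ be an integral lattice of rank $n$, let $s=(s_1,\dots,s_N)$ be a eutactic star of rank $N$ on $\underline L$, and let $G$ be a subgroup of the orthogonal group $O(\underline L)$ leaving $s$ invariant up to signs such that $s$ is $G$-extremal. Then there exist a constant $\gamma$ and a vector $w\in L^\bullet$ such that for all $\tau\in\mathbb H$, $z\in\mathbb C\otimes L$, $$\eta(\tau)^{n-N}\prod_{j=1}^N\vartheta\bigl(\tau,\beta(s_j,z)\bigr)=\gamma\sum_{x\in w+L_{\mathrm{ev}}}q^{\beta(x)}\sum_{g\in G}\operatorname{sn}(g)\,e\bigl(\beta(gx,z)\bigr).$$ In particular, the product on the left is an element of $J_{n/2,\underline L}(\varepsilon^{n+2N})$.
   Context: $e(x)=e^{2\pi ix}$, $q=e(\tau)$, $\eta(\tau)=q^{1/24}\prod_{n\ge1}(1-q^n)$, $\vartheta(\tau,z)=\sum_{r\in\mathbb Z}\left(\frac{-4}{r}\right)q^{r^2/8}e(rz/2)$. An integral lattice $\underline L=(L,\beta)$ is a free $\mathbb Z$-module $L$ of finite rank with a nondegenerate symmetric bilinear form $\beta:L\times L\to\mathbb Z$ (extended bilinearly to $\mathbb Q\otimes L$, $\mathbb C\otimes L$); $\beta(x):=\frac12\beta(x,x)$. $L^\sharp=\{y\in\mathbb Q\otimes L:\beta(y,L)\subseteq\mathbb Z\}$; $L_{\mathrm{ev}}=\{x\in L:\beta(x)\in\mathbb Z\}$; the shadow is $L^\bullet=\{r\in\mathbb Q\otimes L:\beta(x)\equiv\beta(r,x)\bmod\mathbb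 Z\text{ for all }x\in L\}$. A eutactic star of rank $N$ on $\underline L$ is a family of nonzero vectors $s_1,\dots,s_N\in L^\sharp$ with $x=\sum_j\beta(s_j,x)s_j$ for all $x\in\mathbb Q\otimes L$. $G\le O(\underline L)$ leaves $s$ invariant up to signs if for each $g\in G$ there are a permutation $\sigma$ and signs $\epsilon_j\in\{\pm1\}$ with $gs_j=\epsilon_js_{\sigma(j)}$ for all $j$; then $\operatorname{sn}(g)=\prod_j\epsilon_j$ is a character of $G$. $G$ acts on $L^\bullet/L_{\mathrm{ev}}$, and $s$ is called $G$-extremal if there is exactly one $G$-orbit in $L^\bullet/L_{\mathrm{ev}}$ whose elements have stabilizer contained in $\ker(\operatorname{sn})$. $\varepsilon^h(A)=f(A\tau)/f(\tau)$ for a fixed branch $f$ of $\eta^h$. For rational $k,h$ with $k\equiv h/2\bmod\mathbb Z$, $J_{k,\underline L}(\varepsilon^h)$ is the space of holomorphic $\phi:\mathbb H\times(\mathbb C\otimes L)\to\mathbb C$ such that (i) $\phi(A\tau,\frac z{c\tau+d})=e\bigl(\frac{c\beta(z)}{c\tau+d}\bigr)(c\tau+d)^{k-h/2}\varepsilon^h(A)\phi(\tau,z)$ for all $A=\begin{pmatrix}a&b\\c&d\end{pmatrix}\in SL_2(\mathbb Z)$; (ii) $\phi(\tau,z+x\tau+y)=e(\beta(x+y))\,e(-\tau\beta(x)-\beta(x,z))\phi(\tau,z)$ for all $x,y\in L$; (iii) $\phi(\tau,z)=\sum_{n\in\frac h{24}+\mathbb Z}\sum_{r\in L^\bullet,\,n\ge\beta(r)}c(n,r)q^ne(\beta(r,z))$.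 *)

theory Defs
  imports "HOL-Analysis.Analysis" "HOL-Algebra.Group_Action"
begin

section \<open>Eta and theta\<close>

definition e2pi :: "complex \<Rightarrow> complex" where
  "e2pi x = exp (2 * of_real pi * \<i> * x)"

text \<open>Throughout, the power \<open>q ^ a\<close> for rational or complex \<open>a\<close> means \<open>e2pi (a * \<tau>)\<close>.\<close>

definition eta :: "complex \<Rightarrow> complex" where
  "eta \<tau> = e2pi (\<tau> / 24) * (\<Prod>n. 1 - e2pi (of_nat (Suc n) * \<tau>))"

text \<open>The Kronecker symbol \<open>(-4/r)\<close>.\<close>

definition kronecker_minus4 :: "int \<Rightarrow> int" where
  "kronecker_minus4 r = (if r mod 4 = 1 then 1 else if r mod 4 = 3 then -1 else 0)"

definition theta :: "complex \<Rightarrow> complex \<Rightarrow> complex" where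
  "theta \<tau> z = (\<Sum>\<^sub>\<infinity>r\<in>UNIV. of_int (kronecker_minus4 r)
      * e2pi (of_int (r\<^sup>2) / 8 * \<tau>) * e2pi (of_int r * z / 2))"

definition upper_half_plane :: "complex set" where
  "upper_half_plane = {\<tau>. Im \<tau> > 0}"

definition is_eta_power_branch :: "rat \<Rightarrow> (complex \<Rightarrow> complex) \<Rightarrow> bool" where
  "is_eta_power_branch h f \<longleftrightarrow>
     (\<exists>l. l holomorphic_on upper_half_plane \<and>
          (\<forall>\<tau>\<in>upper_half_plane. exp (l \<tau>) = eta \<tau> \<and> f \<tau> = exp (of_rat h * l \<tau>)))"

definition eta_power :: "rat \<Rightarrow> complex \<Rightarrow> complex" where
  "eta_power h = (SOME f. is_eta_power_branch h f)"

definition mobius :: "int \<Rightarrow> int \<Rightarrow> int \<Rightarrow> int \<Rightarrow> complex \<Rightarrow> complex" where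
  "mobius a b c d \<tau> = (of_int a * \<tau> + of_int b) / (of_int c * \<tau> + of_int d)"

text \<open>\<open>\<epsilon>\<^sup>h(A) = f(A\<tau>)/f(\<tau>)\<close> for \<open>A\<close> with rows \<open>(a, b)\<close> and \<open>(c, d)\<close>. It is a function of
  \<open>\<tau>\<close>: it contains the factor \<open>(c\<tau> + d) ^ (h/2)\<close>. Two branches of \<open>\<eta>\<^sup>h\<close> differ by a constant, so
  the quotient does not depend on the choice of \<open>f\<close>.\<close>

definition eta_multiplier :: "rat \<Rightarrow> int \<Rightarrow> int \<Rightarrow> int \<Rightarrow> int \<Rightarrow> complex \<Rightarrow> complex" where
  "eta_multiplier h a b c d \<tau> = eta_power h (mobius a b c d \<tau>) / eta_power h \<tau>"


section \<open>Integral lattices\<close>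

text \<open>The free module \<open>L\<close>, \<open>\<rat> \<otimes> L\<close> and \<open>\<complex> \<otimes> L\<close> all live in one type: \<open>'v\<close> is \<open>\<complex> \<otimes> L\<close>, a
  complex vector space with scalar multiplication \<open>smul\<close>, and \<open>L\<close> is the \<open>\<int>\<close>-span of a finite
  \<open>\<complex>\<close>-basis. The form \<open>\<beta>\<close> is the \<open>\<complex>\<close>-bilinear extension to \<open>'v\<close>. The norm of \<open>'v\<close> only
  provides the topology needed to speak of holomorphic functions; the space is
  finite-dimensional, so the choice of norm is irrelevant. Rank \<open>0\<close> is allowed.\<close>

locale integral_lattice = vector_space smul
  for smul :: "complex \<Rightarrow> 'v::real_normed_vector \<Rightarrow> 'v" +
  fixes L :: "'v set" and \<beta> :: "'v \<Rightarrow> 'v \<Rightarrow> complex"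
  assumes smul_of_real: "smul (of_real a) v = a *\<^sub>R v"
    and free: "\<exists>B. finite B \<and> independent B \<and> span B = UNIV \<and>
                 L = {\<Sum>b\<in>B. smul (of_int (m b)) b |m. True}"
    and linear: "Vector_Spaces.linear smul (*) (\<beta> x)"
    and symmetric: "\<beta> x y = \<beta> y x"
    and integral: "x \<in> L \<Longrightarrow> y \<in> L \<Longrightarrow> \<beta> x y \<in> \<int>"
    and nondegenerate: "x \<in> L \<Longrightarrow> (\<And>y. y \<in> L \<Longrightarrow> \<beta> x y = 0) \<Longrightarrow> x = 0"

text \<open>A \<open>\<int>\<close>-basis of \<open>L\<close> is a \<open>\<complex>\<close>-basis of its complex span.\<close>

definition lattice_rank :: "(complex \<Rightarrow> 'v::real_normed_vector \<Rightarrow> 'v) \<Rightarrow> 'v set \<Rightarrow> nat" where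
  "lattice_rank smul L = vector_space.dim smul L"

text \<open>Every element of \<open>\<rat> \<otimes> L\<close> is of the form \<open>a \<otimes> x\<close>.\<close>

definition rational_span :: "(complex \<Rightarrow> 'v::real_normed_vector \<Rightarrow> 'v) \<Rightarrow> 'v set \<Rightarrow> 'v set" where
  "rational_span smul L = {smul (of_rat a) x |a x. x \<in> L}"

definition quad :: "('v \<Rightarrow> 'v \<Rightarrow> complex) \<Rightarrow> 'v \<Rightarrow> complex" where
  "quad \<beta> x = \<beta> x x / 2"

definition dual_lattice ::
  "(complex \<Rightarrow> 'v::real_normed_vector \<Rightarrow> 'v) \<Rightarrow> 'v set \<Rightarrow> ('v \<Rightarrow> 'v \<Rightarrow> complex) \<Rightarrow> 'v set" where
  "dual_lattice smul L \<beta> = {y \<in> rational_span smul L. \<forall>x\<in>L. \<beta> y x \<in> \<int>}"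

definition even_sublattice :: "'v set \<Rightarrow> ('v \<Rightarrow> 'v \<Rightarrow> complex) \<Rightarrow> 'v set" where
  "even_sublattice L \<beta> = {x \<in> L. quad \<beta> x \<in> \<int>}"

definition shadow ::
  "(complex \<Rightarrow> 'v::real_normed_vector \<Rightarrow> 'v) \<Rightarrow> 'v set \<Rightarrow> ('v \<Rightarrow> 'v \<Rightarrow> complex) \<Rightarrow> 'v set" where
  "shadow smul L \<beta> = {r \<in> rational_span smul L. \<forall>x\<in>L. quad \<beta> x - \<beta> r x \<in> \<int>}"

definition even_coset ::
  "'v::real_normed_vector set \<Rightarrow> ('v \<Rightarrow> 'v \<Rightarrow> complex) \<Rightarrow> 'v \<Rightarrow> 'v set" where
  "even_coset L \<beta> w = (\<lambda>y. w + y) ` even_sublattice L \<beta>"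

definition shadow_quotient ::
  "(complex \<Rightarrow> 'v::real_normed_vector \<Rightarrow> 'v) \<Rightarrow> 'v set \<Rightarrow> ('v \<Rightarrow> 'v \<Rightarrow> complex) \<Rightarrow> 'v set set" where
  "shadow_quotient smul L \<beta> = even_coset L \<beta> ` shadow smul L \<beta>"

text \<open>Automorphisms of \<open>L\<close> are represented by their \<open>\<complex>\<close>-linear extensions to \<open>'v\<close>.\<close>

definition orthogonal_group ::
  "(complex \<Rightarrow> 'v::real_normed_vector \<Rightarrow> 'v) \<Rightarrow> 'v set \<Rightarrow> ('v \<Rightarrow> 'v \<Rightarrow> complex) \<Rightarrow> ('v \<Rightarrow> 'v) monoid"
  where
  "orthogonal_group smul L \<beta> =
     \<lparr>carrier = {g. Vector_Spaces.linear smul smul g \<and> bij_betw g L L \<and>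
                    (\<forall>x\<in>L. \<forall>y\<in>L. \<beta> (g x) (g y) = \<beta> x y)},
      mult = (\<circ>), one = id\<rparr>"


section \<open>Eutactic stars\<close>

definition eutactic_star ::
  "(complex \<Rightarrow> 'v::real_normed_vector \<Rightarrow> 'v) \<Rightarrow> 'v set \<Rightarrow> ('v \<Rightarrow> 'v \<Rightarrow> complex) \<Rightarrow>
   nat \<Rightarrow> (nat \<Rightarrow> 'v) \<Rightarrow> bool" where
  "eutactic_star smul L \<beta> N s \<longleftrightarrow>
     (\<forall>j\<in>{1..N}. s j \<in> dual_lattice smul L \<beta> \<and> s j \<noteq> 0) \<and>
     (\<forall>x\<in>rational_span smul L. x = (\<Sum>j=1..N. smul (\<beta> (s j) x) (s j)))"

definition signed_permutation ::
  "nat \<Rightarrow> (nat \<Rightarrow> 'v::real_normed_vector) \<Rightarrow> ('v \<Rightarrow> 'v) \<Rightarrow> (nat \<Rightarrow> nat) \<Rightarrow> (nat \<Rightarrow> int) \<Rightarrow> bool" where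
  "signed_permutation N s g \<sigma> \<epsilon> \<longleftrightarrow>
     \<sigma> permutes {1..N} \<and> (\<forall>j\<in>{1..N}. \<epsilon> j \<in> {1, -1} \<and> g (s j) = of_int (\<epsilon> j) *\<^sub>R s (\<sigma> j))"

definition invariant_up_to_signs ::
  "('v::real_normed_vector \<Rightarrow> 'v) set \<Rightarrow> nat \<Rightarrow> (nat \<Rightarrow> 'v) \<Rightarrow> bool" where
  "invariant_up_to_signs G N s \<longleftrightarrow> (\<forall>g\<in>G. \<exists>\<sigma> \<epsilon>. signed_permutation N s g \<sigma> \<epsilon>)"

text \<open>If some of the \<open>s j\<close> agree up to sign then \<open>\<sigma>\<close> and \<open>\<epsilon>\<close> are not determined by \<open>g\<close>, but the
  product of the signs still is, since the \<open>s j\<close> are nonzero.\<close>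

definition sn :: "nat \<Rightarrow> (nat \<Rightarrow> 'v::real_normed_vector) \<Rightarrow> ('v \<Rightarrow> 'v) \<Rightarrow> int" where
  "sn N s g = (THE p. \<exists>\<sigma> \<epsilon>. signed_permutation N s g \<sigma> \<epsilon> \<and> p = (\<Prod>j=1..N. \<epsilon> j))"

definition extremal ::
  "(complex \<Rightarrow> 'v::real_normed_vector \<Rightarrow> 'v) \<Rightarrow> 'v set \<Rightarrow> ('v \<Rightarrow> 'v \<Rightarrow> complex) \<Rightarrow>
   ('v \<Rightarrow> 'v) set \<Rightarrow> nat \<Rightarrow> (nat \<Rightarrow> 'v) \<Rightarrow> bool" where
  "extremal smul L \<beta> G N s \<longleftrightarrow>
     (let GG = orthogonal_group smul L \<beta> \<lparr>carrier := G\<rparr>; act = (\<lambda>g C. g ` C) in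
      \<exists>!orb. orb \<in> orbits GG (shadow_quotient smul L \<beta>) act \<and>
             (\<forall>C\<in>orb. stabilizer GG act C \<subseteq> {g \<in> G. sn N s g = 1}))"


section \<open>Jacobi forms of lattice index\<close>

text \<open>Holomorphic on \<open>\<H> \<times> (\<complex> \<otimes> L)\<close>: at every point the (real) total derivative exists and is
  \<open>\<complex>\<close>-linear.\<close>

definition holomorphic_on_jacobi_domain ::
  "(complex \<Rightarrow> 'v::real_normed_vector \<Rightarrow> 'v) \<Rightarrow> (complex \<Rightarrow> 'v \<Rightarrow> complex) \<Rightarrow> bool" where
  "holomorphic_on_jacobi_domain smul \<phi> \<longleftrightarrow>
     (\<forall>\<tau>\<in>upper_half_plane. \<forall>z. \<exists>D.
        ((\<lambda>(t, v). \<phi> t v) has_derivative D) (at (\<tau>, z)) \<and>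
        (\<forall>c t v. D (c * t, smul c v) = c * D (t, v)))"

text \<open>The space \<open>J\<^bsub>k,L\<^esub>(\<epsilon>\<^sup>h)\<close>, defined for \<open>k \<equiv> h/2 mod \<int>\<close>, so that \<open>k - h/2\<close> is an integer. Only the
  values on the upper half plane matter. For \<open>r\<close> in the shadow \<open>quad \<beta> r\<close> is a rational number,
  so \<open>Re\<close> only changes its type.\<close>

definition jacobi_forms ::
  "(complex \<Rightarrow> 'v::real_normed_vector \<Rightarrow> 'v) \<Rightarrow> 'v set \<Rightarrow> ('v \<Rightarrow> 'v \<Rightarrow> complex) \<Rightarrow>
   rat \<Rightarrow> rat \<Rightarrow> (complex \<Rightarrow> 'v \<Rightarrow> complex) set" where
  "jacobi_forms smul L \<beta> k h = {\<phi>.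
     holomorphic_on_jacobi_domain smul \<phi> \<and>
     (\<forall>a b c d :: int. a * d - b * c = 1 \<longrightarrow>
        (\<forall>\<tau>\<in>upper_half_plane. \<forall>z.
           let j = of_int c * \<tau> + of_int d in
           \<phi> (mobius a b c d \<tau>) (smul (1 / j) z) =
             e2pi (of_int c * quad \<beta> z / j) * j powi \<lfloor>k - h / 2\<rfloor>
             * eta_multiplier h a b c d \<tau> * \<phi> \<tau> z)) \<and>
     (\<forall>\<tau>\<in>upper_half_plane. \<forall>z. \<forall>x\<in>L. \<forall>y\<in>L.
        \<phi> \<tau> (z + smul \<tau> x + y) =
          e2pi (quad \<beta> (x + y)) * e2pi (- \<tau> * quad \<beta> x - \<beta> x z) * \<phi> \<tau> z) \<and>
     (\<exists>coeff :: rat \<Rightarrow> 'v \<Rightarrow> complex. \<forall>\<tau>\<in>upper_half_plane. \<forall>z.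
        ((\<lambda>(m, r). coeff m r * e2pi (of_rat m * \<tau>) * e2pi (\<beta> r z)) has_sum \<phi> \<tau> z)
          {(m, r). m - h / 24 \<in> \<int> \<and> r \<in> shadow smul L \<beta> \<and> Re (quad \<beta> r) \<le> of_rat m})}"

end

(* Write u_j = beta(s_j, z) and Phi = prod_j theta(tau, u_j). Multiplying out the theta series gives
   eta^(n-N) Phi = sum_x C_x(tau) q^beta(x) e(beta(x,z)), where x runs over the half-integral combinations
   (1/2) sum_j r_j s_j with all r_j odd. Reindexing r shows that C_x depends only on x modulo L_ev and that
   C_(gx) = sn(g) C_x; so C_x vanishes whenever the stabilizer of x + L_ev is not contained in ker sn, and
   G-extremality leaves a single orbit. Hence eta^(n-N) Phi = h(tau) Theta(tau, z), where Theta is a constant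
   coefficient combination of the q^beta(x) e(beta(x,z)).

   No modularity is needed to see that h is constant: Theta is annihilated by the heat operator
   d/dtau - (1/(4 pi i)) sum_k (d/ds_k)^2. Applying it to the product and letting z tend to 0 along a ray
   expresses h'/h through the Laurent coefficients of theta'/theta at 0. Since (beta(s_i,s_j)) is a projection
   of trace n and theta'(tau,0) = 2 pi i eta^3 satisfies the heat equation as well, everything cancels.

   The transformation law of theta under SL_2(Z) follows from Liouville's theorem applied to the quotient of
   both sides as functions of z, the zeros of theta being known from the Jacobi triple product; the factor
   (eta(A tau)/eta(tau))^3 is read off from the derivative at z = 0, so the weight of eta never enters. *)

theory Submission
  imports Defs "HOL-Complex_Analysis.Complex_Analysis"
begin

text \<open>Since N may exceed n, many multi-indices r give the same x, so a Fourier coefficient of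
  the product is in general an infinite sum depending on tau. Extremality only says that, up to
  constants and powers of q, all coefficients share one unknown function of tau. In the code this
  function omits the eta power: \<open>h\<close> is the coefficient at \<open>w\<close> without
  q^beta(w), and the aim is h'/h = (N - n) eta'/eta.

  The cancellation is numerical. Near 0 one has theta'/theta = 1/u + b u + ..., while theta''/theta
  tends to 3 b, where 3 b = theta'''(0)/theta'(0) = 12 pi i eta'/eta. In (Laplacian - 4 pi i d/dtau)
  of the product, divided by the product, the cross terms of these expansions contribute 2 b (N - n)
  and the second derivatives -3 b (N - n), together (n - N) b.

  Everything on the lattice side rests on beta(x,y) = sum_j beta(s_j,x) beta(s_j,y). It forces beta
  >= 0 on the rational span, which supplies nonnegative exponents of q, and it makes sum_k
  (d/ds_k)^2 the Laplacian of beta. The Fourier exponents turn out to be exactly beta(r), so the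
  growth condition of a Jacobi form holds with equality.\<close>

section \<open>Series of exponentials\<close>

text \<open>By Weierstrass's convergence theorem a majorant of the terms also controls their
  derivatives, so convergence of the differentiated series is part of the conclusion.\<close>

lemma DERIV_infsum:
  fixes f :: "'a \<Rightarrow> complex \<Rightarrow> complex"
  assumes "open A" "z \<in> A"
    and deriv: "\<And>x w. x \<in> X \<Longrightarrow> w \<in> A \<Longrightarrow> (f x has_field_derivative f' x w) (at w)"
    and bound: "\<And>x w. x \<in> X \<Longrightarrow> w \<in> A \<Longrightarrow> norm (f x w) \<le> M x" and M: "M summable_on X"
  shows "\<exists>D. ((\<lambda>w. \<Sum>\<^sub>\<infinity>x\<in>X. f x w) has_field_derivative D) (at z) \<and> ((\<lambda>x. f' x z) has_sum D) X"
proof -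
  define S where "S = (\<lambda>w. \<Sum>\<^sub>\<infinity>x\<in>X. f x w)"
  have ul: "uniform_limit A (\<lambda>X w. \<Sum>x\<in>X. f x w) S (finite_subsets_at_top X)"
    unfolding S_def by (rule Weierstrass_m_test_general[OF bound M])
  have ev: "\<forall>\<^sub>F F in finite_subsets_at_top X. finite F \<and> F \<subseteq> X"
    by (simp add: eventually_finite_subsets_at_top_weakI)
  have dsum: "((\<lambda>w. \<Sum>x\<in>F. f x w) has_field_derivative (\<Sum>x\<in>F. f' x w)) (at w)"
    if "F \<subseteq> X" "w \<in> A" for F w
    using that by (intro DERIV_sum deriv) auto
  have hol: "\<forall>\<^sub>F F in finite_subsets_at_top X. (\<lambda>w. \<Sum>x\<in>F. f x w) holomorphic_on A"
    using ev by eventually_elim (use dsum assms(1) in \<open>auto simp: holomorphic_on_open\<close>)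
  obtain r where r: "r > 0" "cball z r \<subseteq> A"
    using assms(1,2) open_contains_cball by blast
  have "S holomorphic_on ball z r"
  proof -
    have 1: "\<forall>\<^sub>F F in finite_subsets_at_top X. continuous_on (cball z r) (\<lambda>w. \<Sum>x\<in>F. f x w) \<and> (\<lambda>w. \<Sum>x\<in>F. f x w) holomorphic_on ball z r"
      using hol
    proof eventually_elim
      case (elim F)
      have "(\<lambda>w. \<Sum>x\<in>F. f x w) holomorphic_on cball z r" "ball z r \<subseteq> cball z r"
        using elim r(2) holomorphic_on_subset by auto
      then show ?case
        by (meson holomorphic_on_imp_continuous_on holomorphic_on_subset)
    qed
    show ?thesis
      by (rule holomorphic_uniform_limit[OF 1 uniform_limit_on_subset[OF ul r(2)]]) auto
  qed
  then have dS: "(S has_field_derivative deriv S z) (at z)"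
    using r(1) by (intro holomorphic_derivI[where S = "ball z r"]) auto
  have "((\<lambda>F. (deriv ^^ 1) (\<lambda>w. \<Sum>x\<in>F. f x w) z) \<longlongrightarrow> (deriv ^^ 1) S z) (finite_subsets_at_top X)"
    by (rule higher_deriv_complex_uniform_limit[OF ul hol _ assms(1,2)]) auto
  then have "((\<lambda>F. deriv (\<lambda>w. \<Sum>x\<in>F. f x w) z) \<longlongrightarrow> deriv S z) (finite_subsets_at_top X)"
    by simp
  moreover have "\<forall>\<^sub>F F in finite_subsets_at_top X. deriv (\<lambda>w. \<Sum>x\<in>F. f x w) z = (\<Sum>x\<in>F. f' x z)"
    using ev by eventually_elim (use assms(2) in \<open>auto intro!: DERIV_imp_deriv dsum\<close>)
  ultimately have "((\<lambda>x. f' x z) has_sum deriv S z) X"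
    unfolding has_sum_def by (simp cong: filterlim_cong tendsto_cong)
  with dS show ?thesis unfolding S_def by blast
qed

text \<open>A common model for theta, indexed by integers, and for a lattice theta series restricted
  to a line. Summability is demanded for every real \<open>y\<close> and every \<open>v > 0\<close>;
  this makes the class stable under multiplying the coefficients by the frequencies, hence under
  termwise differentiation.\<close>

locale exp_series =
  fixes X :: "'a set" and a :: "'a \<Rightarrow> complex" and \<alpha> b :: "'a \<Rightarrow> real"
  assumes nonneg: "x \<in> X \<Longrightarrow> \<alpha> x \<ge> 0"
    and summable_term: "v > 0 \<Longrightarrow> (\<lambda>x. norm (a x) * exp (- \<alpha> x * v - b x * y)) summable_on X"
begin

definition exp_term :: "complex \<Rightarrow> complex \<Rightarrow> 'a \<Rightarrow> complex" where
  "exp_term \<tau> u x = a x * exp (\<i> * (of_real (\<alpha> x) * \<tau> + of_real (b x) * u))"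

definition exp_sum :: "complex \<Rightarrow> complex \<Rightarrow> complex" where
  "exp_sum \<tau> u = (\<Sum>\<^sub>\<infinity>x\<in>X. exp_term \<tau> u x)"

lemma norm_exp_term: "norm (exp_term \<tau> u x) = norm (a x) * exp (- \<alpha> x * Im \<tau> - b x * Im u)"
  by (simp add: exp_term_def norm_mult algebra_simps)

lemma abs_summable_exp_term: "Im \<tau> > 0 \<Longrightarrow> (\<lambda>x. norm (exp_term \<tau> u x)) summable_on X"
  unfolding norm_exp_term by (rule summable_term)

lemma has_sum_exp_sum: "Im \<tau> > 0 \<Longrightarrow> (exp_term \<tau> u has_sum exp_sum \<tau> u) X"
  unfolding exp_sum_def by (rule has_sum_infsum[OF abs_summable_summable[OF abs_summable_exp_term]])

text \<open>A real exponential on [-R, R] is largest at an endpoint, so the two boundary values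
  together dominate the whole strip |Im u| <= R.\<close>

definition majorant :: "real \<Rightarrow> real \<Rightarrow> 'a \<Rightarrow> real" where
  "majorant v R x = norm (a x) * exp (- \<alpha> x * v - b x * R) + norm (a x) * exp (- \<alpha> x * v - b x * (-R))"

lemma summable_majorant: "v > 0 \<Longrightarrow> majorant v R summable_on X"
  unfolding majorant_def by (intro summable_on_add summable_term)

lemma exp_term_le_majorant:
  assumes "x \<in> X" "v \<le> Im \<tau>" "\<bar>Im u\<bar> \<le> R"
  shows "norm (exp_term \<tau> u x) \<le> majorant v R x"
proof -
  have 1: "\<alpha> x * v \<le> \<alpha> x * Im \<tau>"
    using assms nonneg by (intro mult_left_mono) auto
  have "\<bar>b x * Im u\<bar> \<le> \<bar>b x\<bar> * R"
    using assms(3) by (simp add: abs_mult mult_left_mono)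
  then have "- (b x * Im u) \<le> - (b x * R) \<or> - (b x * Im u) \<le> - (b x * (-R))"
    by (cases "b x \<ge> 0") (auto simp: abs_le_iff)
  then have "- \<alpha> x * Im \<tau> - b x * Im u \<le> - \<alpha> x * v - b x * R \<or>
     - \<alpha> x * Im \<tau> - b x * Im u \<le> - \<alpha> x * v - b x * (-R)"
    using 1 by auto
  then have "exp (- \<alpha> x * Im \<tau> - b x * Im u) \<le> exp (- \<alpha> x * v - b x * R) + exp (- \<alpha> x * v - b x * (-R))"
    by (meson add_increasing add_increasing2 exp_ge_zero exp_le_cancel_iff)
  then show ?thesis
    unfolding norm_exp_term majorant_def by (metis distrib_left mult_left_mono norm_ge_zero)
qed

lemma continuous_exp_sum: "continuous_on ({\<tau>. Im \<tau> > 0} \<times> UNIV) (\<lambda>(\<tau>, u). exp_sum \<tau> u)"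
proof -
  let ?H = "{\<tau>. Im \<tau> > 0} \<times> UNIV :: (complex \<times> complex) set"
  have op: "open ?H" by (intro open_Times open_halfspace_Im_gt) auto
  have "isCont (\<lambda>(\<tau>, u). exp_sum \<tau> u) (\<tau>0, u0)" if "Im \<tau>0 > 0" for \<tau>0 u0
  proof -
    define v where "v = Im \<tau>0 / 2"
    define R where "R = \<bar>Im u0\<bar> + 1"
    define U where "U = {p :: complex \<times> complex. v < Im (fst p) \<and> \<bar>Im (snd p)\<bar> < R}"
    have U: "open U" "(\<tau>0, u0) \<in> U"
      unfolding U_def using that by (auto intro!: open_Collect_conj open_Collect_less continuous_intros simp: v_def R_def)
    have "uniform_limit U (\<lambda>F p. \<Sum>x\<in>F. exp_term (fst p) (snd p) x) (\<lambda>p. \<Sum>\<^sub>\<infinity>x\<in>X. exp_term (fst p) (snd p) x)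
       (finite_subsets_at_top X)"
      by (rule Weierstrass_m_test_general[where M = "majorant v R"])
        (use that in \<open>auto intro!: exp_term_le_majorant summable_majorant simp: U_def v_def\<close>)
    then have "continuous_on U (\<lambda>p. \<Sum>\<^sub>\<infinity>x\<in>X. exp_term (fst p) (snd p) x)"
      by (rule uniform_limit_theorem[rotated])
        (auto intro!: always_eventually continuous_intros simp: exp_term_def)
    then show ?thesis
      using U by (simp add: continuous_on_eq_continuous_at exp_sum_def case_prod_unfold)
  qed
  then show ?thesis
    by (subst continuous_on_eq_continuous_at[OF op]) (simp add: split_paired_Ball_Sigma)
qed

text \<open>Because |b| <= exp(-b) + exp(b), the extra factor costs only a shift of \<open>y\<close>
  by 1 in either direction.\<close>

lemma exp_series_mult_b: "exp_series X (\<lambda>x. \<i> * of_real (b x) * a x) \<alpha> b"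
proof
  fix v y :: real assume v: "v > 0"
  show "(\<lambda>x. norm (\<i> * of_real (b x) * a x) * exp (- \<alpha> x * v - b x * y)) summable_on X"
  proof (rule summable_on_comparison_test)
    show "(\<lambda>x. norm (a x) * exp (- \<alpha> x * v - b x * (y + 1)) + norm (a x) * exp (- \<alpha> x * v - b x * (y - 1))) summable_on X"
      using v by (intro summable_on_add summable_term)
    fix x
    have "\<bar>b x\<bar> \<le> exp (- b x) + exp (b x)"
      using exp_ge_add_one_self[of "b x"] exp_ge_add_one_self[of "- b x"] exp_gt_zero[of "b x"] exp_gt_zero[of "- b x"] by linarith
    then have "\<bar>b x\<bar> * (norm (a x) * exp (- \<alpha> x * v - b x * y)) \<le> (exp (- b x) + exp (b x)) * (norm (a x) * exp (- \<alpha> x * v - b x * y))"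
      by (intro mult_right_mono) auto
    also have "\<dots> = norm (a x) * (exp (- b x) * exp (- \<alpha> x * v - b x * y)) + norm (a x) * (exp (b x) * exp (- \<alpha> x * v - b x * y))"
      by (simp add: algebra_simps)
    also have "exp (- b x) * exp (- \<alpha> x * v - b x * y) = exp (- \<alpha> x * v - b x * (y + 1))"
      by (simp add: algebra_simps flip: exp_add)
    also have "exp (b x) * exp (- \<alpha> x * v - b x * y) = exp (- \<alpha> x * v - b x * (y - 1))"
      by (simp add: algebra_simps flip: exp_add)
    finally show "norm (\<i> * of_real (b x) * a x) * exp (- \<alpha> x * v - b x * y)
       \<le> norm (a x) * exp (- \<alpha> x * v - b x * (y + 1)) + norm (a x) * exp (- \<alpha> x * v - b x * (y - 1))"
      by (simp add: norm_mult algebra_simps)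
  qed simp
qed (rule nonneg)

text \<open>The factor \<alpha> is at most (2/v) exp(\<alpha> v/2), so it is paid for with half of
  the decay in \<open>v\<close>.\<close>

lemma exp_series_mult_\<alpha>: "exp_series X (\<lambda>x. \<i> * of_real (\<alpha> x) * a x) \<alpha> b"
proof
  fix v y :: real assume v: "v > 0"
  show "(\<lambda>x. norm (\<i> * of_real (\<alpha> x) * a x) * exp (- \<alpha> x * v - b x * y)) summable_on X"
  proof (rule summable_on_comparison_test)
    show "(\<lambda>x. 2 / v * (norm (a x) * exp (- \<alpha> x * (v / 2) - b x * y))) summable_on X"
      using v by (intro summable_on_cmult_right summable_term) auto
    fix x assume x: "x \<in> X"
    have "\<alpha> x * (v / 2) \<le> exp (\<alpha> x * (v / 2))"
      using exp_ge_add_one_self[of "\<alpha> x * (v/2)"] by linarith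
    then have "\<alpha> x \<le> 2 / v * exp (\<alpha> x * (v / 2))"
      using v by (simp add: field_simps)
    then have "\<alpha> x * (norm (a x) * exp (- \<alpha> x * v - b x * y)) \<le> 2 / v * exp (\<alpha> x * (v / 2)) * (norm (a x) * exp (- \<alpha> x * v - b x * y))"
      by (intro mult_right_mono) auto
    also have "\<dots> = 2 / v * (norm (a x) * (exp (\<alpha> x * (v / 2)) * exp (- \<alpha> x * v - b x * y)))"
      by simp
    also have "exp (\<alpha> x * (v / 2)) * exp (- \<alpha> x * v - b x * y) = exp (- \<alpha> x * (v / 2) - b x * y)"
      by (simp add: field_simps flip: exp_add)
    finally show "norm (\<i> * of_real (\<alpha> x) * a x) * exp (- \<alpha> x * v - b x * y)
       \<le> 2 / v * (norm (a x) * exp (- \<alpha> x * (v / 2) - b x * y))"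
      using nonneg[OF x] by (simp add: norm_mult algebra_simps)
  qed simp
qed (rule nonneg)

lemma exp_sum_deriv_u:
  assumes "Im \<tau> > 0"
  shows "((\<lambda>u. exp_sum \<tau> u) has_field_derivative exp_series.exp_sum X (\<lambda>x. \<i> * of_real (b x) * a x) \<alpha> b \<tau> u) (at u)"
proof -
  interpret D: exp_series X "\<lambda>x. \<i> * of_real (b x) * a x" \<alpha> b by (rule exp_series_mult_b)
  define R where "R = \<bar>Im u\<bar> + 1"
  have "\<exists>D. ((\<lambda>w. \<Sum>\<^sub>\<infinity>x\<in>X. exp_term \<tau> w x) has_field_derivative D) (at u) \<and> ((\<lambda>x. D.exp_term \<tau> u x) has_sum D) X"
    by (rule DERIV_infsum[where A = "{w. \<bar>Im w\<bar> < R}" and M = "majorant (Im \<tau>) R"])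
      (use assms in \<open>auto intro!: derivative_eq_intros open_Collect_less continuous_intros exp_term_le_majorant[unfolded exp_term_def] summable_majorant
         simp: R_def exp_term_def D.exp_term_def\<close>)
  then obtain D' where D': "((\<lambda>w. exp_sum \<tau> w) has_field_derivative D') (at u)" "(D.exp_term \<tau> u has_sum D') X"
    unfolding exp_sum_def by blast
  have "D' = D.exp_sum \<tau> u"
    by (rule has_sum_unique[OF D'(2) D.has_sum_exp_sum[OF assms]])
  then show ?thesis
    using D'(1) by simp
qed

lemma exp_sum_deriv_\<tau>:
  assumes "Im \<tau> > 0"
  shows "((\<lambda>\<tau>. exp_sum \<tau> u) has_field_derivative exp_series.exp_sum X (\<lambda>x. \<i> * of_real (\<alpha> x) * a x) \<alpha> b \<tau> u) (at \<tau>)"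
proof -
  interpret D: exp_series X "\<lambda>x. \<i> * of_real (\<alpha> x) * a x" \<alpha> b by (rule exp_series_mult_\<alpha>)
  have "\<exists>D. ((\<lambda>w. \<Sum>\<^sub>\<infinity>x\<in>X. exp_term w u x) has_field_derivative D) (at \<tau>) \<and> ((\<lambda>x. D.exp_term \<tau> u x) has_sum D) X"
    by (rule DERIV_infsum[where A = "{w. Im \<tau> / 2 < Im w}" and M = "majorant (Im \<tau> / 2) \<bar>Im u\<bar>"])
      (use assms in \<open>auto intro!: derivative_eq_intros open_Collect_less continuous_intros exp_term_le_majorant[unfolded exp_term_def] summable_majorant
         simp: exp_term_def D.exp_term_def\<close>)
  then obtain D' where D': "((\<lambda>w. exp_sum w u) has_field_derivative D') (at \<tau>)" "(D.exp_term \<tau> u has_sum D') X"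
    unfolding exp_sum_def by blast
  have "D' = D.exp_sum \<tau> u"
    by (rule has_sum_unique[OF D'(2) D.has_sum_exp_sum[OF assms]])
  then show ?thesis
    using D'(1) by simp
qed

end

section \<open>Analytic preliminaries\<close>

text \<open>Tannery's theorem: the partial sums converge uniformly in \<open>m\<close>, so the two
  limits may be interchanged. It carries the finite Jacobi identity over to the triple
  product.\<close>

lemma tendsto_infsum_dominated:
  fixes f :: "'b \<Rightarrow> 'a \<Rightarrow> 'c :: banach"
  assumes lim: "\<And>k. k \<in> X \<Longrightarrow> ((\<lambda>m. f m k) \<longlongrightarrow> g k) G" and "G \<noteq> bot"
    and bound: "\<And>m k. k \<in> X \<Longrightarrow> norm (f m k) \<le> M k" and M: "M summable_on X"
  shows "((\<lambda>m. \<Sum>\<^sub>\<infinity>k\<in>X. f m k) \<longlongrightarrow> (\<Sum>\<^sub>\<infinity>k\<in>X. g k)) G"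
proof -
  have "norm (g k) \<le> M k" if "k \<in> X" for k
    using tendsto_norm[OF lim[OF that]] by (rule tendsto_upperbound) (use assms that in auto)
  then have "g summable_on X"
    by (intro abs_summable_summable[OF summable_on_comparison_test[OF M]]) auto
  then have g: "((\<lambda>F. \<Sum>k\<in>F. g k) \<longlongrightarrow> (\<Sum>\<^sub>\<infinity>k\<in>X. g k)) (finite_subsets_at_top X)"
    by (rule infsum_tendsto)
  have ev: "\<forall>\<^sub>F F in finite_subsets_at_top X. ((\<lambda>m. \<Sum>k\<in>F. f m k) \<longlongrightarrow> (\<Sum>k\<in>F. g k)) G"
    by (rule eventually_finite_subsets_at_top_weakI) (auto intro!: tendsto_sum lim)
  show ?thesis
    by (rule swap_uniform_limit'[OF ev g Weierstrass_m_test_general[where Y = UNIV, OF bound M]]) auto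
qed

lemma summable_on_gaussian_int:
  fixes c d :: real
  assumes "c > 0"
  shows "(\<lambda>r::int. exp (- c * (of_int r)\<^sup>2 + d * of_int r)) summable_on UNIV"
proof -
  \<comment> \<open>\<open>K\<close> is the maximum of (|d| + 1) x - c x^2 over real x; completing
    the square bounds the Gaussian term by exp(K) exp(-|r|).\<close>
  define K where "K = (\<bar>d\<bar> + 1)\<^sup>2 / (4 * c)"
  have nat: "(\<lambda>n::nat. exp (- real n)) summable_on UNIV"
  proof (rule norm_summable_imp_summable_on)
    have "summable (\<lambda>n. exp (-1::real) ^ n)" by (rule summable_geometric) simp
    then show "summable (\<lambda>n. norm (exp (- real n)))" by (simp flip: exp_of_nat_mult)
  qed
  have "(\<lambda>r::int. exp (- \<bar>of_int r\<bar> :: real)) summable_on (range int \<union> range (\<lambda>n. - int n))"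
  proof (rule summable_on_union)
    show "(\<lambda>r::int. exp (- \<bar>of_int r\<bar> :: real)) summable_on range int"
      by (subst summable_on_reindex) (use nat in \<open>auto simp: o_def\<close>)
    show "(\<lambda>r::int. exp (- \<bar>of_int r\<bar> :: real)) summable_on range (\<lambda>n. - int n)"
      by (subst summable_on_reindex) (use nat in \<open>auto simp: o_def inj_on_def\<close>)
  qed
  moreover have "range int \<union> range (\<lambda>n. - int n) = UNIV"
    by (auto intro: int_cases2)
  ultimately have "(\<lambda>r::int. exp K * exp (- \<bar>of_int r\<bar> :: real)) summable_on UNIV"
    by (intro summable_on_cmult_right) auto
  then show ?thesis
  proof (rule summable_on_comparison_test)
    fix r :: int
    have "0 \<le> c * (\<bar>of_int r\<bar> - (\<bar>d\<bar> + 1) / (2 * c))\<^sup>2"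
      using assms by simp
    also have "\<dots> = c * (of_int r)\<^sup>2 - (\<bar>d\<bar> + 1) * \<bar>of_int r\<bar> + K"
      using assms by (simp add: K_def power2_diff field_simps power2_eq_square)
    finally have "- c * (of_int r)\<^sup>2 + d * of_int r \<le> K - \<bar>of_int r\<bar> + (d * of_int r - \<bar>d\<bar> * \<bar>of_int r\<bar>)"
      by (simp add: algebra_simps)
    also have "d * of_int r \<le> \<bar>d\<bar> * \<bar>of_int r\<bar>"
      by (metis abs_ge_self abs_mult)
    finally show "exp (- c * (of_int r)\<^sup>2 + d * of_int r) \<le> exp K * exp (- \<bar>of_int r\<bar> :: real)"
      by (simp flip: exp_add)
  qed auto
qed

lemma periodic_of_int:
  fixes f :: "complex \<Rightarrow> 'a"
  assumes "\<And>z. f (z + w) = f z"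
  shows "f (z + of_int n * w) = f z"
proof (induction n rule: int_induct[where k = 0])
  case (step1 i)
  then show ?case using assms[of "z + of_int i * w"] by (simp add: algebra_simps)
next
  case (step2 i)
  then show ?case using assms[of "z + of_int (i - 1) * w"] by (simp add: algebra_simps)
qed simp

text \<open>With equal automorphy factors the quotient F/T has periods 1 and \<tau>; it extends to
  an entire function because the zeros of T are simple and are zeros of F. A bounded entire function
  is constant.\<close>

lemma quasiperiodic_proportional:
  fixes F T :: "complex \<Rightarrow> complex"
  assumes F: "F holomorphic_on UNIV" and T: "T holomorphic_on UNIV"
    and zero: "\<And>z. T z = 0 \<Longrightarrow> deriv T z \<noteq> 0 \<and> F z = 0"
    and p: "\<And>z. p z \<noteq> 0" "\<And>z. F (z + 1) = p z * F z" "\<And>z. T (z + 1) = p z * T z"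
    and r: "\<And>z. r z \<noteq> 0" "\<And>z. F (z + \<tau>) = r z * F z" "\<And>z. T (z + \<tau>) = r z * T z"
    and \<tau>: "Im \<tau> > 0"
  obtains c where "\<And>z. F z = c * T z"
proof -
  \<comment> \<open>At a zero of T the value is the limit given by l'Hospital's rule, which makes
    \<open>R\<close> continuous and hence entire.\<close>
  define R where "R = (\<lambda>z. if T z = 0 then deriv F z / deriv T z else F z / T z)"
  have D: "(F has_field_derivative deriv F z) (at z)" "(T has_field_derivative deriv T z) (at z)" for z
    using F T by (auto intro: holomorphic_derivI)
  have nz: "\<exists>e>0. \<forall>w\<in>ball z e - {z}. T w \<noteq> 0" for z
  proof (cases "T z = 0")
    case True
    then obtain e where "e > 0" "inj_on T (ball z e)"
      using has_complex_derivative_locally_injective[OF T _ open_UNIV] zero by blast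
    with True show ?thesis
      by (metis DiffE centre_in_ball inj_onD insertI1)
  next
    case False
    have "isCont T z" using D by (auto intro: DERIV_isCont)
    then obtain e where "e > 0" "\<And>w. dist z w < e \<Longrightarrow> T w \<noteq> 0"
      using continuous_at_avoid[of z T 0] False by blast
    then show ?thesis by (intro exI[of _ e]) auto
  qed
  have R_hol: "R holomorphic_on UNIV"
  proof -
    have "R field_differentiable (at z)" for z
    proof -
      obtain e where e: "e > 0" "\<And>w. w \<in> ball z e - {z} \<Longrightarrow> T w \<noteq> 0" using nz by blast
      have "(R \<longlongrightarrow> R z) (at z)"
      proof (rule Lim_transform_within_open[where s = "ball z e" and f = "\<lambda>w. F w / T w"])
        show "((\<lambda>w. F w / T w) \<longlongrightarrow> R z) (at z)"
        proof (cases "T z = 0")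
          case True
          with zero have "((\<lambda>w. F w / T w) \<longlongrightarrow> deriv F z / deriv T z) (at z)"
            by (intro lhopital_complex_simple[OF D]) auto
          with True show ?thesis by (simp add: R_def)
        next
          case False
          then have "isCont (\<lambda>w. F w / T w) z"
            using D by (intro continuous_intros) (auto intro: DERIV_isCont)
          with False show ?thesis by (simp add: isCont_def R_def)
        qed
      qed (use e in \<open>auto simp: R_def\<close>)
      then have lim: "(R \<longlongrightarrow> R w) (at w within ball z e)" if "w \<in> {z}" for w
        using that by (auto intro: tendsto_mono[OF at_le])
      have "R holomorphic_on (ball z e - {z})"
      proof (rule holomorphic_transform[where f = "\<lambda>w. F w / T w"])
        show "(\<lambda>w. F w / T w) holomorphic_on ball z e - {z}"
          using e by (intro holomorphic_intros holomorphic_on_subset[OF F] holomorphic_on_subset[OF T]) auto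
      qed (use e in \<open>auto simp: R_def\<close>)
      with lim have "R holomorphic_on ball z e"
        by (rule no_isolated_singularity') auto
      then show ?thesis
        using e(1) by (intro holomorphic_on_imp_differentiable_at[of R "ball z e"]) simp_all
    qed
    then show ?thesis by (simp add: holomorphic_on_def)
  qed
  have eq: "F z = R z * T z" for z using zero[of z] by (auto simp: R_def)
  \<comment> \<open>Periodicity is immediate where T does not vanish. At a zero of T it follows by
    continuity from a punctured neighbourhood.\<close>
  have per: "R (z + w) = R z" if "\<And>z. q z \<noteq> 0" "\<And>z. F (z + w) = q z * F z" "\<And>z. T (z + w) = q z * T z" for w q z
  proof -
    obtain e where e: "e > 0" "\<And>w. w \<in> ball z e - {z} \<Longrightarrow> T w \<noteq> 0" using nz by blast
    have "continuous_on UNIV R"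
      using R_hol by (rule holomorphic_on_imp_continuous_on)
    then have "continuous_on UNIV (\<lambda>y. R (y + w) - R y)"
      by (intro continuous_on_diff continuous_on_compose2[of UNIV R UNIV "\<lambda>y. y + w"] continuous_on_add continuous_on_id continuous_on_const) auto
    then have "((\<lambda>y. R (y + w) - R y) \<longlongrightarrow> R (z + w) - R z) (at z)"
      by (simp add: continuous_on_eq_continuous_at isCont_def)
    moreover have "((\<lambda>y. R (y + w) - R y) \<longlongrightarrow> 0) (at z)"
    proof (rule Lim_transform_within_open[where s = "ball z e" and f = "\<lambda>_. 0"])
      fix y assume "y \<in> ball z e" "y \<noteq> z"
      then have "T y \<noteq> 0" using e by auto
      with that[of y] show "0 = R (y + w) - R y" by (simp add: R_def)
    qed (use e in auto)
    ultimately have "R (z + w) - R z = 0"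
      by (rule tendsto_unique[rotated]) simp
    then show ?thesis by simp
  qed
  have per1: "R (z + of_int m * 1 + of_int n * \<tau>) = R z" for z m n
    using periodic_of_int[of R \<tau>, OF per[OF r]] periodic_of_int[of R 1, OF per[OF p]] by metis
  \<comment> \<open>The closed fundamental parallelogram of the lattice spanned by 1 and \<tau>; by
    periodicity \<open>R\<close> takes all its values there.\<close>
  define K where "K = (\<lambda>(x, y). of_real x + of_real y * \<tau>) ` ({0..1::real} \<times> {0..1::real})"
  have "compact K"
    unfolding K_def by (intro compact_continuous_image compact_Times continuous_intros) (auto simp: case_prod_unfold intro!: continuous_intros)
  then have "compact (R ` K)"
    using R_hol by (meson compact_continuous_image continuous_on_subset holomorphic_on_imp_continuous_on subset_UNIV)
  moreover have "range R \<subseteq> R ` K"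
  proof safe
    fix z
    define y where "y = Im z / Im \<tau>"
    define x where "x = Re z - y * Re \<tau>"
    have z: "z = of_real x + of_real y * \<tau>"
      using \<tau> by (simp add: complex_eq_iff x_def y_def)
    have "R z = R (z + of_int (- \<lfloor>x\<rfloor>) * 1 + of_int (- \<lfloor>y\<rfloor>) * \<tau>)" by (rule per1[symmetric])
    also have "z + of_int (- \<lfloor>x\<rfloor>) * 1 + of_int (- \<lfloor>y\<rfloor>) * \<tau> = of_real (frac x) + of_real (frac y) * \<tau>"
      by (simp add: z frac_def algebra_simps)
    finally have "R z = R (of_real (frac x) + of_real (frac y) * \<tau>)" .
    moreover have "of_real (frac x) + of_real (frac y) * \<tau> \<in> K"
      unfolding K_def by (rule image_eqI[of _ _ "(frac x, frac y)"]) (simp_all add: frac_lt_1 less_imp_le)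
    ultimately show "R z \<in> R ` K" by blast
  qed
  ultimately have "bounded (range R)"
    using bounded_subset compact_imp_bounded by blast
  then obtain c where "\<And>z. R z = c"
    using Liouville_theorem[OF R_hol] by (auto simp: constant_on_def)
  with eq that show ?thesis by metis
qed

text \<open>The induction rests on the span of the smaller set being closed: the new vector then has
  positive distance from it, which bounds its coordinate. The norm of \<open>'v\<close> is
  arbitrary, so this is what later gives continuity of the linear forms \<beta> y.\<close>

lemma finite_independent_coordinates_bounded:
  fixes C :: "'v :: real_normed_vector set"
  assumes "finite C" "independent C"
  shows "\<exists>K\<ge>0. \<forall>m. (\<Sum>c\<in>C. \<bar>m c\<bar>) \<le> K * norm (\<Sum>c\<in>C. m c *\<^sub>R c)"
  using assms
proof induction
  case (insert b C)
  then obtain K where K: "K \<ge> 0" "\<And>m. (\<Sum>c\<in>C. \<bar>m c\<bar>) \<le> K * norm (\<Sum>c\<in>C. m c *\<^sub>R c)"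
    by (auto simp: independent_insert)
  \<comment> \<open>By the induction hypothesis the coordinates of a convergent sequence are Cauchy,
    so the limit is the combination of the limiting coordinates.\<close>
  have "closed (span C)"
  proof (unfold closed_sequential_limits, safe)
    fix x l assume x: "\<forall>n. x n \<in> span C" "x \<longlonglongrightarrow> l"
    have "\<exists>m. x n = (\<Sum>c\<in>C. m c *\<^sub>R c)" for n
      using x(1) insert.hyps(1) by (auto simp: span_finite)
    then obtain m where m: "\<And>n. x n = (\<Sum>c\<in>C. m n c *\<^sub>R c)" by metis
    have "\<exists>t. (\<lambda>n. m n c) \<longlonglongrightarrow> t" if "c \<in> C" for c
    proof -
      have le: "\<bar>m i c - m j c\<bar> \<le> K * norm (x i - x j)" for i j
      proof -
        have "\<bar>m i c - m j c\<bar> \<le> (\<Sum>c\<in>C. \<bar>m i c - m j c\<bar>)"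
          using that insert.hyps(1) by (intro member_le_sum) auto
        also have "\<dots> \<le> K * norm (\<Sum>c\<in>C. (m i c - m j c) *\<^sub>R c)" by (rule K(2))
        finally show ?thesis by (simp add: m scaleR_diff_left sum_subtractf)
      qed
      have "Cauchy (\<lambda>n. m n c)"
      proof (rule metric_CauchyI)
        fix e :: real assume "e > 0"
        then have "e / (K + 1) > 0" using K by simp
        then obtain M where M: "\<And>i j. i \<ge> M \<Longrightarrow> j \<ge> M \<Longrightarrow> norm (x i - x j) < e / (K + 1)"
          using metric_CauchyD[OF LIMSEQ_imp_Cauchy[OF x(2)]] unfolding dist_norm by meson
        show "\<exists>M. \<forall>i\<ge>M. \<forall>j\<ge>M. dist (m i c) (m j c) < e"
        proof (intro exI[of _ M] allI impI)
          fix i j assume "i \<ge> M" "j \<ge> M"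
          then have "(K + 1) * norm (x i - x j) < e"
            using M[of i j] K by (simp add: field_simps)
          moreover have "K * norm (x i - x j) \<le> (K + 1) * norm (x i - x j)"
            by (intro mult_right_mono) auto
          ultimately show "dist (m i c) (m j c) < e"
            using le[of i j] by (simp add: dist_norm)
        qed
      qed
      then show ?thesis by (simp add: Cauchy_convergent_iff convergent_def)
    qed
    then obtain t where t: "\<And>c. c \<in> C \<Longrightarrow> (\<lambda>n. m n c) \<longlonglongrightarrow> t c" by metis
    have "x \<longlonglongrightarrow> (\<Sum>c\<in>C. t c *\<^sub>R c)"
      unfolding m by (intro tendsto_sum tendsto_scaleR t tendsto_const) auto
    then have "l = (\<Sum>c\<in>C. t c *\<^sub>R c)" using x(2) LIMSEQ_unique by blast
    then show "l \<in> span C" by (simp add: span_sum span_base span_scale)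
  qed
  moreover have "b \<notin> span C" using insert by (auto simp: independent_insert)
  ultimately obtain d where d: "d > 0" "ball b d \<subseteq> - span C"
    by (metis ComplI open_Compl open_contains_ball)
  then have d: "d > 0" "\<And>w. w \<in> span C \<Longrightarrow> d \<le> dist b w"
    by (auto simp: subset_iff not_less[symmetric])
  have b: "\<bar>t\<bar> * d \<le> norm (t *\<^sub>R b + w)" if "w \<in> span C" for t w
  proof (cases "t = 0")
    case False
    have "d \<le> norm (b - (- (1 / t)) *\<^sub>R w)"
      using d(2)[OF span_scale[OF that]] by (metis dist_norm)
    then have "\<bar>t\<bar> * d \<le> norm (t *\<^sub>R (b - (- (1 / t)) *\<^sub>R w))"
      by (simp add: mult_left_mono)
    with False show ?thesis by (simp add: algebra_simps)
  qed simp
  \<comment> \<open>The summand 1/d bounds the coordinate of \<open>b\<close>, whose distance from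
    the span is at least d; 1 + norm b / d bounds the norm of the remaining part \<open>w\<close>
    relative to that of x.\<close>
  define K' where "K' = 1 / d + K * (1 + norm b / d)"
  have "(\<Sum>c\<in>insert b C. \<bar>m c\<bar>) \<le> K' * norm (\<Sum>c\<in>insert b C. m c *\<^sub>R c)" for m
  proof -
    define w where "w = (\<Sum>c\<in>C. m c *\<^sub>R c)"
    define x where "x = m b *\<^sub>R b + w"
    have "w \<in> span C" unfolding w_def by (simp add: span_sum span_base span_scale)
    then have 1: "\<bar>m b\<bar> \<le> norm x / d" using b[of w "m b"] d(1) by (simp add: x_def field_simps)
    have "norm w \<le> norm x + \<bar>m b\<bar> * norm b"
      using norm_triangle_ineq4[of x "m b *\<^sub>R b"] by (simp add: x_def)
    also have "\<dots> \<le> norm x + norm x / d * norm b" using mult_right_mono[OF 1, of "norm b"] by simp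
    finally have "K * norm w \<le> K * (norm x + norm x / d * norm b)" using K(1) by (rule mult_left_mono)
    then have "(\<Sum>c\<in>C. \<bar>m c\<bar>) \<le> K * (norm x + norm x / d * norm b)"
      using K(2)[of m] by (simp add: w_def)
    with 1 have "\<bar>m b\<bar> + (\<Sum>c\<in>C. \<bar>m c\<bar>) \<le> K' * norm x"
      by (simp add: K'_def field_simps)
    then show ?thesis using insert.hyps by (simp add: x_def w_def)
  qed
  moreover have "K' \<ge> 0" using d K by (simp add: K'_def)
  ultimately show ?case by blast
qed (auto intro: exI[of _ 0])

lemma linear_imp_bounded_linear_finite_span:
  fixes f :: "'v :: real_normed_vector \<Rightarrow> 'w :: real_normed_vector" and S :: "'v set"
  assumes "linear f" "finite S" "span S = UNIV"
  shows "bounded_linear f"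
proof -
  obtain C where C: "C \<subseteq> S" "independent C" "span C = UNIV"
    using maximal_independent_subset[of S] assms(3) by (metis span_minimal subspace_span top.extremum_uniqueI)
  have fin: "finite C" using C(1) assms(2) by (rule finite_subset)
  obtain K where K: "K \<ge> 0" "\<And>m. (\<Sum>c\<in>C. \<bar>m c\<bar>) \<le> K * norm (\<Sum>c\<in>C. m c *\<^sub>R c)"
    using finite_independent_coordinates_bounded[OF fin C(2)] by blast
  define M where "M = (\<Sum>c\<in>C. norm (f c))"
  have "norm (f x) \<le> norm x * (K * M)" for x
  proof -
    obtain m where m: "x = (\<Sum>c\<in>C. m c *\<^sub>R c)"
      using C(3) fin by (auto simp: span_finite)
    have "f x = (\<Sum>c\<in>C. m c *\<^sub>R f c)"
      unfolding m by (simp add: linear_sum[OF assms(1)] linear_scale[OF assms(1)])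
    then have "norm (f x) \<le> (\<Sum>c\<in>C. \<bar>m c\<bar> * norm (f c))"
      by (simp add: sum_norm_le)
    also have "\<dots> \<le> (\<Sum>c\<in>C. \<bar>m c\<bar> * M)"
      unfolding M_def using fin by (intro sum_mono mult_left_mono member_le_sum) auto
    also have "\<dots> \<le> K * norm x * M"
      using K(2)[of m] by (simp add: m M_def mult_right_mono sum_nonneg flip: sum_distrib_right)
    finally show ?thesis by (simp add: mult_ac)
  qed
  then show ?thesis
    by (intro bounded_linear_intro[of f "K * M"] linear_add[OF assms(1)] linear_scale[OF assms(1)])
qed

section \<open>The theta function\<close>

lemma e2pi_add: "e2pi (x + y) = e2pi x * e2pi y"
  by (simp add: e2pi_def exp_add algebra_simps)

lemma e2pi_0 [simp]: "e2pi 0 = 1" and e2pi_nonzero [simp]: "e2pi x \<noteq> 0"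
  by (simp_all add: e2pi_def)

lemma e2pi_minus: "e2pi (- x) = inverse (e2pi x)"
  by (simp add: e2pi_def exp_minus)

lemma e2pi_diff: "e2pi (x - y) = e2pi x / e2pi y"
  by (simp add: e2pi_def exp_diff algebra_simps)

lemma e2pi_sum: "finite A \<Longrightarrow> e2pi (sum f A) = (\<Prod>x\<in>A. e2pi (f x))"
  by (induction A rule: finite_induct) (auto simp: e2pi_add)

lemma e2pi_of_nat_mult: "e2pi (of_nat n * x) = e2pi x ^ n"
  by (simp add: e2pi_def flip: exp_of_nat_mult) (simp add: algebra_simps)

lemma norm_e2pi: "norm (e2pi x) = exp (- (2 * pi * Im x))"
  by (simp add: e2pi_def)

lemma e2pi_eq_1_iff: "e2pi x = 1 \<longleftrightarrow> x \<in> \<int>"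
proof -
  have "e2pi x = 1 \<longleftrightarrow> (\<exists>n::int. Im x = 0 \<and> Re x = of_int n)"
    by (auto simp: e2pi_def exp_eq_1)
  also have "\<dots> \<longleftrightarrow> x \<in> \<int>"
    by (auto simp: Ints_def complex_eq_iff)
  finally show ?thesis .
qed

lemma e2pi_of_int [simp]: "e2pi (of_int n) = 1"
  by (simp add: e2pi_eq_1_iff)

lemma e2pi_eq_iff: "e2pi x = e2pi y \<longleftrightarrow> x - y \<in> \<int>"
  by (simp add: e2pi_diff flip: e2pi_eq_1_iff)

lemma e2pi_eqI: "x - y \<in> \<int> \<Longrightarrow> e2pi x = e2pi y"
  by (simp add: e2pi_eq_iff)

lemma has_field_derivative_e2pi [derivative_intros]:
  assumes "(f has_field_derivative D) (at z within A)"
  shows "((\<lambda>z. e2pi (f z)) has_field_derivative 2 * of_real pi * \<i> * D * e2pi (f z)) (at z within A)"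
  unfolding e2pi_def using assms by (auto intro!: derivative_eq_intros)

lemma holomorphic_on_e2pi [holomorphic_intros]: "f holomorphic_on A \<Longrightarrow> (\<lambda>z. e2pi (f z)) holomorphic_on A"
  unfolding e2pi_def by (intro holomorphic_intros)

lemma continuous_on_e2pi [continuous_intros]: "continuous_on A f \<Longrightarrow> continuous_on A (\<lambda>z. e2pi (f z))"
  unfolding e2pi_def by (intro continuous_intros)

lemma e2pi_half: "e2pi (1 / 2) = -1"
  by (simp add: e2pi_def mult.commute)

text \<open>On r = 2 k + 1 the character is (-1)^k. Written as an exponential it can be merged with
  the other exponents.\<close>

lemma kronecker_odd: "of_int (kronecker_minus4 (2 * k + 1)) = e2pi (of_int k / 2)"
proof (cases "even k")
  case True
  then obtain j where j: "k = 2 * j" by blast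
  have "kronecker_minus4 (2 * k + 1) = 1"
    unfolding kronecker_minus4_def j by presburger
  then show ?thesis by (simp add: j)
next
  case False
  then obtain j where j: "k = 2 * j + 1" by (blast elim: oddE)
  have "kronecker_minus4 (2 * k + 1) = -1"
    unfolding kronecker_minus4_def j by presburger
  then show ?thesis
    by (simp add: j add_divide_distrib e2pi_add e2pi_half)
qed

lemma kronecker_even: "even r \<Longrightarrow> kronecker_minus4 r = 0"
  unfolding kronecker_minus4_def by presburger

lemma kronecker_neq_0_imp_odd: "kronecker_minus4 r \<noteq> 0 \<Longrightarrow> odd r"
  using kronecker_even by blast

lemma kronecker_minus: "kronecker_minus4 (- r) = - kronecker_minus4 r"
  unfolding kronecker_minus4_def by presburger

lemma kronecker_shift: "of_int (kronecker_minus4 (r + 2 * m)) = of_int (kronecker_minus4 r) * e2pi (of_int m / 2)"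
proof (cases "even r")
  case False
  then obtain k where "r = 2 * k + 1" by (blast elim: oddE)
  then show ?thesis
    using kronecker_odd[of "k + m"] kronecker_odd[of k] by (simp add: e2pi_add add_divide_distrib algebra_simps)
qed (simp add: kronecker_even)

lemma kronecker_mult_e2pi:
  "of_int (kronecker_minus4 r) * e2pi (of_int r * of_int l / 2) = of_int (kronecker_minus4 r) * e2pi (of_int l / 2)"
proof (cases "even r")
  case False
  then obtain k where k: "r = 2 * k + 1" by (blast elim: oddE)
  have "e2pi (of_int r * of_int l / 2) = e2pi (of_int l / 2)"
    by (rule e2pi_eqI) (auto simp: k field_simps intro!: Ints_mult)
  then show ?thesis by simp
qed (simp add: kronecker_even)

lemma exp_series_theta:
  "exp_series UNIV (\<lambda>r. of_int (kronecker_minus4 r)) (\<lambda>r. pi * (of_int r)\<^sup>2 / 4) (\<lambda>r. pi * of_int r)"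
proof
  fix v y :: real assume "v > 0"
  then have "(\<lambda>r::int. exp (- (pi * v / 4) * (of_int r)\<^sup>2 + (- pi * y) * of_int r)) summable_on UNIV"
    by (intro summable_on_gaussian_int) simp
  then show "(\<lambda>r. norm (of_int (kronecker_minus4 r) :: complex) * exp (- (pi * (of_int r)\<^sup>2 / 4) * v - pi * of_int r * y)) summable_on UNIV"
    by (rule summable_on_comparison_test)
      (auto simp: kronecker_minus4_def algebra_simps)
qed simp

interpretation theta: exp_series UNIV "\<lambda>r. of_int (kronecker_minus4 r)" "\<lambda>r. pi * (of_int r)\<^sup>2 / 4" "\<lambda>r. pi * of_int r"
  by (rule exp_series_theta)

lemma theta_exp_term:
  "theta.exp_term \<tau> u r = of_int (kronecker_minus4 r) * e2pi (of_int (r\<^sup>2) / 8 * \<tau>) * e2pi (of_int r * u / 2)"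
  by (simp add: theta.exp_term_def e2pi_def algebra_simps flip: exp_add)

lemma theta_eq_exp_sum: "theta \<tau> u = theta.exp_sum \<tau> u"
  by (simp add: theta_def theta.exp_sum_def theta_exp_term)

text \<open>Completing the square, r^2/8 + r m/2 + m^2/2 = (r + 2 m)^2/8, so translating u amounts
  to shifting the summation index by 2 m. That shift multiplies the character by (-1)^m, and r l has
  the parity of l because only odd r contribute.\<close>

lemma theta_quasiperiodic:
  "theta \<tau> (u + of_int m * \<tau> + of_int l) =
     e2pi ((of_int m + of_int l) / 2 - of_int m ^ 2 * \<tau> / 2 - of_int m * u) * theta \<tau> u"
proof -
  let ?t = "theta.exp_term"
  have "?t \<tau> (u + of_int m * \<tau> + of_int l) r =
     e2pi ((of_int m + of_int l) / 2 - of_int m ^ 2 * \<tau> / 2 - of_int m * u) * ?t \<tau> u (r + 2 * m)" for r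
  proof -
    have "?t \<tau> (u + of_int m * \<tau> + of_int l) r = (of_int (kronecker_minus4 r) * e2pi (of_int r * of_int l / 2)) *
        e2pi (of_int (r\<^sup>2) / 8 * \<tau> + of_int r * (u + of_int m * \<tau>) / 2)"
      by (simp add: theta_exp_term add_divide_distrib ring_distribs e2pi_add)
    also have "\<dots> = of_int (kronecker_minus4 r) *
        e2pi (of_int l / 2 + (of_int (r\<^sup>2) / 8 * \<tau> + of_int r * (u + of_int m * \<tau>) / 2))"
      by (simp add: kronecker_mult_e2pi e2pi_add)
    also have "\<dots> = of_int (kronecker_minus4 r) * e2pi (of_int m / 2) *
       e2pi (((of_int m + of_int l) / 2 - of_int m ^ 2 * \<tau> / 2 - of_int m * u) + (of_int ((r + 2 * m)\<^sup>2) / 8 * \<tau> + of_int (r + 2 * m) * u / 2))"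
    proof -
      have "e2pi (of_int l / 2 + (of_int (r\<^sup>2) / 8 * \<tau> + of_int r * (u + of_int m * \<tau>) / 2)) =
        e2pi (of_int m / 2 + (((of_int m + of_int l) / 2 - of_int m ^ 2 * \<tau> / 2 - of_int m * u) + (of_int ((r + 2 * m)\<^sup>2) / 8 * \<tau> + of_int (r + 2 * m) * u / 2)))"
        (is "e2pi ?x = e2pi ?y")
      proof (rule e2pi_eqI)
        have "?x - ?y = - of_int m" by (simp add: field_simps power2_eq_square)
        then show "?x - ?y \<in> \<int>" by simp
      qed
      then show ?thesis by (simp add: e2pi_add)
    qed
    also have "\<dots> = e2pi ((of_int m + of_int l) / 2 - of_int m ^ 2 * \<tau> / 2 - of_int m * u) * ?t \<tau> u (r + 2 * m)"
      unfolding theta_exp_term kronecker_shift e2pi_add by (simp only: mult_ac)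
    finally show ?thesis .
  qed
  then have "theta \<tau> (u + of_int m * \<tau> + of_int l) =
     e2pi ((of_int m + of_int l) / 2 - of_int m ^ 2 * \<tau> / 2 - of_int m * u) * (\<Sum>\<^sub>\<infinity>r. ?t \<tau> u (r + 2 * m))"
    by (simp only: theta_eq_exp_sum theta.exp_sum_def infsum_cmult_right')
  also have "(\<Sum>\<^sub>\<infinity>r. ?t \<tau> u (r + 2 * m)) = (\<Sum>\<^sub>\<infinity>r. ?t \<tau> u r)"
    by (rule infsum_reindex_bij_witness[where i = "\<lambda>r. r - 2 * m" and j = "\<lambda>r. r + 2 * m"]) auto
  finally show ?thesis by (simp add: theta_eq_exp_sum theta.exp_sum_def)
qed

section \<open>The Jacobi triple product\<close>

definition euler_partial :: "complex \<Rightarrow> nat \<Rightarrow> complex" where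
  "euler_partial \<tau> m = (\<Prod>k<m. 1 - e2pi (of_nat (Suc k) * \<tau>))"

definition euler_prod :: "complex \<Rightarrow> complex" where
  "euler_prod \<tau> = (\<Prod>n. 1 - e2pi (of_nat (Suc n) * \<tau>))"

text \<open>This is 1/(q;q)_j. The value 0 for negative j makes the recursion
  \<open>euler_inverse_step\<close> hold for all integers; at j = 0 both sides vanish.\<close>

definition euler_inverse :: "complex \<Rightarrow> int \<Rightarrow> complex" where
  "euler_inverse \<tau> j = (if j < 0 then 0 else inverse (euler_partial \<tau> (nat j)))"

text \<open>With zeta = e(u) this is (-1)^k q^(k(k+1)/2) zeta^k, the theta term of index 2 k + 1
  without the common factor q^(1/8) zeta^(1/2).\<close>

definition jacobi_term :: "complex \<Rightarrow> complex \<Rightarrow> int \<Rightarrow> complex" where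
  "jacobi_term \<tau> u k = e2pi (of_int k / 2 + of_int (k * (k + 1)) / 2 * \<tau> + of_int k * u)"

lemma summable_norm_e2pi:
  assumes "Im \<tau> > 0"
  shows "summable (\<lambda>n. norm (e2pi (of_nat n * \<tau> + w)))"
proof -
  have "norm (e2pi \<tau>) < 1" using assms by (simp add: norm_e2pi)
  then have "summable (\<lambda>n. norm (e2pi w) * norm (e2pi \<tau>) ^ n)"
    by (intro summable_mult summable_geometric) simp
  then show ?thesis
    by (simp add: e2pi_add e2pi_of_nat_mult norm_mult norm_power mult.commute[of "norm (e2pi w)"])
qed

lemma convergent_prod_e2pi:
  assumes "Im \<tau> > 0"
  shows "convergent_prod (\<lambda>n. 1 - e2pi (of_nat n * \<tau> + w))"
proof -
  have "summable (\<lambda>n. norm ((1 - e2pi (of_nat n * \<tau> + w)) - 1))"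
    using summable_norm_e2pi[OF assms] by simp
  then show ?thesis
    by (intro abs_convergent_prod_imp_convergent_prod summable_imp_abs_convergent_prod)
qed

abbreviation theta_factor :: "complex \<Rightarrow> complex \<Rightarrow> complex" where
  "theta_factor \<tau> w \<equiv> \<Prod>n. 1 - e2pi (of_nat n * \<tau> + w)"

lemma LIMSEQ_prod_e2pi:
  assumes "Im \<tau> > 0"
  shows "(\<lambda>m. \<Prod>n<m. 1 - e2pi (of_nat n * \<tau> + w)) \<longlonglongrightarrow> theta_factor \<tau> w"
  using convergent_prod_LIMSEQ[OF convergent_prod_e2pi[OF assms]]
  by (subst filterlim_sequentially_Suc[symmetric]) (simp only: lessThan_Suc_atMost)

lemma of_nat_Suc_mult: "of_nat (Suc n) * \<tau> = of_nat n * \<tau> + (\<tau> :: complex)"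
  by (simp add: algebra_simps)

context
  fixes \<tau> :: complex
  assumes \<tau>: "Im \<tau> > 0"
begin

lemma e2pi_Suc_neq_1: "1 - e2pi (of_nat (Suc k) * \<tau>) \<noteq> 0"
proof -
  have "norm (e2pi (of_nat (Suc k) * \<tau>)) < 1"
    using \<tau> by (simp add: norm_e2pi del: of_nat_Suc)
  then show ?thesis by auto
qed

lemma euler_partial_nonzero: "euler_partial \<tau> m \<noteq> 0"
  unfolding euler_partial_def using e2pi_Suc_neq_1 by simp

lemma euler_partial_LIMSEQ: "euler_partial \<tau> \<longlonglongrightarrow> euler_prod \<tau>"
  using LIMSEQ_prod_e2pi[OF \<tau>, of \<tau>] unfolding euler_partial_def euler_prod_def of_nat_Suc_mult .

lemma euler_prod_nonzero: "euler_prod \<tau> \<noteq> 0"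
  unfolding euler_prod_def
proof (rule prodinf_nonzero)
  show "convergent_prod (\<lambda>n. 1 - e2pi (of_nat (Suc n) * \<tau>))"
    unfolding of_nat_Suc_mult by (rule convergent_prod_e2pi[OF \<tau>])
qed (rule e2pi_Suc_neq_1)

lemma euler_inverse_step: "euler_inverse \<tau> (j - 1) = (1 - e2pi (of_int j * \<tau>)) * euler_inverse \<tau> j"
proof -
  consider "j < 0" | "j = 0" | n where "j = int (Suc n)"
    by (metis linorder_neqE_linordered_idom gr0_implies_Suc zero_less_imp_eq_int)
  then show ?thesis
  proof cases
    case 3
    then show ?thesis
      using e2pi_Suc_neq_1[of n] euler_partial_nonzero[of n]
      by (simp add: euler_inverse_def euler_partial_def nat_add_distrib)
  qed (auto simp: euler_inverse_def)
qed

text \<open>Multiplying by the monomial of a new linear factor moves the index by one. This identity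
  and its companion \<open>jacobi_term_down\<close> bring the moved terms back to index
  \<open>k\<close> at the price of a power of q.\<close>

lemma jacobi_term_up: "jacobi_term \<tau> u (k - 1) * (- e2pi (u + of_int m * \<tau>)) = jacobi_term \<tau> u k * e2pi (of_int (m - k) * \<tau>)"
proof -
  have "jacobi_term \<tau> u (k - 1) * (- e2pi (u + of_int m * \<tau>)) =
    e2pi (1 / 2 + ((of_int k - 1) / 2 + (of_int k - 1) * of_int k / 2 * \<tau> + (of_int k - 1) * u + (u + of_int m * \<tau>)))"
    by (simp add: jacobi_term_def e2pi_add e2pi_half)
  also have "1 / 2 + ((of_int k - 1) / 2 + (of_int k - 1) * of_int k / 2 * \<tau> + (of_int k - 1) * u + (u + of_int m * \<tau>))
     = of_int k / 2 + of_int (k * (k + 1)) / 2 * \<tau> + of_int k * u + of_int (m - k) * \<tau>"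
    by (simp add: field_simps)
  finally show ?thesis by (simp only: jacobi_term_def e2pi_add)
qed

lemma jacobi_term_down: "jacobi_term \<tau> u (k + 1) * (- e2pi (of_int m * \<tau> - u)) = jacobi_term \<tau> u k * e2pi (of_int (m + k + 1) * \<tau>)"
proof -
  have "jacobi_term \<tau> u (k + 1) * (- e2pi (of_int m * \<tau> - u)) =
    e2pi (- 1 / 2) * e2pi (((of_int k + 1) / 2 + (of_int k + 1) * (of_int k + 2) / 2 * \<tau> + (of_int k + 1) * u + (of_int m * \<tau> - u)))"
    using e2pi_minus[of "1/2"] by (simp add: jacobi_term_def e2pi_add e2pi_diff e2pi_half add.commute)
  also have "\<dots> = e2pi (- 1 / 2 + ((of_int k + 1) / 2 + (of_int k + 1) * (of_int k + 2) / 2 * \<tau> + (of_int k + 1) * u + (of_int m * \<tau> - u)))"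
    by (simp only: e2pi_add)
  also have "- 1 / 2 + ((of_int k + 1) / 2 + (of_int k + 1) * (of_int k + 2) / 2 * \<tau> + (of_int k + 1) * u + (of_int m * \<tau> - u))
     = of_int k / 2 + of_int (k * (k + 1)) / 2 * \<tau> + of_int k * u + of_int (m + k + 1) * \<tau>"
    by (simp add: field_simps)
  finally show ?thesis by (simp only: jacobi_term_def e2pi_add)
qed

text \<open>The terms on the left are the Gaussian binomial coefficients \<open>(2m choose m + k)\<close> times the terms of
  the theta series; \<open>euler_inverse\<close> vanishes at negative integers, so the sum is finite.\<close>

lemma finite_jacobi_identity:
  "((\<lambda>k. jacobi_term \<tau> u k * (euler_partial \<tau> (2 * m) * euler_inverse \<tau> (int m + k) * euler_inverse \<tau> (int m - k))) has_sum
     (\<Prod>j<m. (1 - e2pi (of_nat j * \<tau> + (u + \<tau>))) * (1 - e2pi (of_nat j * \<tau> + (- u))))) UNIV"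
proof (induction m)
  case 0
  have "((\<lambda>k. jacobi_term \<tau> u k * (euler_partial \<tau> 0 * euler_inverse \<tau> k * euler_inverse \<tau> (- k))) has_sum 1) UNIV"
    by (rule has_sum_finite_neutralI[where B = "{0}"])
      (auto simp: euler_inverse_def euler_partial_def jacobi_term_def)
  then show ?case by simp
next
  case (Suc m)
  define f where "f = (\<lambda>m k. jacobi_term \<tau> u k * (euler_partial \<tau> (2 * m) * euler_inverse \<tau> (int m + k) * euler_inverse \<tau> (int m - k)))"
  define p where "p = (\<Prod>j<m. (1 - e2pi (of_nat j * \<tau> + (u + \<tau>))) * (1 - e2pi (of_nat j * \<tau> + (- u))))"
  \<comment> \<open>The factors added in passing to \<open>Suc m\<close> are 1 - X and 1 - Y with X
    Y = Q. Their product is 1 + Q - X - Y, so the new coefficient at k combines the old ones at k, k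
    - 1 and k + 1.\<close>
  define Q where "Q = e2pi (of_int (2 * int m + 1) * \<tau>)"
  define X where "X = e2pi (u + of_int (int m + 1) * \<tau>)"
  define Y where "Y = e2pi (of_int (int m) * \<tau> - u)"
  have IH: "(f m has_sum p) UNIV" using Suc by (simp add: f_def p_def)
  have up: "((\<lambda>k. f m (k - 1)) has_sum p) UNIV"
    by (subst has_sum_reindex_bij_witness[of UNIV "\<lambda>k. k + 1" "\<lambda>k. k - 1" UNIV "f m" _ p p]) (use IH in auto)
  have down: "((\<lambda>k. f m (k + 1)) has_sum p) UNIV"
    by (subst has_sum_reindex_bij_witness[of UNIV "\<lambda>k. k - 1" "\<lambda>k. k + 1" UNIV "f m" _ p p]) (use IH in auto)
  have "((\<lambda>k. f m k * (1 + Q) + f m (k - 1) * (- X) + f m (k + 1) * (- Y)) has_sum (p * (1 + Q) + p * (- X) + p * (- Y))) UNIV"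
    by (intro has_sum_add has_sum_cmult_left IH up down)
  also have "(\<lambda>k. f m k * (1 + Q) + f m (k - 1) * (- X) + f m (k + 1) * (- Y)) = f (Suc m)"
  proof
    fix k
    \<comment> \<open>\<open>a\<close> and \<open>b\<close> are the arguments of the two inverses at
      level \<open>Suc m\<close>. With x = q^a and y = q^b the claim reduces to the rational
      identity (1-x)(1-y)(1+xy/q) + y(1-x/q)(1-x) + x(1-y/q)(1-y) = (1-xy/q)(1-xy).\<close>
    define a where "a = int m + 1 + k"
    define b where "b = int m + 1 - k"
    define x where "x = e2pi (of_int a * \<tau>)"
    define y where "y = e2pi (of_int b * \<tau>)"
    define q where "q = e2pi \<tau>"
    have [simp]: "q \<noteq> 0" by (simp add: q_def)
    have xq: "e2pi (of_int (a - 1) * \<tau>) = x / q" "e2pi (of_int (b - 1) * \<tau>) = y / q"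
      by (simp_all add: x_def y_def q_def left_diff_distrib e2pi_diff)
    have "Q = e2pi (of_int a * \<tau> + of_int b * \<tau> - \<tau>)"
      unfolding Q_def by (rule arg_cong[of _ _ e2pi]) (simp add: a_def b_def algebra_simps)
    then have Q: "Q = x * y / q" by (simp add: e2pi_add e2pi_diff x_def y_def q_def)
    have xy: "e2pi (of_nat (2 * m + 2) * \<tau>) = x * y" "e2pi (of_nat (2 * m + 1) * \<tau>) = x * y / q"
    proof -
      have "of_nat (2 * m + 2) * \<tau> = of_int a * \<tau> + of_int b * \<tau>" by (simp add: a_def b_def algebra_simps)
      then show "e2pi (of_nat (2 * m + 2) * \<tau>) = x * y" by (simp add: x_def y_def e2pi_add)
      have "of_nat (2 * m + 1) * \<tau> = of_int a * \<tau> + of_int b * \<tau> - \<tau>" by (simp add: a_def b_def algebra_simps)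
      then show "e2pi (of_nat (2 * m + 1) * \<tau>) = x * y / q" by (simp add: x_def y_def e2pi_add e2pi_diff q_def)
    qed
    define A where "A = euler_inverse \<tau> a"
    define B where "B = euler_inverse \<tau> b"
    define P where "P = euler_partial \<tau> (2 * m)"
    define t where "t = jacobi_term \<tau> u k"
    have a1: "euler_inverse \<tau> (a - 1) = (1 - x) * A" and a2: "euler_inverse \<tau> (a - 1 - 1) = (1 - x / q) * ((1 - x) * A)"
      and b1: "euler_inverse \<tau> (b - 1) = (1 - y) * B" and b2: "euler_inverse \<tau> (b - 1 - 1) = (1 - y / q) * ((1 - y) * B)"
      by (simp_all only: euler_inverse_step xq A_def B_def x_def y_def)
    have P: "euler_partial \<tau> (2 * Suc m) = P * (1 - x * y / q) * (1 - x * y)"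
    proof -
      have "2 * Suc m = Suc (Suc (2 * m))" by simp
      then have "euler_partial \<tau> (2 * Suc m) = P * (1 - e2pi (of_nat (2 * m + 1) * \<tau>)) * (1 - e2pi (of_nat (2 * m + 2) * \<tau>))"
        by (simp add: euler_partial_def P_def)
      then show ?thesis by (simp only: xy)
    qed
    have f0: "f m k = t * (P * ((1 - x) * A) * ((1 - y) * B))"
      using a1 b1 by (simp add: f_def t_def P_def a_def b_def)
    have "f m (k - 1) * (- X) = (jacobi_term \<tau> u (k - 1) * (- X)) * (P * euler_inverse \<tau> (a - 1 - 1) * B)"
      by (simp add: f_def P_def a_def b_def B_def algebra_simps)
    also have "jacobi_term \<tau> u (k - 1) * (- X) = t * y"
      unfolding X_def jacobi_term_up by (simp add: t_def y_def b_def)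
    finally have f1: "f m (k - 1) * (- X) = t * y * (P * ((1 - x / q) * ((1 - x) * A)) * B)" by (simp only: a2)
    have "f m (k + 1) * (- Y) = (jacobi_term \<tau> u (k + 1) * (- Y)) * (P * A * euler_inverse \<tau> (b - 1 - 1))"
      by (simp add: f_def P_def a_def b_def A_def algebra_simps)
    also have "jacobi_term \<tau> u (k + 1) * (- Y) = t * x"
      unfolding Y_def jacobi_term_down by (simp add: t_def x_def a_def add_ac)
    finally have f2: "f m (k + 1) * (- Y) = t * x * (P * A * ((1 - y / q) * ((1 - y) * B)))" by (simp only: b2)
    have f3: "f (Suc m) k = t * (P * (1 - x * y / q) * (1 - x * y) * A * B)"
      unfolding f_def P by (simp add: t_def A_def B_def a_def b_def add_ac)
    show "f m k * (1 + Q) + f m (k - 1) * (- X) + f m (k + 1) * (- Y) = f (Suc m) k"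
      unfolding f0 f1 f2 f3 Q by (simp add: field_simps)
  qed
  also have "p * (1 + Q) + p * (- X) + p * (- Y) = p * ((1 - e2pi (of_nat m * \<tau> + (u + \<tau>))) * (1 - e2pi (of_nat m * \<tau> + (- u))))"
  proof -
    have "X = e2pi (of_nat m * \<tau> + (u + \<tau>))" "Y = e2pi (of_nat m * \<tau> + (- u))"
      unfolding X_def Y_def by (rule arg_cong[of _ _ e2pi], simp add: algebra_simps)+
    moreover have "Q = X * Y"
      unfolding X_def Y_def Q_def e2pi_add[symmetric] by (rule arg_cong[of _ _ e2pi]) (simp add: algebra_simps)
    ultimately show ?thesis by (simp add: algebra_simps)
  qed
  finally show ?case by (simp add: f_def p_def)
qed

lemma summable_norm_jacobi_term: "(\<lambda>k. norm (jacobi_term \<tau> u k)) summable_on UNIV"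
proof -
  have "norm (jacobi_term \<tau> u k) = exp (- (pi * Im \<tau>) * (of_int k)\<^sup>2 + (- pi * Im \<tau> - 2 * pi * Im u) * of_int k)" for k
    by (simp add: jacobi_term_def norm_e2pi field_simps power2_eq_square)
  then show ?thesis
    using \<tau> summable_on_gaussian_int[of "pi * Im \<tau>" "- pi * Im \<tau> - 2 * pi * Im u"] by simp
qed

text \<open>The limit of the finite identity: each Gaussian binomial coefficient tends to the
  inverse of the Euler product, and all of them are bounded by one constant, so dominated
  convergence applies.\<close>

lemma jacobi_triple_product:
  "(\<Sum>\<^sub>\<infinity>k. jacobi_term \<tau> u k) =
     euler_prod \<tau> * theta_factor \<tau> (u + \<tau>) * theta_factor \<tau> (- u)"
proof -
  define f where "f = (\<lambda>m k. jacobi_term \<tau> u k * (euler_partial \<tau> (2 * m) * euler_inverse \<tau> (int m + k) * euler_inverse \<tau> (int m - k)))"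
  have lim2: "(\<lambda>m. euler_partial \<tau> (2 * m)) \<longlonglongrightarrow> euler_prod \<tau>"
    by (rule filterlim_compose[OF euler_partial_LIMSEQ]) (simp add: filterlim_subseq strict_mono_def)
  have inv: "(\<lambda>m. inverse (euler_partial \<tau> m)) \<longlonglongrightarrow> inverse (euler_prod \<tau>)"
    by (intro tendsto_inverse euler_partial_LIMSEQ euler_prod_nonzero)
  have lim_inv: "(\<lambda>m. euler_inverse \<tau> (int m + k)) \<longlonglongrightarrow> inverse (euler_prod \<tau>)" for k
  proof -
    have "filterlim (\<lambda>m. nat (int m + k)) at_top sequentially"
      unfolding filterlim_at_top
    proof
      fix Z show "\<forall>\<^sub>F m in sequentially. Z \<le> nat (int m + k)"
        by (rule eventually_sequentiallyI[of "nat (int Z - k)"]) auto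
    qed
    then have "(\<lambda>m. inverse (euler_partial \<tau> (nat (int m + k)))) \<longlonglongrightarrow> inverse (euler_prod \<tau>)"
      by (rule filterlim_compose[OF inv])
    moreover have "\<forall>\<^sub>F m in sequentially. inverse (euler_partial \<tau> (nat (int m + k))) = euler_inverse \<tau> (int m + k)"
      by (rule eventually_sequentiallyI[of "nat (- k)"]) (auto simp: euler_inverse_def)
    ultimately show ?thesis by (rule Lim_transform_eventually)
  qed
  obtain K1 where K1: "\<And>m. norm (euler_partial \<tau> m) \<le> K1"
    using euler_partial_LIMSEQ[THEN convergentI, THEN convergent_imp_Bseq] by (auto simp: Bseq_def)
  obtain K2 where K2: "K2 > 0" "\<And>m. norm (inverse (euler_partial \<tau> m)) \<le> K2"
    using inv[THEN convergentI, THEN convergent_imp_Bseq] by (auto simp: Bseq_def)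
  have K2': "norm (euler_inverse \<tau> j) \<le> K2" for j
    using K2 by (auto simp: euler_inverse_def)
  have "(\<lambda>m. \<Sum>\<^sub>\<infinity>k. f m k) \<longlonglongrightarrow> (\<Sum>\<^sub>\<infinity>k. jacobi_term \<tau> u k * (euler_prod \<tau> * inverse (euler_prod \<tau>) * inverse (euler_prod \<tau>)))"
  proof (rule tendsto_infsum_dominated)
    fix k
    show "(\<lambda>m. f m k) \<longlonglongrightarrow> jacobi_term \<tau> u k * (euler_prod \<tau> * inverse (euler_prod \<tau>) * inverse (euler_prod \<tau>))"
      unfolding f_def using lim_inv[of "- k"] by (intro tendsto_mult tendsto_const lim2 lim_inv) simp
    fix m
    show "norm (f m k) \<le> norm (jacobi_term \<tau> u k) * (K1 * K2 * K2)"
      unfolding f_def norm_mult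
      using K1 K2 K2' order_trans[OF norm_ge_zero K1] by (intro mult_mono mult_nonneg_nonneg) auto
  next
    show "(\<lambda>k. norm (jacobi_term \<tau> u k) * (K1 * K2 * K2)) summable_on UNIV"
      by (intro summable_on_cmult_left summable_norm_jacobi_term)
  qed auto
  also have "(\<lambda>m. \<Sum>\<^sub>\<infinity>k. f m k) = (\<lambda>m. (\<Prod>j<m. 1 - e2pi (of_nat j * \<tau> + (u + \<tau>))) * (\<Prod>j<m. 1 - e2pi (of_nat j * \<tau> + (- u))))"
    by (simp only: f_def infsumI[OF finite_jacobi_identity] prod.distrib)
  finally have "(\<Sum>\<^sub>\<infinity>k. jacobi_term \<tau> u k * (euler_prod \<tau> * inverse (euler_prod \<tau>) * inverse (euler_prod \<tau>))) =
     theta_factor \<tau> (u + \<tau>) * theta_factor \<tau> (- u)"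
    using tendsto_mult[OF LIMSEQ_prod_e2pi[OF \<tau>] LIMSEQ_prod_e2pi[OF \<tau>]] LIMSEQ_unique by blast
  then have "(\<Sum>\<^sub>\<infinity>k. jacobi_term \<tau> u k) * (euler_prod \<tau> * inverse (euler_prod \<tau>) * inverse (euler_prod \<tau>)) =
     theta_factor \<tau> (u + \<tau>) * theta_factor \<tau> (- u)"
    unfolding infsum_cmult_left' .
  then show ?thesis
    using euler_prod_nonzero by (simp add: field_simps)
qed

lemma theta_product:
  "theta \<tau> u = e2pi (\<tau> / 8 + u / 2) * euler_prod \<tau> * theta_factor \<tau> (u + \<tau>) * theta_factor \<tau> (- u)"
proof -
  have "theta \<tau> u = (\<Sum>\<^sub>\<infinity>r\<in>range (\<lambda>k. 2 * k + 1). theta.exp_term \<tau> u r)"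
    unfolding theta_eq_exp_sum theta.exp_sum_def
  proof (rule infsum_cong_neutral)
    fix r :: int assume "r \<in> UNIV - range (\<lambda>k. 2 * k + 1)"
    then have "even r" by (metis DiffD2 oddE rangeI)
    then show "theta.exp_term \<tau> u r = 0" by (simp add: theta_exp_term kronecker_even)
  qed auto
  also have "\<dots> = (\<Sum>\<^sub>\<infinity>k. theta.exp_term \<tau> u (2 * k + 1))"
    by (subst infsum_reindex) (auto simp: inj_on_def o_def)
  also have "(\<lambda>k. theta.exp_term \<tau> u (2 * k + 1)) = (\<lambda>k. e2pi (\<tau> / 8 + u / 2) * jacobi_term \<tau> u k)"
  proof
    fix k :: int
    have "theta.exp_term \<tau> u (2 * k + 1) = e2pi (of_int k / 2 + of_int ((2 * k + 1)\<^sup>2) / 8 * \<tau> + of_int (2 * k + 1) * u / 2)"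
      by (simp only: theta_exp_term kronecker_odd e2pi_add)
    also have "of_int k / 2 + of_int ((2 * k + 1)\<^sup>2) / 8 * \<tau> + of_int (2 * k + 1) * u / 2 =
       (\<tau> / 8 + u / 2) + (of_int k / 2 + of_int (k * (k + 1)) / 2 * \<tau> + of_int k * u)"
      by (simp add: field_simps power2_eq_square)
    finally show "theta.exp_term \<tau> u (2 * k + 1) = e2pi (\<tau> / 8 + u / 2) * jacobi_term \<tau> u k"
      by (simp only: jacobi_term_def e2pi_add)
  qed
  finally show ?thesis
    by (simp add: infsum_cmult_right' jacobi_triple_product mult.assoc)
qed

end

section \<open>Holomorphy of the products, and the zeros and first derivative of theta\<close>

lemma eta_eq: "eta \<tau> = e2pi (\<tau> / 24) * euler_prod \<tau>"
  unfolding eta_def euler_prod_def ..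

lemma eta_nonzero: "Im \<tau> > 0 \<Longrightarrow> eta \<tau> \<noteq> 0"
  by (simp add: eta_eq euler_prod_nonzero)

text \<open>Both coefficients vary so that one lemma serves eta, with \<open>a\<close> the identity,
  and the theta factors as functions of u, with \<open>a\<close> constant.\<close>

lemma holomorphic_on_prod_e2pi:
  fixes a b :: "complex \<Rightarrow> complex"
  assumes A: "open A" and a: "a holomorphic_on A" and b: "b holomorphic_on A" and pos: "\<And>z. z \<in> A \<Longrightarrow> Im (a z) > 0"
  shows "(\<lambda>z. \<Prod>n. 1 - e2pi (of_nat n * a z + b z)) holomorphic_on A"
proof -
  define P where "P = (\<lambda>z. \<Prod>n. 1 - e2pi (of_nat n * a z + b z))"
  have cont: "continuous_on A a" "continuous_on A b"
    using a b by (auto intro: holomorphic_on_imp_continuous_on)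
  have "P field_differentiable (at z)" if z: "z \<in> A" for z
  proof -
    obtain r where r: "r > 0" "cball z r \<subseteq> A"
      using A z open_contains_cball by blast
    have ne: "cball z r \<noteq> {}" using r by auto
    \<comment> \<open>The minimum of Im a and the maximum of |e(b)| on the compact disc yield one
      geometric majorant \<open>M\<close> valid on all of it.\<close>
    obtain x where x: "x \<in> cball z r" "\<And>y. y \<in> cball z r \<Longrightarrow> Im (a x) \<le> Im (a y)"
      using continuous_attains_inf[OF compact_cball ne, of "\<lambda>y. Im (a y)"]
        continuous_on_Im[OF continuous_on_subset[OF cont(1) r(2)]] by blast
    obtain y where y: "y \<in> cball z r" "\<And>w. w \<in> cball z r \<Longrightarrow> norm (e2pi (b w)) \<le> norm (e2pi (b y))"
      using continuous_attains_sup[OF compact_cball ne, of "\<lambda>y. norm (e2pi (b y))"]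
        continuous_on_norm[OF continuous_on_e2pi[OF continuous_on_subset[OF cont(2) r(2)]]] by blast
    have posx: "Im (a x) > 0" using x(1) r(2) pos by blast
    define M where "M = (\<lambda>n. norm (e2pi (of_nat n * a x + b y)))"
    have bound: "norm (e2pi (of_nat n * a w + b w)) \<le> M n" if "w \<in> cball z r" for n w
    proof -
      have "norm (e2pi (of_nat n * a w)) \<le> norm (e2pi (of_nat n * a x))"
        using x(2)[OF that] by (simp add: norm_e2pi mult_left_mono)
      then show ?thesis
        unfolding M_def e2pi_add norm_mult using y(2)[OF that] by (intro mult_mono) auto
    qed
    have "uniformly_convergent_on (cball z r) (\<lambda>N w. \<Sum>n<N. norm ((1 - e2pi (of_nat n * a w + b w)) - 1))"
      by (rule Weierstrass_m_test'[where M = M])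
        (use bound summable_norm_e2pi[OF posx] in \<open>auto simp: M_def\<close>)
    then have "uniformly_convergent_on (cball z r) (\<lambda>N w. \<Prod>n<N. 1 - e2pi (of_nat n * a w + b w))"
      by (intro uniformly_convergent_on_prod')
        (auto intro!: continuous_intros continuous_on_subset[OF cont(1) r(2)] continuous_on_subset[OF cont(2) r(2)])
    then obtain l where l: "uniform_limit (cball z r) (\<lambda>N w. \<Prod>n<N. 1 - e2pi (of_nat n * a w + b w)) l sequentially"
      by (auto simp: uniformly_convergent_on_def)
    have eq: "l w = P w" if "w \<in> cball z r" for w
    proof (rule LIMSEQ_unique)
      show "(\<lambda>N. \<Prod>n<N. 1 - e2pi (of_nat n * a w + b w)) \<longlonglongrightarrow> l w"
        by (rule tendsto_uniform_limitI[OF l that])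
      show "(\<lambda>N. \<Prod>n<N. 1 - e2pi (of_nat n * a w + b w)) \<longlonglongrightarrow> P w"
        unfolding P_def using that r(2) by (intro LIMSEQ_prod_e2pi pos) auto
    qed
    have hol: "(\<lambda>w. \<Prod>n<N. 1 - e2pi (of_nat n * a w + b w)) holomorphic_on A" for N
      by (intro holomorphic_intros a b)
    have "l holomorphic_on ball z r"
      by (rule holomorphic_uniform_limit[OF always_eventually l])
        (use r(2) ball_subset_cball in \<open>auto intro!: holomorphic_on_imp_continuous_on holomorphic_on_subset[OF hol]\<close>)
    then have "P holomorphic_on ball z r"
      by (rule holomorphic_transform) (simp add: eq)
    then show ?thesis
      using r(1) by (intro holomorphic_on_imp_differentiable_at[of P "ball z r"]) simp_all
  qed
  then show ?thesis
    unfolding P_def[symmetric] holomorphic_on_def using field_differentiable_at_within by blast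
qed

lemma holomorphic_on_eta: "eta holomorphic_on upper_half_plane"
proof -
  have "open upper_half_plane"
    by (simp add: upper_half_plane_def open_halfspace_Im_gt)
  then have "(\<lambda>\<tau>. e2pi (\<tau> / 24) * (\<Prod>n. 1 - e2pi (of_nat n * \<tau> + \<tau>))) holomorphic_on upper_half_plane"
    by (intro holomorphic_intros holomorphic_on_prod_e2pi) (auto simp: upper_half_plane_def)
  then show ?thesis unfolding eta_def[abs_def] of_nat_Suc_mult .
qed

text \<open>In the triple product a convergent infinite product vanishes only if one of its factors
  does, and each factor 1 - e(w) vanishes only for integral w.\<close>

lemma theta_eq_0D:
  assumes "Im \<tau> > 0" "theta \<tau> u = 0"
  obtains m l :: int where "u = of_int m * \<tau> + of_int l"
proof -
  have factor: "\<exists>n. e2pi (of_nat n * \<tau> + w) = 1" if "theta_factor \<tau> w = 0" for w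
    using that prodinf_nonzero[OF convergent_prod_e2pi[OF assms(1), of w]] by force
  from assms have "theta_factor \<tau> (u + \<tau>) = 0 \<or> theta_factor \<tau> (- u) = 0"
    by (simp add: theta_product euler_prod_nonzero)
  then consider n where "of_nat n * \<tau> + (u + \<tau>) \<in> \<int>" | n where "of_nat n * \<tau> + (- u) \<in> \<int>"
    using factor unfolding e2pi_eq_1_iff by blast
  then show thesis
  proof cases
    case (1 n)
    then obtain l where "of_nat n * \<tau> + (u + \<tau>) = of_int l" by (auto elim: Ints_cases)
    then have "u = of_int (- int (Suc n)) * \<tau> + of_int l" by (simp add: algebra_simps)
    then show ?thesis by (rule that)
  next
    case (2 n)
    then obtain l where "of_nat n * \<tau> + (- u) = of_int l" by (auto elim: Ints_cases)
    then have "u = of_int (int n) * \<tau> + of_int (- l)" by (simp add: algebra_simps)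
    then show ?thesis by (rule that)
  qed
qed

lemma theta_minus: "theta \<tau> (- u) = - theta \<tau> u"
proof -
  have "theta \<tau> (- u) = (\<Sum>\<^sub>\<infinity>r. - theta.exp_term \<tau> u r)"
    unfolding theta_eq_exp_sum theta.exp_sum_def
    by (rule infsum_reindex_bij_witness[where i = uminus and j = uminus]) (auto simp: theta_exp_term kronecker_minus)
  then show ?thesis by (simp add: infsum_uminus theta_eq_exp_sum theta.exp_sum_def)
qed

lemma theta_0 [simp]: "theta \<tau> 0 = 0"
  using theta_minus[of \<tau> 0] by simp

text \<open>Splitting the factor 1 - e(-u) off the triple product leaves a function whose value at 0
  is q^(1/8) times the cube of the Euler product, and q^(1/8) is the cube of q^(1/24).\<close>

lemma theta_deriv_0:
  assumes "Im \<tau> > 0"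
  shows "(theta \<tau> has_field_derivative 2 * of_real pi * \<i> * eta \<tau> ^ 3) (at 0)"
proof -
  define h where "h = (\<lambda>u. e2pi (\<tau> / 8 + u / 2) * euler_prod \<tau> * theta_factor \<tau> (u + \<tau>) *
     theta_factor \<tau> (\<tau> - u))"
  have split: "theta_factor \<tau> w = (1 - e2pi w) * theta_factor \<tau> (\<tau> + w)" for w
  proof (rule LIMSEQ_unique)
    show "(\<lambda>N. \<Prod>n<Suc N. 1 - e2pi (of_nat n * \<tau> + w)) \<longlonglongrightarrow> theta_factor \<tau> w"
      using LIMSEQ_prod_e2pi[OF assms] by (rule LIMSEQ_Suc)
    have "(\<lambda>N. (1 - e2pi w) * (\<Prod>n<N. 1 - e2pi (of_nat n * \<tau> + (\<tau> + w)))) \<longlonglongrightarrow> (1 - e2pi w) * theta_factor \<tau> (\<tau> + w)"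
      by (intro tendsto_mult tendsto_const LIMSEQ_prod_e2pi assms)
    then show "(\<lambda>N. \<Prod>n<Suc N. 1 - e2pi (of_nat n * \<tau> + w)) \<longlonglongrightarrow> (1 - e2pi w) * theta_factor \<tau> (\<tau> + w)"
      by (simp add: prod.lessThan_Suc_shift algebra_simps del: prod.lessThan_Suc)
  qed
  have theta: "theta \<tau> u = (1 - e2pi (- u)) * h u" for u
    unfolding theta_product[OF assms] h_def split[of "- u"] by simp
  have "h holomorphic_on UNIV"
    unfolding h_def by (intro holomorphic_intros holomorphic_on_prod_e2pi) (use assms in auto)
  then have "(h has_field_derivative deriv h 0) (at 0)"
    by (rule holomorphic_derivI) auto
  then have "((\<lambda>u. (1 - e2pi (- u)) * h u) has_field_derivative 2 * of_real pi * \<i> * h 0) (at 0)"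
    by (auto intro!: derivative_eq_intros)
  moreover have "h 0 = eta \<tau> ^ 3"
  proof -
    have "e2pi (\<tau> / 8) = e2pi (\<tau> / 24) ^ 3"
      by (simp flip: e2pi_of_nat_mult)
    moreover have "h 0 = e2pi (\<tau> / 8) * euler_prod \<tau> * euler_prod \<tau> * euler_prod \<tau>"
      unfolding h_def euler_prod_def of_nat_Suc_mult by (simp add: mult.assoc)
    ultimately show ?thesis by (simp add: eta_eq power3_eq_cube)
  qed
  ultimately show ?thesis by (simp flip: theta)
qed

section \<open>Heat equation and modular transformation of theta\<close>

lemma exp_series_theta_deriv:
  "exp_series UNIV (\<lambda>r. (\<i> * of_real (pi * of_int r)) ^ k * of_int (kronecker_minus4 r))
     (\<lambda>r. pi * (of_int r)\<^sup>2 / 4) (\<lambda>r. pi * of_int r)"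
proof (induction k)
  case 0
  then show ?case using exp_series_theta by simp
next
  case (Suc k)
  from exp_series.exp_series_mult_b[OF this] show ?case by (simp add: mult.assoc)
qed

interpretation theta_d: exp_series UNIV "\<lambda>r. (\<i> * of_real (pi * of_int r)) ^ k * of_int (kronecker_minus4 r)"
    "\<lambda>r. pi * (of_int r)\<^sup>2 / 4" "\<lambda>r. pi * of_int r" for k
  by (rule exp_series_theta_deriv)

text \<open>The k-th derivative in u, defined by its series. With k as a parameter the heat equation
  becomes the shift from k to k + 2.\<close>

definition theta_deriv :: "nat \<Rightarrow> complex \<Rightarrow> complex \<Rightarrow> complex" where
  "theta_deriv k = theta_d.exp_sum k"

lemma theta_deriv_0_eq: "theta_deriv 0 = theta"
  by (simp add: theta_deriv_def theta_eq_exp_sum[abs_def] fun_eq_iff)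

text \<open>For k = 1 this is the logarithmic derivative; for k = 2 it is theta''/theta, not the
  second derivative of log theta.\<close>

abbreviation theta_log :: "nat \<Rightarrow> complex \<Rightarrow> complex \<Rightarrow> complex" where
  "theta_log k \<tau> u \<equiv> theta_deriv k \<tau> u / theta \<tau> u"

lemma theta_deriv_DERIV_u:
  assumes "Im \<tau> > 0"
  shows "(theta_deriv k \<tau> has_field_derivative theta_deriv (Suc k) \<tau> u) (at u)"
  using theta_d.exp_sum_deriv_u[OF assms, of k u] by (simp add: theta_deriv_def mult.assoc)

text \<open>Differentiating a term in \<tau> produces i pi r^2/4 = (i pi r)^2/(4 pi i).\<close>

lemma theta_deriv_DERIV_\<tau>:
  assumes "Im \<tau> > 0"
  shows "((\<lambda>\<tau>. theta_deriv k \<tau> u) has_field_derivative theta_deriv (k + 2) \<tau> u / (4 * of_real pi * \<i>)) (at \<tau>)"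
proof -
  interpret D: exp_series UNIV "\<lambda>r. \<i> * of_real (pi * (of_int r)\<^sup>2 / 4) * ((\<i> * of_real (pi * of_int r)) ^ k * of_int (kronecker_minus4 r))"
    "\<lambda>r. pi * (of_int r)\<^sup>2 / 4" "\<lambda>r. pi * of_int r"
    by (rule theta_d.exp_series_mult_\<alpha>)
  have "D.exp_term \<tau> u r = theta_d.exp_term (k + 2) \<tau> u r * (1 / (4 * of_real pi * \<i>))" for r
    unfolding D.exp_term_def theta_d.exp_term_def by (simp add: field_simps power2_eq_square)
  then have "D.exp_sum \<tau> u = (\<Sum>\<^sub>\<infinity>r. theta_d.exp_term (k + 2) \<tau> u r * (1 / (4 * of_real pi * \<i>)))"
    unfolding D.exp_sum_def by (intro infsum_cong)
  also have "\<dots> = theta_deriv (k + 2) \<tau> u / (4 * of_real pi * \<i>)"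
    unfolding infsum_cmult_left' theta_deriv_def theta_d.exp_sum_def by simp
  finally have "D.exp_sum \<tau> u = theta_deriv (k + 2) \<tau> u / (4 * of_real pi * \<i>)" .
  with theta_d.exp_sum_deriv_\<tau>[OF assms, of k u] show ?thesis by (simp add: theta_deriv_def)
qed

lemma theta_DERIV: "Im \<tau> > 0 \<Longrightarrow> (theta \<tau> has_field_derivative theta_deriv 1 \<tau> u) (at u)"
  using theta_deriv_DERIV_u[of \<tau> 0 u] by (simp add: theta_deriv_0_eq)

lemma theta_deriv_1_0: "Im \<tau> > 0 \<Longrightarrow> theta_deriv 1 \<tau> 0 = 2 * of_real pi * \<i> * eta \<tau> ^ 3"
  using theta_DERIV theta_deriv_0 DERIV_unique by blast

lemma theta_deriv_minus: "theta_deriv k \<tau> (- u) = (-1) ^ Suc k * theta_deriv k \<tau> u"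
proof -
  have "theta_deriv k \<tau> (- u) = (\<Sum>\<^sub>\<infinity>r. (-1) ^ Suc k * theta_d.exp_term k \<tau> u r)"
    unfolding theta_deriv_def theta_d.exp_sum_def
  proof (rule infsum_reindex_bij_witness[where i = uminus and j = uminus])
    fix r :: int
    show "(-1) ^ Suc k * theta_d.exp_term k \<tau> u (- r) = theta_d.exp_term k \<tau> (- u) r"
      using power_minus[of "\<i> * of_real (pi * of_int r)" k]
      unfolding theta_d.exp_term_def by (simp add: kronecker_minus)
  qed auto
  then show ?thesis unfolding infsum_cmult_right' theta_deriv_def theta_d.exp_sum_def .
qed

text \<open>The partial derivatives exist and the one in u is jointly continuous, which gives the
  total derivative that holomorphy in (\<tau>, z) requires.\<close>

lemma has_derivative_theta:
  assumes "Im \<tau> > 0"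
  shows "((\<lambda>(\<tau>, u). theta \<tau> u) has_derivative
     (\<lambda>(t, w). theta_deriv 2 \<tau> u / (4 * of_real pi * \<i>) * t + theta_deriv 1 \<tau> u * w)) (at (\<tau>, u))"
proof -
  let ?H = "{\<tau>. Im \<tau> > 0}"
  have "((\<lambda>(\<tau>, u). theta \<tau> u) has_derivative
     (\<lambda>(t, w). theta_deriv 2 \<tau> u / (4 * of_real pi * \<i>) * t + blinfun_mult_right (theta_deriv 1 \<tau> u) w)) (at (\<tau>, u) within ?H \<times> UNIV)"
  proof (rule has_derivative_partialsI[where fy = "\<lambda>x y. blinfun_mult_right (theta_deriv 1 x y)"])
    show "((\<lambda>x. theta x u) has_derivative (*) (theta_deriv 2 \<tau> u / (4 * of_real pi * \<i>))) (at \<tau> within ?H)"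
      using theta_deriv_DERIV_\<tau>[OF assms, of 0 u]
      by (simp add: theta_deriv_0_eq has_field_derivative_def has_derivative_at_withinI numeral_2_eq_2)
    show "((\<lambda>y. theta x y) has_derivative blinfun_apply (blinfun_mult_right (theta_deriv 1 x y))) (at y within UNIV)"
      if "x \<in> ?H" for x y
      using that theta_DERIV by (simp add: has_field_derivative_def)
    have "continuous_on (?H \<times> UNIV) (\<lambda>(x, y). theta_deriv 1 x y)"
      unfolding theta_deriv_def by (rule theta_d.continuous_exp_sum)
    then have "continuous (at (\<tau>, u) within ?H \<times> UNIV) (\<lambda>p. theta_deriv 1 (fst p) (snd p))"
      using assms by (simp add: continuous_on_eq_continuous_within case_prod_unfold)
    then show "continuous (at (\<tau>, u) within ?H \<times> UNIV) (\<lambda>(x, y). blinfun_mult_right (theta_deriv 1 x y))"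
      unfolding case_prod_unfold by (rule bounded_linear.continuous[OF bounded_linear_blinfun_mult_right])
  qed (use assms in auto)
  moreover have "at (\<tau>, u) within ?H \<times> UNIV = at (\<tau>, u)"
    using assms by (intro at_within_open open_Times open_halfspace_Im_gt) auto
  ultimately show ?thesis by simp
qed

text \<open>Differentiate theta'(\<tau>,0) = 2 pi i eta^3 in \<tau> and use the heat equation for
  theta' on the left.\<close>

lemma eta_deriv:
  assumes "Im \<tau> > 0"
  shows "theta_deriv 3 \<tau> 0 = 2 * of_real pi * \<i> * (3 * eta \<tau> ^ 2 * deriv eta \<tau>) * (4 * of_real pi * \<i>)"
proof -
  have op: "open upper_half_plane" by (simp add: upper_half_plane_def open_halfspace_Im_gt)
  have \<tau>: "\<tau> \<in> upper_half_plane" using assms by (simp add: upper_half_plane_def)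
  have "((\<lambda>\<tau>. 2 * of_real pi * \<i> * eta \<tau> ^ 3) has_field_derivative 2 * of_real pi * \<i> * (3 * eta \<tau> ^ 2 * deriv eta \<tau>)) (at \<tau>)"
    using holomorphic_derivI[OF holomorphic_on_eta op \<tau>] by (auto intro!: derivative_eq_intros)
  then have "((\<lambda>\<tau>. theta_deriv 1 \<tau> 0) has_field_derivative 2 * of_real pi * \<i> * (3 * eta \<tau> ^ 2 * deriv eta \<tau>)) (at \<tau>)"
    by (rule has_field_derivative_transform_within_open[OF _ op \<tau>]) (simp add: upper_half_plane_def theta_deriv_1_0 del: One_nat_def)
  from DERIV_unique[OF theta_deriv_DERIV_\<tau>[OF assms, of 1 0] this] show ?thesis
    by (simp add: field_simps numeral_3_eq_3)
qed

section \<open>Behaviour under SL_2(Z)\<close>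

lemma Im_mobius:
  assumes "a * d - b * c = (1::int)" "Im \<tau> > 0"
  shows "of_int c * \<tau> + of_int d \<noteq> 0" "Im (mobius a b c d \<tau>) > 0"
proof -
  show nz: "of_int c * \<tau> + of_int d \<noteq> 0"
  proof
    assume eq: "of_int c * \<tau> + of_int d = 0"
    then have "c = 0" using assms(2) by (auto simp: complex_eq_iff)
    with eq assms(1) show False by simp
  qed
  have "Im (mobius a b c d \<tau>) = Im \<tau> * of_int (a * d - b * c) / (norm (of_int c * \<tau> + of_int d))\<^sup>2"
    unfolding mobius_def Im_divide cmod_power2 by (simp add: algebra_simps)
  with nz assms show "Im (mobius a b c d \<tau>) > 0" by simp
qed

text \<open>Since 1/j = a - c \<tau>' and \<tau>/j = d \<tau>' - b, division by j = c \<tau> + d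
  carries the lattice Z + Z \<tau> onto Z + Z \<tau>'. Hence both sides have comparable
  quasi-periods in z.\<close>

lemma theta_modular:
  assumes det: "a * d - b * c = (1::int)" and \<tau>: "Im \<tau> > 0"
  shows "theta (mobius a b c d \<tau>) (z / (of_int c * \<tau> + of_int d)) =
    e2pi (of_int c * z\<^sup>2 / (2 * (of_int c * \<tau> + of_int d))) / (of_int c * \<tau> + of_int d) *
    (eta (mobius a b c d \<tau>) / eta \<tau>) ^ 3 * theta \<tau> z"
proof -
  define j where "j = of_int c * \<tau> + of_int d"
  define \<tau>' where "\<tau>' = mobius a b c d \<tau>"
  have j: "j \<noteq> 0" and \<tau>': "Im \<tau>' > 0"
    using Im_mobius[OF det \<tau>] by (auto simp: j_def \<tau>'_def)
  have \<tau>'_eq: "\<tau>' * j = of_int a * \<tau> + of_int b"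
    using j by (simp add: \<tau>'_def mobius_def j_def)
  have det': "of_int a * of_int d - of_int b * of_int c = (1 :: complex)"
    using arg_cong[OF det, of "of_int :: int \<Rightarrow> complex"] by simp
  have j1: "1 / j = of_int a - of_int c * \<tau>'"
  proof -
    have "(of_int a - of_int c * \<tau>') * j = of_int a * j - of_int c * (\<tau>' * j)" by (simp add: algebra_simps)
    also have "\<dots> = 1" unfolding \<tau>'_eq using det' by (simp add: j_def algebra_simps)
    finally show ?thesis using j by (simp add: field_simps)
  qed
  have j\<tau>: "\<tau> / j = of_int d * \<tau>' - of_int b"
  proof -
    have "(of_int d * \<tau>' - of_int b) * j = of_int d * (\<tau>' * j) - of_int b * j" by (simp add: algebra_simps)
    also have "\<dots> = (of_int a * of_int d - of_int b * of_int c) * \<tau>" unfolding \<tau>'_eq by (simp add: j_def algebra_simps)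
    finally show ?thesis using j det' by (simp add: field_simps)
  qed
  \<comment> \<open>The Gaussian factor removes the terms of the quasi-periodicity factors that
    depend on c, leaving exactly the factors of theta at \<tau>.\<close>
  define F where "F = (\<lambda>z. e2pi (- (of_int c * z\<^sup>2 / (2 * j))) * theta \<tau>' (z / j))"
  have F1: "F (z + 1) = (-1) * F z" for z
  proof -
    have "F (z + 1) = e2pi (- (of_int c * (z + 1)\<^sup>2 / (2 * j))) * theta \<tau>' (z / j + of_int (- c) * \<tau>' + of_int a)"
      unfolding F_def add_divide_distrib j1 by (simp add: algebra_simps)
    also have "\<dots> = e2pi (- (of_int c * (z + 1)\<^sup>2 / (2 * j)) + ((of_int (- c) + of_int a) / 2 - of_int (- c) ^ 2 * \<tau>' / 2 - of_int (- c) * (z / j))) * theta \<tau>' (z / j)"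
      unfolding theta_quasiperiodic e2pi_add by simp
    also have "- (of_int c * (z + 1)\<^sup>2 / (2 * j)) + ((of_int (- c) + of_int a) / 2 - of_int (- c) ^ 2 * \<tau>' / 2 - of_int (- c) * (z / j))
       = of_int (a - c - a * c) / 2 + - (of_int c * z\<^sup>2 / (2 * j))"
    proof -
      have "of_int c * (z + 1)\<^sup>2 / (2 * j) = of_int c * z\<^sup>2 / (2 * j) + of_int c * (z / j) + of_int c * (1 / j) / 2"
        using j by (simp add: field_simps power2_eq_square)
      then show ?thesis
        unfolding j1 by (simp add: algebra_simps power2_eq_square add_divide_distrib diff_divide_distrib)
    qed
    also have "e2pi (of_int (a - c - a * c) / 2 + - (of_int c * z\<^sup>2 / (2 * j))) = (-1) * e2pi (- (of_int c * z\<^sup>2 / (2 * j)))"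
    proof -
      \<comment> \<open>Up to sign and even numbers this is (1 + a)(1 + c) - 1, which is even only
        if a and c are both even; the determinant excludes that.\<close>
      have "odd (a - c - a * c)"
      proof (rule ccontr)
        assume "\<not> odd (a - c - a * c)"
        then have "even a" "even c" by auto
        then have "even (a * d - b * c)" by simp
        with det show False by simp
      qed
      then obtain k where "a - c - a * c = 2 * k + 1" by (blast elim: oddE)
      then have "e2pi (of_int (a - c - a * c) / 2) = -1"
        by (simp add: add_divide_distrib e2pi_add e2pi_half)
      then show ?thesis by (simp only: e2pi_add)
    qed
    finally show ?thesis by (simp add: F_def)
  qed
  have F\<tau>: "F (z + \<tau>) = e2pi (1 / 2 - \<tau> / 2 - z) * F z" for z
  proof -
    have "F (z + \<tau>) = e2pi (- (of_int c * (z + \<tau>)\<^sup>2 / (2 * j))) * theta \<tau>' (z / j + of_int d * \<tau>' + of_int (- b))"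
      unfolding F_def add_divide_distrib j\<tau> by (simp add: algebra_simps)
    also have "\<dots> = e2pi (- (of_int c * (z + \<tau>)\<^sup>2 / (2 * j)) + ((of_int d + of_int (- b)) / 2 - of_int d ^ 2 * \<tau>' / 2 - of_int d * (z / j))) * theta \<tau>' (z / j)"
      unfolding theta_quasiperiodic e2pi_add by simp
    also have "- (of_int c * (z + \<tau>)\<^sup>2 / (2 * j)) + ((of_int d + of_int (- b)) / 2 - of_int d ^ 2 * \<tau>' / 2 - of_int d * (z / j))
       = of_int (d - b - b * d) / 2 + (- \<tau> / 2 - z) + - (of_int c * z\<^sup>2 / (2 * j))"
    proof -
      have 1: "of_int d ^ 2 * \<tau>' = of_int d * \<tau> / j + of_int (b * d)"
        using arg_cong[OF j\<tau>, of "\<lambda>x. of_int d * x"] by (simp add: algebra_simps power2_eq_square)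
      have 2: "of_int c * (z + \<tau>)\<^sup>2 / (2 * j) = of_int c * z\<^sup>2 / (2 * j) + z * (of_int c * \<tau>) / j + \<tau> * (of_int c * \<tau>) / j / 2"
        using j by (simp add: field_simps power2_eq_square)
      have 3: "of_int c * \<tau> = j - of_int d" by (simp add: j_def)
      show ?thesis unfolding 1 2 3 using j by (simp add: field_simps)
    qed
    also have "e2pi (of_int (d - b - b * d) / 2 + (- \<tau> / 2 - z) + - (of_int c * z\<^sup>2 / (2 * j))) =
       e2pi (1 / 2 - \<tau> / 2 - z) * e2pi (- (of_int c * z\<^sup>2 / (2 * j)))"
    proof -
      have "odd (d - b - b * d)"
      proof (rule ccontr)
        assume "\<not> odd (d - b - b * d)"
        then have "even d" "even b" by auto
        then have "even (a * d - b * c)" by simp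
        with det show False by simp
      qed
      then obtain k where "d - b - b * d = 2 * k + 1" by (blast elim: oddE)
      then have 1: "e2pi (of_int (d - b - b * d) / 2) = e2pi (1 / 2)"
        by (simp add: add_divide_distrib e2pi_add)
      have 2: "1 / 2 - \<tau> / 2 - z = 1 / 2 + (- \<tau> / 2 - z)" by simp
      show ?thesis unfolding 2 by (simp only: e2pi_add 1)
    qed
    finally show ?thesis by (simp add: F_def)
  qed
  have T1: "theta \<tau> (z + 1) = (-1) * theta \<tau> z" for z
    using theta_quasiperiodic[of \<tau> z 0 1] by (simp add: e2pi_half)
  have T\<tau>: "theta \<tau> (z + \<tau>) = e2pi (1 / 2 - \<tau> / 2 - z) * theta \<tau> z" for z
    using theta_quasiperiodic[of \<tau> z 1 0] by simp
  have DF: "(F has_field_derivative (- of_int c * z / j) * (2 * of_real pi * \<i>) * F z + e2pi (- (of_int c * z\<^sup>2 / (2 * j))) * (theta_deriv 1 \<tau>' (z / j) / j)) (at z)" for z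
    unfolding F_def using j
    by (auto intro!: derivative_eq_intros DERIV_chain2[OF theta_DERIV[OF \<tau>']] simp: mult_ac)
  obtain K where K: "\<And>z. F z = K * theta \<tau> z"
  proof (rule quasiperiodic_proportional[where F = F and T = "theta \<tau>" and p = "\<lambda>_. -1" and r = "\<lambda>z. e2pi (1 / 2 - \<tau> / 2 - z)" and \<tau> = \<tau>])
    show "F holomorphic_on UNIV" "theta \<tau> holomorphic_on UNIV"
      using DF theta_DERIV[OF \<tau>] by (auto simp: holomorphic_on_open)
    fix z assume "theta \<tau> z = 0"
    then obtain m l where z: "z = of_int m * \<tau> + of_int l" using theta_eq_0D[OF \<tau>] by blast
    have "F 0 = 0" by (simp add: F_def)
    moreover have "(F (0 + of_int m * \<tau> + of_int l * 1) = 0) = (F 0 = 0)"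
      using periodic_of_int[of "\<lambda>z. F z = 0" 1] periodic_of_int[of "\<lambda>z. F z = 0" \<tau> 0] F1 F\<tau> by simp
    ultimately have "F z = 0" by (simp add: z)
    \<comment> \<open>Quasi-periodicity transports the simple zero of theta at 0 to the lattice
      point z; \<open>C\<close> is the nonvanishing factor at that point.\<close>
    define C where "C = e2pi ((of_int m + of_int l) / 2 - of_int m ^ 2 * \<tau> / 2)"
    have "theta \<tau> w = C * e2pi (- (of_int m * (w - z))) * theta \<tau> (w - z)" for w
    proof -
      have "w - z + of_int m * \<tau> + of_int l = w" by (simp add: z)
      then have "theta \<tau> w = e2pi ((of_int m + of_int l) / 2 - of_int m ^ 2 * \<tau> / 2 - of_int m * (w - z)) * theta \<tau> (w - z)"
        using theta_quasiperiodic[of \<tau> "w - z" m l] by (simp only:)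
      then show ?thesis unfolding C_def e2pi_add[symmetric] by simp
    qed
    then have "theta \<tau> = (\<lambda>w. C * e2pi (- (of_int m * (w - z))) * theta \<tau> (w - z))" by blast
    moreover have "((\<lambda>w. C * e2pi (- (of_int m * (w - z))) * theta \<tau> (w - z)) has_field_derivative C * theta_deriv 1 \<tau> 0) (at z)"
      by (auto intro!: derivative_eq_intros DERIV_chain2[OF theta_DERIV[OF \<tau>]])
    ultimately have "(theta \<tau> has_field_derivative C * theta_deriv 1 \<tau> 0) (at z)" by simp
    then have "deriv (theta \<tau>) z = C * theta_deriv 1 \<tau> 0" by (rule DERIV_imp_deriv)
    with \<open>F z = 0\<close> show "deriv (theta \<tau>) z \<noteq> 0 \<and> F z = 0"
      by (simp add: C_def theta_deriv_1_0[OF \<tau>, simplified] eta_nonzero[OF \<tau>])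
  qed (use F1 F\<tau> T1 T\<tau> \<tau> in auto)
  have "(F has_field_derivative theta_deriv 1 \<tau>' 0 / j) (at 0)" using DF[of 0] by simp
  moreover have "(F has_field_derivative K * theta_deriv 1 \<tau> 0) (at 0)"
    unfolding K[abs_def] by (rule DERIV_cmult[OF theta_DERIV[OF \<tau>]])
  ultimately have "theta_deriv 1 \<tau>' 0 / j = K * theta_deriv 1 \<tau> 0" by (rule DERIV_unique)
  then have "K = (eta \<tau>' / eta \<tau>) ^ 3 / j"
    unfolding theta_deriv_1_0[OF \<tau>] theta_deriv_1_0[OF \<tau>'] using j eta_nonzero[OF \<tau>]
    by (simp add: field_simps)
  moreover have "theta \<tau>' (z / j) = e2pi (of_int c * z\<^sup>2 / (2 * j)) * F z"
    by (simp add: F_def e2pi_minus)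
  ultimately have "theta \<tau>' (z / j) = e2pi (of_int c * z\<^sup>2 / (2 * j)) / j * (eta \<tau>' / eta \<tau>) ^ 3 * theta \<tau> z"
    by (simp add: K)
  then show ?thesis by (simp add: j_def \<tau>'_def)
qed

text \<open>Eta has no zeros on the convex half plane, so a holomorphic logarithm exists and the
  choice in \<open>eta_power\<close> is meaningful. For a natural exponent every branch gives the
  ordinary power.\<close>

lemma eta_power_of_nat:
  assumes "\<tau> \<in> upper_half_plane"
  shows "eta_power (of_nat h) \<tau> = eta \<tau> ^ h"
proof -
  have "convex upper_half_plane"
    unfolding upper_half_plane_def by (rule convex_halfspace_Im_gt)
  then obtain l where l: "l holomorphic_on upper_half_plane" "\<And>\<tau>. \<tau> \<in> upper_half_plane \<Longrightarrow> eta \<tau> = exp (l \<tau>)"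
    using contractible_imp_holomorphic_log[OF holomorphic_on_eta convex_imp_contractible]
    by (metis (no_types, lifting) eta_nonzero mem_Collect_eq upper_half_plane_def)
  then have "is_eta_power_branch (of_nat h) (\<lambda>\<tau>. exp (of_rat (of_nat h) * l \<tau>))"
    unfolding is_eta_power_branch_def by (intro exI[of _ l]) auto
  then have "is_eta_power_branch (of_nat h) (eta_power (of_nat h))"
    unfolding eta_power_def by (rule someI[of "is_eta_power_branch (of_nat h)"])
  then obtain l' where "exp (l' \<tau>) = eta \<tau>" "eta_power (of_nat h) \<tau> = exp (of_rat (of_nat h) * l' \<tau>)"
    using assms unfolding is_eta_power_branch_def by blast
  then show ?thesis by (simp add: exp_of_nat_mult)
qed

section \<open>Lattices and eutactic stars\<close>

context integral_lattice
begin

lemma \<beta>_add_right: "\<beta> x (y + z) = \<beta> x y + \<beta> x z"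
  and \<beta>_scale_right: "\<beta> x (smul c y) = c * \<beta> x y"
  and \<beta>_zero_right [simp]: "\<beta> x 0 = 0"
  and \<beta>_minus_right: "\<beta> x (- y) = - \<beta> x y"
  and \<beta>_diff_right: "\<beta> x (y - z) = \<beta> x y - \<beta> x z"
  and \<beta>_sum_right: "\<beta> x (sum f A) = (\<Sum>a\<in>A. \<beta> x (f a))"
proof -
  interpret f: Vector_Spaces.linear smul "(*)" "\<beta> x" by (rule linear)
  show "\<beta> x (y + z) = \<beta> x y + \<beta> x z" "\<beta> x (smul c y) = c * \<beta> x y" "\<beta> x 0 = 0"
    "\<beta> x (- y) = - \<beta> x y" "\<beta> x (y - z) = \<beta> x y - \<beta> x z" "\<beta> x (sum f A) = (\<Sum>a\<in>A. \<beta> x (f a))"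
    by (simp_all add: f.add f.scale f.zero f.neg f.diff f.sum)
qed

lemma \<beta>_add_left: "\<beta> (y + z) x = \<beta> y x + \<beta> z x"
  and \<beta>_scale_left: "\<beta> (smul c y) x = c * \<beta> y x"
  and \<beta>_zero_left [simp]: "\<beta> 0 x = 0"
  and \<beta>_minus_left: "\<beta> (- y) x = - \<beta> y x"
  and \<beta>_diff_left: "\<beta> (y - z) x = \<beta> y x - \<beta> z x"
  and \<beta>_sum_left: "\<beta> (sum f A) x = (\<Sum>a\<in>A. \<beta> (f a) x)"
  by (simp_all only: symmetric[of _ x] \<beta>_add_right \<beta>_scale_right \<beta>_zero_right \<beta>_minus_right \<beta>_diff_right \<beta>_sum_right)

lemmas \<beta>_bilinear = \<beta>_add_right \<beta>_scale_right \<beta>_minus_right \<beta>_diff_right \<beta>_sum_right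
  \<beta>_add_left \<beta>_scale_left \<beta>_minus_left \<beta>_diff_left \<beta>_sum_left

lemma quad_add: "quad \<beta> (x + y) = quad \<beta> x + quad \<beta> y + \<beta> x y"
  by (simp add: quad_def \<beta>_bilinear symmetric[of y x] add_divide_distrib)

lemma lattice_basis:
  obtains B where "finite B" "independent B" "span B = UNIV" "B \<subseteq> L"
    "L = {\<Sum>b\<in>B. smul (of_int (m b)) b |m. True}"
proof -
  obtain B where B: "finite B" "independent B" "span B = UNIV" "L = {\<Sum>b\<in>B. smul (of_int (m b)) b |m. True}"
    using free by blast
  have "b \<in> L" if "b \<in> B" for b
  proof -
    have "(\<Sum>c\<in>B. smul (of_int (if c = b then 1 else 0)) c) = (\<Sum>c\<in>B. if c = b then c else 0)"
      by (intro sum.cong) auto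
    also have "\<dots> = b" using that B(1) by simp
    finally show ?thesis
      unfolding B(4) by (intro CollectI exI[of _ "\<lambda>c. if c = b then 1 else 0"]) simp
  qed
  with B that show ?thesis by blast
qed

lemma lattice_0: "0 \<in> L" and lattice_add: "x \<in> L \<Longrightarrow> y \<in> L \<Longrightarrow> x + y \<in> L"
  and lattice_scale: "x \<in> L \<Longrightarrow> smul (of_int k) x \<in> L"
proof -
  obtain B where B: "finite B" "L = {\<Sum>b\<in>B. smul (of_int (m b)) b |m. True}"
    using free by blast
  show "0 \<in> L" unfolding B(2) by (intro CollectI exI[of _ "\<lambda>_. 0"]) simp
  show "x + y \<in> L" if xy: "x \<in> L" "y \<in> L"
  proof -
    obtain m m' where "x = (\<Sum>b\<in>B. smul (of_int (m b)) b)" "y = (\<Sum>b\<in>B. smul (of_int (m' b)) b)"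
      using xy unfolding B(2) by blast
    then show ?thesis
      unfolding B(2) by (intro CollectI exI[of _ "\<lambda>b. m b + m' b"]) (simp add: scale_left_distrib sum.distrib)
  qed
  show "smul (of_int k) x \<in> L" if x: "x \<in> L"
  proof -
    obtain m where "x = (\<Sum>b\<in>B. smul (of_int (m b)) b)"
      using x unfolding B(2) by blast
    then show ?thesis
      unfolding B(2) by (intro CollectI exI[of _ "\<lambda>b. k * m b"]) (simp add: scale_sum_right)
  qed
qed

lemma lattice_minus: "x \<in> L \<Longrightarrow> - x \<in> L"
  using lattice_scale[of x "-1"] by simp

text \<open>Extends identities linear in a vector from the lattice to its complex span, such as the
  star relation and the invariance of \<beta> under automorphisms.\<close>

lemma complex_span_induct [case_names zero step]:
  assumes "P 0" and "\<And>c x y. x \<in> L \<Longrightarrow> P y \<Longrightarrow> P (smul c x + y)"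
  shows "P v"
proof -
  obtain B where "span B = UNIV" "B \<subseteq> L" using lattice_basis by metis
  then have "v \<in> span B" "B \<subseteq> L" by auto
  then show ?thesis
    by (induction rule: span_induct_alt) (use assms in auto)
qed

lemma lattice_subset_rational_span: "x \<in> L \<Longrightarrow> x \<in> rational_span smul L"
  unfolding rational_span_def by (auto intro!: exI[of _ 1] exI[of _ x])

lemma rational_span_scale:
  assumes "x \<in> rational_span smul L"
  shows "smul (of_rat a) x \<in> rational_span smul L"
proof -
  obtain b y where "x = smul (of_rat b) y" "y \<in> L" using assms unfolding rational_span_def by blast
  then have "smul (of_rat a) x = smul (of_rat (a * b)) y" by (simp add: of_rat_mult)
  with \<open>y \<in> L\<close> show ?thesis unfolding rational_span_def by blast
qed

lemma rational_span_add:
  assumes "x \<in> rational_span smul L" "y \<in> rational_span smul L"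
  shows "x + y \<in> rational_span smul L"
proof -
  obtain a b u v where x: "x = smul (of_rat a) u" "u \<in> L" and y: "y = smul (of_rat b) v" "v \<in> L"
    using assms unfolding rational_span_def by blast
  obtain p q where a: "a = of_int p / of_int q" "q > 0" by (metis quotient_of_div quotient_of_denom_pos surj_pair)
  obtain p' q' where b: "b = of_int p' / of_int q'" "q' > 0" by (metis quotient_of_div quotient_of_denom_pos surj_pair)
  have "x + y = smul (of_rat (1 / (of_int q * of_int q'))) (smul (of_int (p * q')) u + smul (of_int (p' * q)) v)"
    using a(2) b(2) by (simp add: x y a(1) b(1) scale_right_distrib of_rat_divide of_rat_mult field_simps)
  then show ?thesis
    using lattice_add lattice_scale x(2) y(2) unfolding rational_span_def by blast
qed

lemma rational_span_0: "0 \<in> rational_span smul L"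
  using lattice_subset_rational_span lattice_0 by blast

lemma rational_span_sum: "(\<And>a. a \<in> A \<Longrightarrow> f a \<in> rational_span smul L) \<Longrightarrow> sum f A \<in> rational_span smul L"
  by (induction A rule: infinite_finite_induct) (auto intro: rational_span_0 rational_span_add)

lemma even_sublattice_add:
  assumes "x \<in> even_sublattice L \<beta>" "y \<in> even_sublattice L \<beta>"
  shows "x + y \<in> even_sublattice L \<beta>"
  using assms integral unfolding even_sublattice_def by (auto simp: quad_add intro: lattice_add)

lemma even_sublattice_minus: "x \<in> even_sublattice L \<beta> \<Longrightarrow> - x \<in> even_sublattice L \<beta>"
  unfolding even_sublattice_def by (auto simp: quad_def \<beta>_bilinear intro: lattice_minus)

lemma even_sublattice_0: "0 \<in> even_sublattice L \<beta>"
  unfolding even_sublattice_def by (auto simp: quad_def intro: lattice_0)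

abbreviation coset :: "'v \<Rightarrow> 'v set" where "coset \<equiv> even_coset L \<beta>"

lemma coset_eq_iff: "coset x = coset y \<longleftrightarrow> x - y \<in> even_sublattice L \<beta>"
proof
  assume "coset x = coset y"
  then have "x + 0 \<in> coset y"
    using even_sublattice_0 unfolding even_coset_def by blast
  then show "x - y \<in> even_sublattice L \<beta>" by (auto simp: even_coset_def)
next
  have *: "coset x \<subseteq> coset y" if xy: "x - y \<in> even_sublattice L \<beta>" for x y
  proof
    fix z assume "z \<in> coset x"
    then obtain l where l: "l \<in> even_sublattice L \<beta>" "z = x + l" unfolding even_coset_def by blast
    have "z = y + ((x - y) + l)" by (simp add: l)
    with even_sublattice_add[OF xy l(1)] show "z \<in> coset y"
      unfolding even_coset_def by blast
  qed
  assume "x - y \<in> even_sublattice L \<beta>"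
  with *[of x y] *[of y x] even_sublattice_minus[of "x - y"]
  show "coset x = coset y" by auto
qed

text \<open>A finite complex basis together with its multiples by i spans over the reals, which
  reduces the claim to finite-dimensional real spaces.\<close>

lemma bounded_linear_of_linear:
  fixes f :: "'v \<Rightarrow> complex"
  assumes "Vector_Spaces.linear smul (*) f"
  shows "bounded_linear f"
proof -
  interpret f: Vector_Spaces.linear smul "(*)" f by (rule assms)
  obtain B where B: "finite B" "span B = UNIV" using free by blast
  let ?S = "B \<union> smul \<i> ` B"
  have "v \<in> real_vector.span ?S" for v
  proof -
    have "v \<in> span B" using B by simp
    then show ?thesis
    proof (induction rule: span_induct_alt)
      case (step c x y)
      have "smul c x = smul (of_real (Re c)) x + smul (of_real (Im c)) (smul \<i> x)"
        by (subst complex_eq[of c]) (simp add: scale_left_distrib mult.commute)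
      then have "smul c x = Re c *\<^sub>R x + Im c *\<^sub>R smul \<i> x" by (simp only: smul_of_real)
      then show ?case
        using step(1,2) by (simp only:) (intro real_vector.span_add real_vector.span_scale, auto intro: real_vector.span_base)
    qed (simp add: real_vector.span_zero)
  qed
  then have "real_vector.span ?S = UNIV" by blast
  moreover have "Real_Vector_Spaces.linear f"
    by (rule Real_Vector_Spaces.linearI)
      (simp_all add: f.add f.scale scaleR_conv_of_real flip: smul_of_real)
  ultimately show ?thesis
    using B(1) by (intro linear_imp_bounded_linear_finite_span[of f ?S]) auto
qed

end

section \<open>Consequences of the star relation\<close>

locale eutactic_lattice = integral_lattice smul L \<beta>
  for smul :: "complex \<Rightarrow> 'v::real_normed_vector \<Rightarrow> 'v" and L :: "'v set" and \<beta> +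
  fixes N :: nat and s :: "nat \<Rightarrow> 'v"
  assumes star: "eutactic_star smul L \<beta> N s"
begin

lemma star_dual: "j \<in> {1..N} \<Longrightarrow> s j \<in> dual_lattice smul L \<beta>"
  and star_nonzero: "j \<in> {1..N} \<Longrightarrow> s j \<noteq> 0"
  and star_rational: "j \<in> {1..N} \<Longrightarrow> s j \<in> rational_span smul L"
  using star by (auto simp: eutactic_star_def dual_lattice_def)

lemma star_integral: "j \<in> {1..N} \<Longrightarrow> x \<in> L \<Longrightarrow> \<beta> (s j) x \<in> \<int>"
  using star_dual by (auto simp: dual_lattice_def)

lemma eutactic: "x = (\<Sum>j=1..N. smul (\<beta> (s j) x) (s j))"
proof (induction x rule: complex_span_induct)
  case (step c x y)
  have "x = (\<Sum>j=1..N. smul (\<beta> (s j) x) (s j))"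
    using star step(1) lattice_subset_rational_span unfolding eutactic_star_def by blast
  then have "smul c x = smul c (\<Sum>j=1..N. smul (\<beta> (s j) x) (s j))" by (rule arg_cong)
  then have "smul c x = (\<Sum>j=1..N. smul (c * \<beta> (s j) x) (s j))"
    by (simp only: scale_sum_right scale_scale)
  then have "smul c x + y = (\<Sum>j=1..N. smul (c * \<beta> (s j) x) (s j)) + (\<Sum>j=1..N. smul (\<beta> (s j) y) (s j))"
    using step(2) by (rule arg_cong2)
  also have "\<dots> = (\<Sum>j=1..N. smul (\<beta> (s j) (smul c x + y)) (s j))"
    by (simp only: \<beta>_add_right \<beta>_scale_right scale_left_distrib sum.distrib)
  finally show ?case .
qed simp

text \<open>The Parseval identity of the star: in the N coordinates \<beta>(s_j, x) the form becomes
  a sum of products.\<close>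

lemma \<beta>_eutactic: "\<beta> x y = (\<Sum>j=1..N. \<beta> (s j) x * \<beta> (s j) y)"
proof -
  have "\<beta> x y = \<beta> (\<Sum>j=1..N. smul (\<beta> (s j) x) (s j)) y"
    by (rule arg_cong[OF eutactic])
  then show ?thesis by (simp only: \<beta>_sum_left \<beta>_scale_left)
qed

lemma nondegenerate_vector: "(\<And>y. \<beta> x y = 0) \<Longrightarrow> x = 0"
  by (subst eutactic) (simp add: symmetric[of "s _" x])

lemma star_pairing_rational:
  assumes "j \<in> {1..N}" "x \<in> rational_span smul L"
  obtains a where "\<beta> (s j) x = of_rat a"
proof -
  obtain a y where x: "x = smul (of_rat a) y" "y \<in> L" using assms(2) unfolding rational_span_def by blast
  obtain k where "\<beta> (s j) y = of_int k" using star_integral[OF assms(1) x(2)] by (auto elim: Ints_cases)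
  then have "\<beta> (s j) x = of_rat (a * of_int k)" by (simp add: x(1) \<beta>_bilinear of_rat_mult)
  then show ?thesis by (rule that)
qed

text \<open>Here positivity appears: by Parseval the form is half a sum of squares of rational
  numbers.\<close>

lemma quad_rational:
  assumes "x \<in> rational_span smul L"
  obtains a where "quad \<beta> x = of_rat a" "a \<ge> 0"
proof -
  have "\<exists>a. \<forall>j\<in>{1..N}. \<beta> (s j) x = of_rat (a j)"
    using star_pairing_rational[OF _ assms] by (intro bchoice ballI) blast
  then obtain a where a: "\<And>j. j \<in> {1..N} \<Longrightarrow> \<beta> (s j) x = of_rat (a j)" by blast
  have "quad \<beta> x = of_rat ((\<Sum>j=1..N. a j * a j) / 2)"
    by (simp add: quad_def \<beta>_eutactic[of x x] a of_rat_divide of_rat_sum of_rat_mult)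
  then show ?thesis by (rule that) (simp add: sum_nonneg)
qed

lemma quad_Re:
  assumes "x \<in> rational_span smul L"
  shows "quad \<beta> x = of_real (Re (quad \<beta> x))" "Re (quad \<beta> x) \<ge> 0"
proof -
  obtain a where "quad \<beta> x = of_rat a" "a \<ge> 0" by (rule quad_rational[OF assms])
  moreover have "(of_rat a :: complex) = of_real (of_rat a)" by (cases a) (simp add: of_rat_rat)
  ultimately show "quad \<beta> x = of_real (Re (quad \<beta> x))" "Re (quad \<beta> x) \<ge> 0" by (metis Re_complex_of_real, metis Re_complex_of_real zero_le_of_rat_iff)
qed

text \<open>The star relation writes the identity as the sum of the rank-one maps x -> \<beta>(s_j,
  x) s_j, whose traces are \<beta>(s_j, s_j). The trace of the identity is the rank.\<close>

lemma gram_trace: "(\<Sum>j=1..N. \<beta> (s j) (s j)) = of_nat (lattice_rank smul L)"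
proof -
  obtain B where B: "finite B" "independent B" "span B = UNIV" "B \<subseteq> L"
    by (rule lattice_basis)
  define r where "r = representation B"
  have rep: "(\<Sum>b\<in>B. smul (r v b) b) = v" for v
    unfolding r_def using B by (intro sum_representation_eq) auto
  have "lattice_rank smul L = card B"
    unfolding lattice_rank_def using B by (intro dim_unique[of B]) auto
  then have "of_nat (lattice_rank smul L) = (\<Sum>b\<in>B. r b b)"
    using representation_basis[OF B(2)] by (simp add: r_def)
  also have "\<dots> = (\<Sum>b\<in>B. \<Sum>j=1..N. \<beta> (s j) b * r (s j) b)"
  proof (rule sum.cong)
    fix b assume "b \<in> B"
    have "r b b = r (\<Sum>j=1..N. smul (\<beta> (s j) b) (s j)) b" by (rule arg_cong[OF eutactic])
    also have "\<dots> = (\<Sum>j=1..N. \<beta> (s j) b * r (s j) b)"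
      unfolding r_def using B by (simp add: representation_sum representation_scale)
    finally show "r b b = (\<Sum>j=1..N. \<beta> (s j) b * r (s j) b)" .
  qed simp
  also have "\<dots> = (\<Sum>j=1..N. \<Sum>b\<in>B. \<beta> (s j) b * r (s j) b)" by (rule sum.swap)
  also have "\<dots> = (\<Sum>j=1..N. \<beta> (s j) (\<Sum>b\<in>B. smul (r (s j) b) b))"
    by (simp add: \<beta>_bilinear mult.commute)
  finally show ?thesis by (simp add: rep)
qed

text \<open>A complex vector space is not a finite union of proper hyperplanes. Such a z spans a
  line on which all arguments \<beta>(s_j, t z) vanish only at t = 0.\<close>

lemma exists_nonorthogonal: "\<exists>z. \<forall>j\<in>{1..N}. \<beta> (s j) z \<noteq> 0"
proof -
  have "\<exists>z. \<forall>j\<in>J. \<beta> (s j) z \<noteq> 0" if "finite J" "J \<subseteq> {1..N}" for J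
    using that
  proof (induction J rule: finite_induct)
    case (insert i J)
    then obtain z where z: "\<forall>j\<in>J. \<beta> (s j) z \<noteq> 0" by auto
    have "s i \<noteq> 0" using insert.prems star_nonzero by auto
    then obtain y where y: "\<beta> (s i) y \<noteq> 0" using nondegenerate_vector by blast
    have "finite ((\<lambda>j. - \<beta> (s j) z / \<beta> (s j) y) ` insert i J)" using insert by simp
    \<comment> \<open>Each index excludes at most one value of t, so a value outside the finite set
      of bad ones keeps the old pairings nonzero and makes the new one nonzero.\<close>
    then obtain t where t: "t \<notin> (\<lambda>j. - \<beta> (s j) z / \<beta> (s j) y) ` insert i J" "t \<noteq> 0"
      using ex_new_if_finite[of "insert 0 ((\<lambda>j. - \<beta> (s j) z / \<beta> (s j) y) ` insert i J)"] infinite_UNIV_char_0 by auto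
    have "\<beta> (s j) (z + smul t y) \<noteq> 0" if "j \<in> insert i J" for j
    proof
      assume "\<beta> (s j) (z + smul t y) = 0"
      then have eq: "\<beta> (s j) z + t * \<beta> (s j) y = 0" by (simp add: \<beta>_bilinear)
      have "\<beta> (s j) y \<noteq> 0"
      proof
        assume 0: "\<beta> (s j) y = 0"
        with eq have "\<beta> (s j) z = 0" by simp
        then show False using that z 0 y by auto
      qed
      then have "t = - \<beta> (s j) z / \<beta> (s j) y" using eq by (simp add: field_simps eq_neg_iff_add_eq_0)
      with t(1) that show False by blast
    qed
    then show ?case by blast
  qed simp
  then show ?thesis by blast
qed

end

section \<open>Fourier coefficients of the product\<close>

text \<open>Regroups the multiple theta series by frequency. The fibres may be infinite, so the
  inner sums are again infinite sums.\<close>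

lemma has_sum_fibres:
  fixes f :: "'a \<Rightarrow> 'c :: banach"
  assumes "f summable_on R"
  shows "((\<lambda>x. \<Sum>\<^sub>\<infinity>r\<in>{r \<in> R. g r = x}. f r) has_sum infsum f R) UNIV"
proof -
  have "bij_betw (\<lambda>r. (g r, r)) R (Sigma UNIV (\<lambda>x. {r \<in> R. g r = x}))"
    by (rule bij_betwI[where g = snd]) auto
  moreover have "((\<lambda>r. f (snd (g r, r))) has_sum infsum f R) R"
    using assms by simp
  ultimately have "((\<lambda>p. f (snd p)) has_sum infsum f R) (Sigma UNIV (\<lambda>x. {r \<in> R. g r = x}))"
    using has_sum_reindex_bij_betw[of "\<lambda>r. (g r, r)" R _ "\<lambda>p. f (snd p)"] by blast
  then show ?thesis
    by (rule has_sum_SigmaD) (auto intro!: has_sum_infsum summable_on_subset_banach[OF assms])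
qed

lemma abs_summable_fibres:
  fixes f :: "'a \<Rightarrow> 'c :: banach"
  assumes "(\<lambda>r. norm (f r)) summable_on R"
  shows "(\<lambda>x. norm (\<Sum>\<^sub>\<infinity>r\<in>{r \<in> R. g r = x}. f r)) summable_on UNIV"
proof (rule summable_on_comparison_test)
  show "(\<lambda>x. \<Sum>\<^sub>\<infinity>r\<in>{r \<in> R. g r = x}. norm (f r)) summable_on UNIV"
    using has_sum_fibres[OF assms] by (rule has_sum_imp_summable)
  show "norm (\<Sum>\<^sub>\<infinity>r\<in>{r \<in> R. g r = x}. f r) \<le> (\<Sum>\<^sub>\<infinity>r\<in>{r \<in> R. g r = x}. norm (f r))" for x
    by (rule norm_infsum_bound) (auto intro: summable_on_subset_banach[OF assms])
qed simp

section \<open>Multi-indices, and how the coefficients behave under translations and signed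
  permutations\<close>

context eutactic_lattice
begin

text \<open>Extensional functions make each multi-index a single object and fit the theorem on
  products of series. Reindexing maps must therefore restrict to {1..N}.\<close>

definition index_set :: "(nat \<Rightarrow> int) set" where
  "index_set = PiE {1..N} (\<lambda>_. UNIV)"

definition half_sum :: "(nat \<Rightarrow> int) \<Rightarrow> 'v" where
  "half_sum r = (\<Sum>j=1..N. smul (of_int (r j) / 2) (s j))"

definition weight :: "complex \<Rightarrow> (nat \<Rightarrow> int) \<Rightarrow> complex" where
  "weight \<tau> r = (\<Prod>j=1..N. of_int (kronecker_minus4 (r j)) * e2pi (of_int ((r j)\<^sup>2) / 8 * \<tau>))"

text \<open>The full coefficient of e(\<beta>(x,z)) in the product, the power q^beta(x)
  included.\<close>

definition theta_coeff :: "complex \<Rightarrow> 'v \<Rightarrow> complex" where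
  "theta_coeff \<tau> x = (\<Sum>\<^sub>\<infinity>r\<in>{r \<in> index_set. half_sum r = x}. weight \<tau> r)"

definition theta_prod :: "complex \<Rightarrow> 'v \<Rightarrow> complex" where
  "theta_prod \<tau> z = (\<Prod>j=1..N. theta \<tau> (\<beta> (s j) z))"

lemma \<beta>_half_sum: "\<beta> (half_sum r) z = (\<Sum>j=1..N. of_int (r j) * \<beta> (s j) z / 2)"
  by (simp add: half_sum_def \<beta>_bilinear)

lemma weight_times_e2pi:
  "weight \<tau> r * e2pi (\<beta> (half_sum r) z) = (\<Prod>j=1..N. theta.exp_term \<tau> (\<beta> (s j) z) (r j))"
  unfolding weight_def \<beta>_half_sum theta_exp_term by (simp add: e2pi_sum flip: prod.distrib)

lemma abs_summable_weight:
  assumes "Im \<tau> > 0"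
  shows "(\<lambda>r. norm (weight \<tau> r * e2pi (\<beta> (half_sum r) z))) summable_on index_set"
proof -
  have "Infinite_Set_Sum.abs_summable_on (\<lambda>r. \<Prod>j\<in>{1..N}. theta.exp_term \<tau> (\<beta> (s j) z) (r j)) (PiE {1..N} (\<lambda>_. UNIV))"
    using theta.abs_summable_exp_term[OF assms]
    by (intro abs_summable_on_prod_PiE) (auto simp: abs_summable_equivalent)
  then show ?thesis
    unfolding weight_times_e2pi index_set_def by (simp only: abs_summable_equivalent)
qed

lemma infsum_weight:
  assumes "Im \<tau> > 0"
  shows "(\<Sum>\<^sub>\<infinity>r\<in>index_set. weight \<tau> r * e2pi (\<beta> (half_sum r) z)) = theta_prod \<tau> z"
  unfolding weight_times_e2pi index_set_def theta_prod_def theta_eq_exp_sum theta.exp_sum_def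
  by (rule infsum_prod_PiE_abs) (use theta.abs_summable_exp_term[OF assms] in auto)

lemma fibre_sum:
  "(\<Sum>\<^sub>\<infinity>r\<in>{r \<in> index_set. half_sum r = x}. weight \<tau> r * e2pi (\<beta> (half_sum r) z)) = theta_coeff \<tau> x * e2pi (\<beta> x z)"
proof -
  have "(\<Sum>\<^sub>\<infinity>r\<in>{r \<in> index_set. half_sum r = x}. weight \<tau> r * e2pi (\<beta> (half_sum r) z)) =
     (\<Sum>\<^sub>\<infinity>r\<in>{r \<in> index_set. half_sum r = x}. weight \<tau> r * e2pi (\<beta> x z))"
    by (rule infsum_cong) auto
  then show ?thesis by (simp only: infsum_cmult_left' theta_coeff_def)
qed

lemma theta_prod_fourier:
  assumes "Im \<tau> > 0"
  shows "((\<lambda>x. theta_coeff \<tau> x * e2pi (\<beta> x z)) has_sum theta_prod \<tau> z) UNIV"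
  using has_sum_fibres[OF abs_summable_summable[OF abs_summable_weight[OF assms]], where g = half_sum]
  unfolding fibre_sum infsum_weight[OF assms] .

lemma abs_summable_theta_coeff:
  assumes "Im \<tau> > 0"
  shows "(\<lambda>x. norm (theta_coeff \<tau> x * e2pi (\<beta> x z))) summable_on UNIV"
  using abs_summable_fibres[OF abs_summable_weight[OF assms], where g = half_sum] unfolding fibre_sum .

lemma weight_nonzero_imp_odd:
  assumes "weight \<tau> r \<noteq> 0" "j \<in> {1..N}"
  shows "odd (r j)"
proof (rule kronecker_neq_0_imp_odd)
  show "kronecker_minus4 (r j) \<noteq> 0" using assms by (auto simp: weight_def)
qed

lemma theta_coeff_nonzeroE:
  assumes "theta_coeff \<tau> x \<noteq> 0"
  obtains r where "half_sum r = x" "weight \<tau> r \<noteq> 0"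
proof -
  have "\<exists>r\<in>{r \<in> index_set. half_sum r = x}. weight \<tau> r \<noteq> 0"
    using assms unfolding theta_coeff_def by (metis (no_types, lifting) infsum_0)
  with that show ?thesis by blast
qed

lemma half_sum_rational: "half_sum r \<in> rational_span smul L"
  unfolding half_sum_def
proof (rule rational_span_sum)
  fix j assume "j \<in> {1..N}"
  have "(of_int (r j) / 2 :: complex) = of_rat (of_int (r j) / 2)" by (simp add: of_rat_divide)
  then show "smul (of_int (r j) / 2) (s j) \<in> rational_span smul L"
    using rational_span_scale[OF star_rational[OF \<open>j \<in> {1..N}\<close>]] by metis
qed

text \<open>For y in L put m_j = \<beta>(s_j, y). Then beta(y) - \<beta>(x,y) is the sum of the
  (m_j^2 - r_j m_j)/2, and each numerator is even because r_j is odd.\<close>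

lemma theta_coeff_nonzero_imp_shadow:
  assumes "theta_coeff \<tau> x \<noteq> 0"
  shows "x \<in> shadow smul L \<beta>"
proof -
  obtain r where r: "half_sum r = x" "weight \<tau> r \<noteq> 0" using assms by (rule theta_coeff_nonzeroE)
  have "quad \<beta> y - \<beta> x y \<in> \<int>" if y: "y \<in> L" for y
  proof -
    have "quad \<beta> y - \<beta> x y = (\<Sum>j=1..N. (\<beta> (s j) y * \<beta> (s j) y - of_int (r j) * \<beta> (s j) y) / 2)"
      by (simp add: quad_def \<beta>_eutactic[of y y] \<beta>_half_sum flip: r(1) sum_subtractf sum_divide_distrib diff_divide_distrib)
    also have "\<dots> \<in> \<int>"
    proof (rule Ints_sum)
      fix j assume j: "j \<in> {1..N}"
      obtain m where m: "\<beta> (s j) y = of_int m" using star_integral[OF j y] by (auto elim: Ints_cases)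
      have "even (m * m - r j * m)" using weight_nonzero_imp_odd[OF r(2) j] by simp
      then obtain k where k: "m * m - r j * m = 2 * k" by blast
      have "(\<beta> (s j) y * \<beta> (s j) y - of_int (r j) * \<beta> (s j) y) / 2 = of_int (m * m - r j * m) / 2"
        by (simp add: m)
      also have "\<dots> = of_int k" unfolding k by simp
      finally show "(\<beta> (s j) y * \<beta> (s j) y - of_int (r j) * \<beta> (s j) y) / 2 \<in> \<int>" by simp
    qed
    finally show ?thesis .
  qed
  then show ?thesis
    using half_sum_rational[of r] r(1) by (simp add: shadow_def)
qed

text \<open>Put m_j = \<beta>(s_j, l). Replacing r_j by r_j + 2 m_j moves the half sum by exactly l,
  by the star relation. The characters contribute the sign (-1)^(sum of m_j); as m_j and m_j^2 have
  equal parity this is e(beta(l)), which is 1 precisely because l lies in the even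
  sublattice.\<close>

lemma theta_coeff_shift:
  assumes l: "l \<in> even_sublattice L \<beta>"
  shows "theta_coeff \<tau> (x + l) = e2pi ((quad \<beta> (x + l) - quad \<beta> x) * \<tau>) * theta_coeff \<tau> x"
proof -
  have "l \<in> L" "quad \<beta> l \<in> \<int>" using l by (auto simp: even_sublattice_def)
  then have "\<forall>j\<in>{1..N}. \<exists>k. \<beta> (s j) l = of_int k"
    using star_integral[OF _ \<open>l \<in> L\<close>] unfolding Ints_def by blast
  then have "\<exists>m. \<forall>j\<in>{1..N}. \<beta> (s j) l = of_int (m j)" by (rule bchoice)
  then obtain m where m: "\<And>j. j \<in> {1..N} \<Longrightarrow> \<beta> (s j) l = of_int (m j)" by blast
  \<comment> \<open>The shift adds k/2 times l to the half sum; k = 2 gives the bijection of fibres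
    and k = -2 its inverse.\<close>
  define T where "T = (\<lambda>(k::int) r. restrict (\<lambda>j. r j + k * m j) {1..N})"
  have half: "half_sum (T k r) = half_sum r + smul (of_int k / 2) l" for k r
  proof -
    have "half_sum (T k r) = half_sum r + (\<Sum>j=1..N. smul (of_int k / 2 * \<beta> (s j) l) (s j))"
      unfolding half_sum_def by (simp add: T_def m add_divide_distrib scale_left_distrib flip: sum.distrib)
    also have "(\<Sum>j=1..N. smul (of_int k / 2 * \<beta> (s j) l) (s j)) = smul (of_int k / 2) (\<Sum>j=1..N. smul (\<beta> (s j) l) (s j))"
      by (simp only: scale_sum_right scale_scale)
    finally show ?thesis by (simp only: eutactic[of l, symmetric])
  qed
  have quad_l: "(\<Sum>j=1..N. of_int (m j) ^ 2 / 2) = quad \<beta> l"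
    by (simp add: quad_def \<beta>_eutactic[of l l] m power2_eq_square sum_divide_distrib)
  have w: "weight \<tau> (T 2 r) = e2pi ((quad \<beta> (x + l) - quad \<beta> x) * \<tau>) * weight \<tau> r" if "half_sum r = x" for r
  proof -
    have "weight \<tau> (T 2 r) = (\<Prod>j=1..N. (of_int (kronecker_minus4 (r j)) * e2pi (of_int ((r j)\<^sup>2) / 8 * \<tau>)) *
        e2pi (of_int (m j) / 2 + (of_int (r j) * of_int (m j) / 2 + of_int (m j) ^ 2 / 2) * \<tau>))"
      unfolding weight_def
    proof (rule prod.cong)
      fix j assume "j \<in> {1..N}"
      then have Tj: "T 2 r j = r j + 2 * m j" by (simp add: T_def)
      have e: "of_int ((r j + 2 * m j)\<^sup>2) / 8 * \<tau> = of_int ((r j)\<^sup>2) / 8 * \<tau> + (of_int (r j) * of_int (m j) / 2 + of_int (m j) ^ 2 / 2) * \<tau>"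
        by (simp add: field_simps power2_eq_square)
      show "of_int (kronecker_minus4 (T 2 r j)) * e2pi (of_int ((T 2 r j)\<^sup>2) / 8 * \<tau>) =
         (of_int (kronecker_minus4 (r j)) * e2pi (of_int ((r j)\<^sup>2) / 8 * \<tau>)) *
         e2pi (of_int (m j) / 2 + (of_int (r j) * of_int (m j) / 2 + of_int (m j) ^ 2 / 2) * \<tau>)"
        unfolding Tj e kronecker_shift e2pi_add by (simp only: mult_ac)
    qed simp
    also have "\<dots> = weight \<tau> r * e2pi (\<Sum>j=1..N. of_int (m j) / 2 + (of_int (r j) * of_int (m j) / 2 + of_int (m j) ^ 2 / 2) * \<tau>)"
      by (simp only: prod.distrib weight_def e2pi_sum[OF finite_atLeastAtMost])
    also have "(\<Sum>j=1..N. of_int (m j) / 2 + (of_int (r j) * of_int (m j) / 2 + of_int (m j) ^ 2 / 2) * \<tau>) =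
        (\<Sum>j=1..N. of_int (m j) / 2) + (\<beta> x l + quad \<beta> l) * \<tau>"
    proof -
      have "\<beta> x l = (\<Sum>j=1..N. of_int (r j) * of_int (m j) / 2)"
        using that by (auto simp: \<beta>_half_sum m)
      then show ?thesis by (simp only: sum.distrib quad_l[symmetric] sum_distrib_right[symmetric])
    qed
    also have "e2pi ((\<Sum>j=1..N. of_int (m j) / 2) + (\<beta> x l + quad \<beta> l) * \<tau>) = e2pi ((\<beta> x l + quad \<beta> l) * \<tau>)"
    proof (rule e2pi_eqI)
      have "(\<Sum>j=1..N. of_int (m j) / 2 :: complex) - quad \<beta> l = (\<Sum>j=1..N. (of_int (m j) - of_int (m j) ^ 2) / 2)"
        by (simp only: quad_l[symmetric] sum_subtractf[symmetric] diff_divide_distrib)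
      also have "\<dots> \<in> \<int>"
      proof (rule Ints_sum)
        fix j
        have "even (m j - (m j)\<^sup>2)" by simp
        then obtain k where k: "m j - (m j)\<^sup>2 = 2 * k" by blast
        have "(of_int (m j) - of_int (m j) ^ 2) / 2 = (of_int (m j - (m j)\<^sup>2) / 2 :: complex)" by simp
        then show "(of_int (m j) - of_int (m j) ^ 2) / 2 \<in> (\<int> :: complex set)" unfolding k by simp
      qed
      finally have "((\<Sum>j=1..N. of_int (m j) / 2) - quad \<beta> l) + quad \<beta> l \<in> \<int>"
        using \<open>quad \<beta> l \<in> \<int>\<close> by (rule Ints_add)
      then show "(\<Sum>j=1..N. of_int (m j) / 2) + (\<beta> x l + quad \<beta> l) * \<tau> - (\<beta> x l + quad \<beta> l) * \<tau> \<in> \<int>" by simp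
    qed
    finally have "weight \<tau> (T 2 r) = weight \<tau> r * e2pi ((\<beta> x l + quad \<beta> l) * \<tau>)" .
    moreover have "quad \<beta> (x + l) - quad \<beta> x = \<beta> x l + quad \<beta> l" by (simp add: quad_add)
    ultimately show ?thesis by (simp only: mult.commute)
  qed
  have TT: "T k (T k' r) = r" if "r \<in> index_set" "k + k' = 0" for k k' r
  proof
    fix j
    have "k * m j + k' * m j = 0" using that(2) by (simp flip: distrib_right)
    moreover have "r j = undefined" if "j \<notin> {1..N}"
      using \<open>r \<in> index_set\<close> that unfolding index_set_def by (rule PiE_arb)
    ultimately show "T k (T k' r) j = r j"
      by (simp add: T_def restrict_def del: atLeastAtMost_iff)
  qed
  have Tin: "T k r \<in> index_set" for k r by (simp add: T_def index_set_def)
  have "theta_coeff \<tau> (x + l) = (\<Sum>\<^sub>\<infinity>r\<in>{r \<in> index_set. half_sum r = x}. e2pi ((quad \<beta> (x + l) - quad \<beta> x) * \<tau>) * weight \<tau> r)"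
    unfolding theta_coeff_def
  proof (rule infsum_reindex_bij_witness[where i = "T 2" and j = "T (- 2)"])
    fix r assume r: "r \<in> {r \<in> index_set. half_sum r = x + l}"
    show "T 2 (T (- 2) r) = r" using r by (simp add: TT)
    show "T (- 2) r \<in> {r \<in> index_set. half_sum r = x}" using r Tin by (simp add: half)
    then show "e2pi ((quad \<beta> (x + l) - quad \<beta> x) * \<tau>) * weight \<tau> (T (- 2) r) = weight \<tau> r"
      using w[of "T (- 2) r"] r by (simp add: TT)
  qed (use TT Tin in \<open>auto simp: half\<close>)
  then show ?thesis by (simp only: infsum_cmult_right' theta_coeff_def)
qed

text \<open>Only odd r_j contribute, and their squares are 1 modulo 8. This later fixes the Fourier
  exponents modulo the integers.\<close>

lemma theta_coeff_T: "theta_coeff (\<tau> + 1) x = e2pi (of_nat N / 8) * theta_coeff \<tau> x"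
proof -
  have "weight (\<tau> + 1) r = e2pi (of_nat N / 8) * weight \<tau> r" for r
  proof -
    have "weight (\<tau> + 1) r = (\<Prod>j=1..N. e2pi (1 / 8) * (of_int (kronecker_minus4 (r j)) * e2pi (of_int ((r j)\<^sup>2) / 8 * \<tau>)))"
      unfolding weight_def
    proof (rule prod.cong)
      fix j
      show "of_int (kronecker_minus4 (r j)) * e2pi (of_int ((r j)\<^sup>2) / 8 * (\<tau> + 1)) =
        e2pi (1 / 8) * (of_int (kronecker_minus4 (r j)) * e2pi (of_int ((r j)\<^sup>2) / 8 * \<tau>))"
      proof (cases "even (r j)")
        case False
        then obtain k where k: "r j = 2 * k + 1" by (blast elim: oddE)
        have "even (k * (k + 1))" by simp
        then obtain i where i: "k * (k + 1) = 2 * i" by blast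
        have "(r j)\<^sup>2 = 4 * (k * (k + 1)) + 1" by (simp add: k power2_eq_square algebra_simps)
        then have r2: "(r j)\<^sup>2 = 8 * i + 1" by (simp add: i)
        have "e2pi (of_int ((r j)\<^sup>2) / 8 * (\<tau> + 1)) = e2pi (1 / 8 + of_int ((r j)\<^sup>2) / 8 * \<tau>)"
          by (rule e2pi_eqI) (simp add: r2 field_simps)
        then show ?thesis by (simp add: e2pi_add)
      qed (simp add: kronecker_even)
    qed simp
    also have "\<dots> = e2pi (1 / 8) ^ N * weight \<tau> r"
      by (simp only: prod.distrib prod_constant weight_def) simp
    also have "e2pi (1 / 8) ^ N = e2pi (of_nat N / 8)"
      using e2pi_of_nat_mult[of N "1 / 8"] by simp
    finally show ?thesis .
  qed
  then show ?thesis by (simp add: theta_coeff_def infsum_cmult_right')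
qed

lemma orthogonal_\<beta>:
  assumes "g \<in> carrier (orthogonal_group smul L \<beta>)"
  shows "\<beta> (g x) (g y) = \<beta> x y"
proof -
  from assms interpret g: Vector_Spaces.linear smul smul g by (simp add: orthogonal_group_def)
  have L: "\<beta> (g x) (g y) = \<beta> x y" if "x \<in> L" "y \<in> L" for x y
    using assms that by (simp add: orthogonal_group_def)
  have R: "\<beta> (g x) (g y) = \<beta> x y" if "x \<in> L" for x y
    by (induction y rule: complex_span_induct) (simp_all add: L that g.add g.scale g.zero \<beta>_add_right \<beta>_scale_right)
  show ?thesis
    by (induction x rule: complex_span_induct) (simp_all add: R g.add g.scale g.zero \<beta>_add_left \<beta>_scale_left)
qed

lemma orthogonal_inj:
  assumes g: "g \<in> carrier (orthogonal_group smul L \<beta>)" and eq: "g x = g y"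
  shows "x = y"
proof -
  have "\<beta> (x - y) z = 0" for z
    using orthogonal_\<beta>[OF g, of x z] orthogonal_\<beta>[OF g, of y z] eq by (simp add: \<beta>_diff_left)
  then show ?thesis using nondegenerate_vector[of "x - y"] by simp
qed

text \<open>The signed permutation acts on multi-indices so that half sums follow g. Squares of the
  entries are only permuted, and the odd character yields one factor \<epsilon> j for each
  j.\<close>

lemma theta_coeff_signed_permutation:
  assumes g: "g \<in> carrier (orthogonal_group smul L \<beta>)" and sp: "signed_permutation N s g \<sigma> \<epsilon>"
  shows "theta_coeff \<tau> (g x) = of_int (\<Prod>j=1..N. \<epsilon> j) * theta_coeff \<tau> x"
proof -
  from g interpret g: Vector_Spaces.linear smul smul g by (simp add: orthogonal_group_def)
  have \<sigma>: "\<sigma> permutes {1..N}" and \<epsilon>: "\<And>j. j \<in> {1..N} \<Longrightarrow> \<epsilon> j = 1 \<or> \<epsilon> j = -1"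
    and gs: "\<And>j. j \<in> {1..N} \<Longrightarrow> g (s j) = smul (of_int (\<epsilon> j)) (s (\<sigma> j))"
    using sp smul_of_real[of "of_int _"] unfolding signed_permutation_def by auto
  have \<sigma>in: "\<sigma> j \<in> {1..N} \<longleftrightarrow> j \<in> {1..N}" "inv_into UNIV \<sigma> j \<in> {1..N} \<longleftrightarrow> j \<in> {1..N}" for j
    using permutes_in_image[OF \<sigma>] permutes_in_image[OF permutes_inv[OF \<sigma>]] by auto
  have \<epsilon>2: "\<epsilon> j * (\<epsilon> j * k) = k" if "j \<in> {1..N}" for j k using \<epsilon>[OF that] by auto
  \<comment> \<open>Chosen so that \<open>H r (\<sigma> j) = \<epsilon> j * r j\<close>; the signs
    in g (s j) then make the half sum of \<open>H r\<close> the image under g.\<close>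
  define H where "H = (\<lambda>r. restrict (\<lambda>i. \<epsilon> (inv_into UNIV \<sigma> i) * r (inv_into UNIV \<sigma> i)) {1..N})"
  define H' where "H' = (\<lambda>r. restrict (\<lambda>j. \<epsilon> j * r (\<sigma> j)) {1..N})"
  have H\<sigma>: "H r (\<sigma> j) = \<epsilon> j * r j" if "j \<in> {1..N}" for r j
    using that \<sigma>in by (simp add: H_def permutes_inverses[OF \<sigma>])
  have half: "half_sum (H r) = g (half_sum r)" for r
  proof -
    have "half_sum (H r) = (\<Sum>j=1..N. smul (of_int (H r (\<sigma> j)) / 2) (s (\<sigma> j)))"
      unfolding half_sum_def by (rule sum.permute[OF \<sigma>, unfolded o_def])
    also have "\<dots> = (\<Sum>j=1..N. smul (of_int (r j) / 2) (g (s j)))"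
      by (rule sum.cong) (simp_all add: H\<sigma> gs mult.commute)
    finally show ?thesis by (simp add: half_sum_def g.sum g.scale)
  qed
  have w: "weight \<tau> (H r) = of_int (\<Prod>j=1..N. \<epsilon> j) * weight \<tau> r" for r
  proof -
    have "weight \<tau> (H r) = (\<Prod>j=1..N. of_int (kronecker_minus4 (H r (\<sigma> j))) * e2pi (of_int ((H r (\<sigma> j))\<^sup>2) / 8 * \<tau>))"
      unfolding weight_def by (rule prod.permute[OF \<sigma>, unfolded o_def])
    also have "\<dots> = (\<Prod>j=1..N. of_int (\<epsilon> j) * (of_int (kronecker_minus4 (r j)) * e2pi (of_int ((r j)\<^sup>2) / 8 * \<tau>)))"
    proof (rule prod.cong)
      fix j assume j: "j \<in> {1..N}"
      then show "of_int (kronecker_minus4 (H r (\<sigma> j))) * e2pi (of_int ((H r (\<sigma> j))\<^sup>2) / 8 * \<tau>) =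
         of_int (\<epsilon> j) * (of_int (kronecker_minus4 (r j)) * e2pi (of_int ((r j)\<^sup>2) / 8 * \<tau>))"
        unfolding H\<sigma>[OF j] using \<epsilon>[OF j] by (auto simp: kronecker_minus)
    qed simp
    finally show ?thesis by (simp add: prod.distrib weight_def)
  qed
  have Hin: "H r \<in> index_set" "H' r \<in> index_set" for r by (simp_all add: H_def H'_def index_set_def)
  have arb: "r i = undefined" if "r \<in> index_set" "i \<notin> {1..N}" for r i
    using that unfolding index_set_def by (rule PiE_arb)
  have H'H: "H' (H r) = r" if "r \<in> index_set" for r
  proof
    fix j show "H' (H r) j = r j"
    proof (cases "j \<in> {1..N}")
      case True
      then have "H' (H r) j = \<epsilon> j * H r (\<sigma> j)" by (simp add: H'_def)
      then show ?thesis by (simp add: H\<sigma>[OF True] \<epsilon>2[OF True])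
    next
      case False
      with arb[OF that False] show ?thesis by (simp add: H'_def restrict_def del: atLeastAtMost_iff)
    qed
  qed
  have HH': "H (H' r) = r" if "r \<in> index_set" for r
  proof
    fix i show "H (H' r) i = r i"
    proof (cases "i \<in> {1..N}")
      case True
      define j where "j = inv_into UNIV \<sigma> i"
      have j: "j \<in> {1..N}" "\<sigma> j = i"
        using True \<sigma>in permutes_inverses(1)[OF \<sigma>] by (simp_all add: j_def)
      have "H (H' r) i = \<epsilon> j * H' r j" using True by (simp add: H_def j_def)
      also have "\<dots> = \<epsilon> j * (\<epsilon> j * r (\<sigma> j))" using j(1) by (simp add: H'_def)
      finally show ?thesis by (simp only: \<epsilon>2[OF j(1)] j(2))
    next
      case False
      with arb[OF that False] show ?thesis by (simp add: H_def restrict_def del: atLeastAtMost_iff)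
    qed
  qed
  have "theta_coeff \<tau> (g x) = (\<Sum>\<^sub>\<infinity>r\<in>{r \<in> index_set. half_sum r = x}. of_int (\<Prod>j=1..N. \<epsilon> j) * weight \<tau> r)"
    unfolding theta_coeff_def
  proof (rule infsum_reindex_bij_witness[where i = H and j = H'])
    fix r assume r: "r \<in> {r \<in> index_set. half_sum r = g x}"
    then have "g (half_sum (H' r)) = g x" by (simp add: HH' flip: half)
    then have "half_sum (H' r) = x" by (rule orthogonal_inj[OF g])
    then show "H' r \<in> {r \<in> index_set. half_sum r = x}" by (simp add: Hin)
    show "H (H' r) = r" "of_int (\<Prod>j=1..N. \<epsilon> j) * weight \<tau> (H' r) = weight \<tau> r"
      using r HH' w[of "H' r"] by simp_all
  qed (use H'H Hin half in auto)
  then show ?thesis by (simp only: infsum_cmult_right' theta_coeff_def)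
qed

end

section \<open>The heat operator on the product\<close>

text \<open>F' behaves like m u^2, so F behaves like m u^3/3. The mean value inequality for F - m
  u^3/3 on the disc of radius |u| takes the place of a Taylor expansion.\<close>

lemma DERIV_cubic_limit:
  fixes F T :: "complex \<Rightarrow> complex"
  assumes F: "\<And>u. (F has_field_derivative u * T u) (at u)" "F 0 = 0"
    and T: "(T has_field_derivative m) (at 0)" "T 0 = 0"
  shows "((\<lambda>u. F u / u ^ 3) \<longlongrightarrow> m / 3) (at 0)"
proof (rule tendstoI)
  fix e :: real assume e: "e > 0"
  have "((\<lambda>u. T u / u) \<longlongrightarrow> m) (at 0)"
    using T by (simp add: has_field_derivative_iff)
  then have "\<forall>\<^sub>F u in at 0. dist (T u / u) m < e / 2"
    using e by (intro tendstoD) auto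
  then obtain d where d: "d > 0" "\<And>u. u \<noteq> 0 \<Longrightarrow> dist u 0 < d \<Longrightarrow> dist (T u / u) m < e / 2"
    unfolding eventually_at by blast
  have "dist (F u / u ^ 3) (m / 3) < e" if u: "u \<noteq> 0" "dist u 0 < d" for u
  proof -
    define G where "G = (\<lambda>u. F u - m * u ^ 3 / 3)"
    have G': "(G has_field_derivative w * (T w - m * w)) (at w within cball 0 (norm u))" for w
      unfolding G_def
      by (auto intro!: derivative_eq_intros DERIV_subset[OF F(1)] simp: power2_eq_square algebra_simps)
    have bound: "norm (w * (T w - m * w)) \<le> e / 2 * norm u ^ 2" if "w \<in> cball 0 (norm u)" for w
    proof (cases "w = 0")
      case False
      have "norm (T w / w - m) \<le> e / 2"
        using d(2)[OF False] that u by (simp add: dist_norm)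
      then have "norm w * norm (T w / w - m) \<le> norm w * (e / 2)" by (rule mult_left_mono) simp
      moreover have "T w - m * w = w * (T w / w - m)" using False by (simp add: field_simps)
      ultimately have "norm (T w - m * w) \<le> norm w * (e / 2)" by (simp only: norm_mult)
      then have "norm (w * (T w - m * w)) \<le> norm w * (norm w * (e / 2))"
        unfolding norm_mult by (rule mult_left_mono) simp
      also have "\<dots> \<le> norm u * (norm u * (e / 2))"
        using that e by (intro mult_mono) auto
      finally show ?thesis by (simp add: power2_eq_square mult_ac)
    qed (use e in simp)
    have "norm (G u - G 0) \<le> e / 2 * norm u ^ 2 * norm (u - 0)"
      by (rule field_differentiable_bound[OF convex_cball G' bound]) auto
    then have "norm (F u - m * u ^ 3 / 3) \<le> e / 2 * norm u ^ 3"
      by (simp add: G_def F(2) power2_eq_square power3_eq_cube mult_ac)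
    moreover have "F u / u ^ 3 - m / 3 = (F u - m * u ^ 3 / 3) / u ^ 3" using u by (simp add: field_simps)
    ultimately have "norm (F u / u ^ 3 - m / 3) \<le> e / 2"
      using u by (simp add: norm_divide norm_power field_simps)
    with e show ?thesis by (simp add: dist_norm)
  qed
  with d(1) show "\<forall>\<^sub>F u in at 0. dist (F u / u ^ 3) (m / 3) < e"
    unfolding eventually_at by blast
qed

text \<open>Logarithmic differentiation twice: P''/P = (P'/P)^2 + (P'/P)'. It is legitimate near 0
  because no factor vanishes there.\<close>

lemma DERIV_prod_second:
  fixes f :: "'a \<Rightarrow> complex \<Rightarrow> complex"
  assumes A: "finite A" and f: "\<And>j u. j \<in> A \<Longrightarrow> (f j has_field_derivative f' j u) (at u)"
    and f': "\<And>j. j \<in> A \<Longrightarrow> (f' j has_field_derivative f'' j) (at 0)"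
    and nz: "\<And>j. j \<in> A \<Longrightarrow> f j 0 \<noteq> 0"
    and Q: "\<And>u. ((\<lambda>u. \<Prod>j\<in>A. f j u) has_field_derivative Q u) (at u)" "(Q has_field_derivative Q') (at 0)"
  shows "Q' = (\<Prod>j\<in>A. f j 0) * ((\<Sum>j\<in>A. f' j 0 / f j 0)\<^sup>2 + (\<Sum>j\<in>A. f'' j / f j 0 - (f' j 0 / f j 0)\<^sup>2))"
proof -
  have P': "((\<lambda>u. \<Prod>j\<in>A. f j u) has_field_derivative (\<Prod>j\<in>A. f j u) * (\<Sum>j\<in>A. f' j u / f j u)) (at u)"
    if "\<And>j. j \<in> A \<Longrightarrow> f j u \<noteq> 0" for u
  proof -
    have "((\<lambda>u. \<Prod>j\<in>A. f j u) has_field_derivative (\<Sum>j\<in>A. f' j u * (\<Prod>i\<in>A - {j}. f i u))) (at u)"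
      by (intro has_field_derivative_prod f)
    also have "(\<Sum>j\<in>A. f' j u * (\<Prod>i\<in>A - {j}. f i u)) = (\<Sum>j\<in>A. (\<Prod>j\<in>A. f j u) * (f' j u / f j u))"
      using A that by (intro sum.cong refl) (simp add: prod.remove)
    finally show ?thesis by (simp only: sum_distrib_left)
  qed
  have "\<forall>\<^sub>F u in nhds 0. \<forall>j\<in>A. f j u \<noteq> 0"
    unfolding eventually_ball_finite_distrib[OF A]
    using f nz by (intro ballI tendsto_imp_eventually_ne[where c = "f _ 0"])
      (auto intro: DERIV_isCont[OF f] simp flip: isCont_def tendsto_at_iff_tendsto_nhds)
  then have ev: "\<forall>\<^sub>F u in nhds 0. Q u = (\<Prod>j\<in>A. f j u) * (\<Sum>j\<in>A. f' j u / f j u)"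
    by eventually_elim (use P' Q(1) DERIV_unique in blast)
  have "((\<lambda>u. (\<Prod>j\<in>A. f j u) * (\<Sum>j\<in>A. f' j u / f j u)) has_field_derivative
      (\<Prod>j\<in>A. f j 0) * (\<Sum>j\<in>A. f' j 0 / f j 0) * (\<Sum>j\<in>A. f' j 0 / f j 0) +
      (\<Sum>j\<in>A. (f'' j * f j 0 - f' j 0 * f' j 0) / (f j 0 * f j 0)) * (\<Prod>j\<in>A. f j 0)) (at 0)"
    using nz by (intro DERIV_mult P' DERIV_sum DERIV_divide f f') auto
  then have "(Q has_field_derivative
      (\<Prod>j\<in>A. f j 0) * (\<Sum>j\<in>A. f' j 0 / f j 0) * (\<Sum>j\<in>A. f' j 0 / f j 0) +
      (\<Sum>j\<in>A. (f'' j * f j 0 - f' j 0 * f' j 0) / (f j 0 * f j 0)) * (\<Prod>j\<in>A. f j 0)) (at 0)"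
    by (subst DERIV_cong_ev[OF refl ev refl])
  from DERIV_unique[OF Q(2) this] have "Q' = (\<Prod>j\<in>A. f j 0) * (\<Sum>j\<in>A. f' j 0 / f j 0) * (\<Sum>j\<in>A. f' j 0 / f j 0) +
      (\<Sum>j\<in>A. (f'' j * f j 0 - f' j 0 * f' j 0) / (f j 0 * f j 0)) * (\<Prod>j\<in>A. f j 0)" .
  also have "(\<Sum>j\<in>A. (f'' j * f j 0 - f' j 0 * f' j 0) / (f j 0 * f j 0)) = (\<Sum>j\<in>A. f'' j / f j 0 - (f' j 0 / f j 0)\<^sup>2)"
    using nz by (intro sum.cong refl) (simp add: field_simps power2_eq_square)
  finally show ?thesis by (simp add: algebra_simps power2_eq_square)
qed

section \<open>Laurent coefficients of theta'/theta and theta''/theta at 0\<close>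

context
  fixes \<tau> :: complex
  assumes \<tau>: "Im \<tau> > 0"
begin

lemma theta_div_limit: "((\<lambda>u. theta \<tau> u / u) \<longlongrightarrow> theta_deriv 1 \<tau> 0) (at 0)"
  using theta_DERIV[OF \<tau>, of 0] by (simp add: has_field_derivative_iff)

lemma theta_deriv_1_0_nonzero: "theta_deriv 1 \<tau> 0 \<noteq> 0"
  using eta_nonzero[OF \<tau>] by (simp add: theta_deriv_1_0[OF \<tau>] del: One_nat_def)

lemma theta_nonzero_near_0: "\<forall>\<^sub>F u in at 0. theta \<tau> u \<noteq> 0"
  using tendsto_imp_eventually_ne[OF theta_div_limit theta_deriv_1_0_nonzero] by eventually_elim auto

text \<open>Theta and theta'' are odd in u, so both vanish to first order and the limit is the ratio
  of their derivatives at 0.\<close>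

lemma theta_second_log_limit:
  "((\<lambda>u. theta_log 2 \<tau> u) \<longlongrightarrow> theta_deriv 3 \<tau> 0 / theta_deriv 1 \<tau> 0) (at 0)"
proof -
  have "theta_deriv 2 \<tau> 0 = 0" using theta_deriv_minus[of 2 \<tau> 0] by simp
  then have "((\<lambda>u. theta_deriv 2 \<tau> u / u) \<longlongrightarrow> theta_deriv 3 \<tau> 0) (at 0)"
    using theta_deriv_DERIV_u[OF \<tau>, of 2 0] by (simp add: has_field_derivative_iff)
  from tendsto_divide[OF this theta_div_limit theta_deriv_1_0_nonzero]
  show ?thesis
    by (rule Lim_transform_eventually) (auto simp: eventually_at_filter)
qed

text \<open>This is the coefficient b of u in theta'/theta = 1/u + b u + ...; the numerator u theta'
  - theta has derivative u theta'', to which the cubic estimate applies.\<close>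

lemma theta_log_deriv_limit:
  "((\<lambda>u. (theta_log 1 \<tau> u - 1 / u) / u) \<longlongrightarrow> theta_deriv 3 \<tau> 0 / theta_deriv 1 \<tau> 0 / 3) (at 0)"
proof -
  have 2: "theta_deriv 2 \<tau> 0 = 0" using theta_deriv_minus[of 2 \<tau> 0] by simp
  have "((\<lambda>u. u * theta_deriv 1 \<tau> u - theta \<tau> u) has_field_derivative u * theta_deriv 2 \<tau> u) (at u)" for u
    using theta_deriv_DERIV_u[OF \<tau>, of 1 u] theta_DERIV[OF \<tau>, of u]
    by (auto intro!: derivative_eq_intros simp: numeral_2_eq_2)
  then have "((\<lambda>u. (u * theta_deriv 1 \<tau> u - theta \<tau> u) / u ^ 3) \<longlongrightarrow> theta_deriv 3 \<tau> 0 / 3) (at 0)"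
    by (rule DERIV_cubic_limit) (use theta_deriv_DERIV_u[OF \<tau>, of 2 0] 2 in simp_all)
  from tendsto_divide[OF this theta_div_limit theta_deriv_1_0_nonzero]
  have "((\<lambda>u. (u * theta_deriv 1 \<tau> u - theta \<tau> u) / u ^ 3 / (theta \<tau> u / u)) \<longlongrightarrow> theta_deriv 3 \<tau> 0 / theta_deriv 1 \<tau> 0 / 3) (at 0)"
    by (simp add: mult.commute)
  moreover have "\<forall>\<^sub>F u in at 0. (u * theta_deriv 1 \<tau> u - theta \<tau> u) / u ^ 3 / (theta \<tau> u / u) = (theta_log 1 \<tau> u - 1 / u) / u"
    using theta_nonzero_near_0 eventually_neq_at_within[of 0]
    by eventually_elim (simp add: field_simps power2_eq_square power3_eq_cube)
  ultimately show ?thesis by (rule Lim_transform_eventually)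
qed

end

section \<open>Failure of the heat equation for the product\<close>

context eutactic_lattice
begin

text \<open>Without the power of q the coefficient depends on x only through its class modulo the
  even sublattice.\<close>

definition reduced_coeff :: "complex \<Rightarrow> 'v \<Rightarrow> complex" where
  "reduced_coeff \<tau> x = theta_coeff \<tau> x * e2pi (- (quad \<beta> x * \<tau>))"

lemma theta_coeff_eq: "theta_coeff \<tau> x = reduced_coeff \<tau> x * e2pi (quad \<beta> x * \<tau>)"
  by (simp add: reduced_coeff_def e2pi_minus)

lemma theta_prod_nonzero_near_0:
  assumes "Im \<tau> > 0" and z: "\<And>j. j \<in> {1..N} \<Longrightarrow> \<beta> (s j) z \<noteq> 0"
  shows "\<forall>\<^sub>F t in at 0. t \<noteq> 0 \<and> (\<forall>j\<in>{1..N}. theta \<tau> (\<beta> (s j) (smul t z)) \<noteq> 0)"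
proof (intro eventually_conj)
  show "\<forall>\<^sub>F t in at 0. t \<noteq> (0 :: complex)" by (rule eventually_neq_at_within)
  show "\<forall>\<^sub>F t in at 0. \<forall>j\<in>{1..N}. theta \<tau> (\<beta> (s j) (smul t z)) \<noteq> 0"
    unfolding eventually_ball_finite_distrib[OF finite_atLeastAtMost]
  proof
    fix j assume "j \<in> {1..N}"
    then have "filterlim (\<lambda>t. t * \<beta> (s j) z) (at 0) (at 0)"
      using z by (intro filterlim_atI) (auto intro!: tendsto_eq_intros simp: eventually_at_filter)
    from eventually_compose_filterlim[OF theta_nonzero_near_0[OF assms(1)] this]
    show "\<forall>\<^sub>F t in at 0. theta \<tau> (\<beta> (s j) (smul t z)) \<noteq> 0" by (simp add: \<beta>_bilinear)
  qed
qed

lemma exists_theta_prod_nonzero: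
  assumes "Im \<tau> > 0"
  shows "\<exists>z. theta_prod \<tau> z \<noteq> 0"
proof -
  obtain z where "\<forall>j\<in>{1..N}. \<beta> (s j) z \<noteq> 0" using exists_nonorthogonal by blast
  then have "\<forall>\<^sub>F t in at 0. t \<noteq> 0 \<and> (\<forall>j\<in>{1..N}. theta \<tau> (\<beta> (s j) (smul t z)) \<noteq> 0)"
    by (intro theta_prod_nonzero_near_0 assms) auto
  then obtain t where "\<forall>j\<in>{1..N}. theta \<tau> (\<beta> (s j) (smul t z)) \<noteq> 0"
    using eventually_happens[of _ "at (0::complex)"] trivial_limit_at by blast
  then show ?thesis by (intro exI[of _ "smul t z"]) (simp add: theta_prod_def)
qed

abbreviation gram :: "nat \<Rightarrow> nat \<Rightarrow> complex" where "gram i j \<equiv> \<beta> (s i) (s j)"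

text \<open>Parseval for two star vectors: the Gram matrix is idempotent.\<close>

lemma gram_projection: "(\<Sum>k=1..N. gram i k * gram j k) = gram i j"
  by (subst \<beta>_eutactic[of "s i" "s j"]) (simp add: symmetric[of "s _" "s _"])

lemma sum_gram: "(\<Sum>i=1..N. gram i j * \<beta> (s i) z) = \<beta> (s j) z"
  by (subst \<beta>_eutactic[of "s j" z]) (rule refl)

text \<open>The quotient of \<open>\<Delta>\<Phi> - 4\<pi>\<i> \<partial>\<^sub>\<tau>\<Phi>\<close> by \<open>\<Phi> = \<Prod>\<^sub>j \<vartheta>(\<tau>, \<beta>(s\<^sub>j, z))\<close>, in terms of
  the logarithmic derivatives of the factors.\<close>

definition heat_defect :: "complex \<Rightarrow> 'v \<Rightarrow> complex" where
  "heat_defect \<tau> z =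
     (\<Sum>k=1..N. (\<Sum>j=1..N. gram j k * (theta_log 1 \<tau> (\<beta> (s j) z)))\<^sup>2 +
        (\<Sum>j=1..N. gram j k ^ 2 * (theta_log 2 \<tau> (\<beta> (s j) z) -
           (theta_log 1 \<tau> (\<beta> (s j) z))\<^sup>2))) -
     (\<Sum>j=1..N. theta_log 2 \<tau> (\<beta> (s j) z))"

text \<open>Idempotency of the Gram matrix removes the sum over the directions k. The diagonal
  squares of the logarithmic derivatives then cancel, so only products with i different from j
  remain.\<close>

lemma heat_defect_eq:
  fixes \<tau> z
  defines "l \<equiv> \<lambda>j. theta_log 1 \<tau> (\<beta> (s j) z)"
    and "B \<equiv> \<lambda>j. theta_log 2 \<tau> (\<beta> (s j) z)"
  shows "heat_defect \<tau> z = (\<Sum>i=1..N. \<Sum>j=1..N. (gram i j - (if i = j then gram j j else 0)) * (l i * l j)) -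
    (\<Sum>j=1..N. (1 - gram j j) * B j)"
proof -
  have 1: "(\<Sum>k=1..N. (\<Sum>j=1..N. gram j k * l j)\<^sup>2) = (\<Sum>i=1..N. \<Sum>j=1..N. gram i j * (l i * l j))"
  proof -
    have "(\<Sum>k=1..N. (\<Sum>j=1..N. gram j k * l j)\<^sup>2) = (\<Sum>k=1..N. \<Sum>i=1..N. \<Sum>j=1..N. (gram i k * gram j k) * (l i * l j))"
      unfolding power2_eq_square sum_product by (simp add: mult_ac)
    also have "\<dots> = (\<Sum>i=1..N. \<Sum>k=1..N. \<Sum>j=1..N. (gram i k * gram j k) * (l i * l j))" by (rule sum.swap)
    also have "\<dots> = (\<Sum>i=1..N. \<Sum>j=1..N. \<Sum>k=1..N. (gram i k * gram j k) * (l i * l j))"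
      by (intro sum.cong refl sum.swap)
    finally show ?thesis by (simp only: sum_distrib_right[symmetric] gram_projection)
  qed
  have 2: "(\<Sum>k=1..N. \<Sum>j=1..N. gram j k ^ 2 * (B j - (l j)\<^sup>2)) = (\<Sum>j=1..N. gram j j * (B j - (l j)\<^sup>2))"
  proof -
    have "(\<Sum>k=1..N. \<Sum>j=1..N. gram j k ^ 2 * (B j - (l j)\<^sup>2)) = (\<Sum>j=1..N. \<Sum>k=1..N. (gram j k * gram j k) * (B j - (l j)\<^sup>2))"
      unfolding power2_eq_square by (rule sum.swap)
    then show ?thesis by (simp only: sum_distrib_right[symmetric] gram_projection)
  qed
  have 3: "(\<Sum>i=1..N. \<Sum>j=1..N. (gram i j - (if i = j then gram j j else 0)) * (l i * l j)) =
    (\<Sum>i=1..N. \<Sum>j=1..N. gram i j * (l i * l j)) - (\<Sum>j=1..N. gram j j * (l j)\<^sup>2)"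
  proof -
    have "(\<Sum>j=1..N. (gram i j - (if i = j then gram j j else 0)) * (l i * l j)) =
      (\<Sum>j=1..N. gram i j * (l i * l j)) - gram i i * (l i)\<^sup>2" if "i \<in> {1..N}" for i
    proof -
      have "(\<Sum>j=1..N. (if i = j then gram j j else 0) * (l i * l j)) = (\<Sum>j=1..N. if i = j then gram i i * (l i)\<^sup>2 else 0)"
        by (intro sum.cong) (auto simp: power2_eq_square)
      then show ?thesis using that by (simp add: left_diff_distrib sum_subtractf)
    qed
    then show ?thesis by (simp add: sum_subtractf)
  qed
  have "heat_defect \<tau> z = (\<Sum>k=1..N. (\<Sum>j=1..N. gram j k * l j)\<^sup>2) + (\<Sum>k=1..N. \<Sum>j=1..N. gram j k ^ 2 * (B j - (l j)\<^sup>2)) - (\<Sum>j=1..N. B j)"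
    unfolding heat_defect_def by (simp only: sum.distrib l_def B_def)
  also have "\<dots> = (\<Sum>i=1..N. \<Sum>j=1..N. gram i j * (l i * l j)) - (\<Sum>j=1..N. gram j j * (l j)\<^sup>2) - (\<Sum>j=1..N. (1 - gram j j) * B j)"
    unfolding 1 2 by (simp add: algebra_simps sum.distrib sum_subtractf)
  finally show ?thesis by (simp only: 3)
qed

text \<open>On the ray t z the defect is S/t^2 + R(t) with R continuous up to 0. A constant defect
  forces S = 0 and equals the limit of R; the cross terms give 2 b (N - n), the second derivatives
  give -3 b (N - n).\<close>

lemma heat_defect_limit:
  assumes \<tau>: "Im \<tau> > 0" and z: "\<And>j. j \<in> {1..N} \<Longrightarrow> \<beta> (s j) z \<noteq> 0"
    and const: "\<forall>\<^sub>F t in at 0. heat_defect \<tau> (smul t z) = E"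
  shows "E = (of_nat (lattice_rank smul L) - of_nat N) * (theta_deriv 3 \<tau> 0 / theta_deriv 1 \<tau> 0 / 3)"
proof -
  define b where "b = theta_deriv 3 \<tau> 0 / theta_deriv 1 \<tau> 0 / 3"
  define v where "v = (\<lambda>j. \<beta> (s j) z)"
  define q where "q = (\<lambda>i j. gram i j - (if i = j then gram j j else 0))"
  define A where "A = (\<lambda>u. (theta_log 1 \<tau> u - 1 / u) / u)"
  define B where "B = (\<lambda>u. theta_log 2 \<tau> u)"
  define S where "S = (\<Sum>i=1..N. \<Sum>j=1..N. q i j / (v i * v j))"
  have at0: "filterlim (\<lambda>t. t * v j) (at 0) (at 0)" if "j \<in> {1..N}" for j
    using z[OF that] unfolding v_def by (intro filterlim_atI) (auto intro!: tendsto_eq_intros simp: eventually_at_filter)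
  have A: "((\<lambda>t. A (t * v j)) \<longlongrightarrow> b) (at 0)" and B: "((\<lambda>t. B (t * v j)) \<longlongrightarrow> 3 * b) (at 0)" if "j \<in> {1..N}" for j
    using filterlim_compose[OF theta_log_deriv_limit[OF \<tau>] at0[OF that]]
      filterlim_compose[OF theta_second_log_limit[OF \<tau>] at0[OF that]]
    by (simp_all add: A_def B_def b_def)
  define R where "R = (\<lambda>t. (\<Sum>i=1..N. \<Sum>j=1..N. q i j * (v i / v j * A (t * v i) + v j / v i * A (t * v j) + t\<^sup>2 * (v i * v j * A (t * v i) * A (t * v j)))) -
     (\<Sum>j=1..N. (1 - gram j j) * B (t * v j)))"
  have defect: "heat_defect \<tau> (smul t z) = S / t\<^sup>2 + R t" if t: "t \<noteq> 0" for t
  proof -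
    have l: "theta_log 1 \<tau> (t * \<beta> (s j) z) = 1 / (t * v j) + t * v j * A (t * v j)" if "j \<in> {1..N}" for j
      using z[OF that] t by (simp add: A_def v_def field_simps)
    have "heat_defect \<tau> (smul t z) = (\<Sum>i=1..N. \<Sum>j=1..N. q i j * ((1 / (t * v i) + t * v i * A (t * v i)) * (1 / (t * v j) + t * v j * A (t * v j)))) -
       (\<Sum>j=1..N. (1 - gram j j) * B (t * v j))"
      unfolding heat_defect_eq
      by (intro arg_cong2[of _ _ _ _ "(-)"] sum.cong refl) (simp_all only: l q_def B_def \<beta>_scale_right v_def)
    also have "(\<Sum>i=1..N. \<Sum>j=1..N. q i j * ((1 / (t * v i) + t * v i * A (t * v i)) * (1 / (t * v j) + t * v j * A (t * v j)))) =
      (\<Sum>i=1..N. \<Sum>j=1..N. q i j / (v i * v j) / t\<^sup>2 + q i j * (v i / v j * A (t * v i) + v j / v i * A (t * v j) + t\<^sup>2 * (v i * v j * A (t * v i) * A (t * v j))))"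
    proof (intro sum.cong refl)
      fix i j assume "i \<in> {1..N}" "j \<in> {1..N}"
      then have "v i \<noteq> 0" "v j \<noteq> 0" using z by (auto simp: v_def)
      then have "(1 / (t * v i) + t * v i * A (t * v i)) * (1 / (t * v j) + t * v j * A (t * v j)) =
        1 / (v i * v j) / t\<^sup>2 + (v i / v j * A (t * v i) + v j / v i * A (t * v j) + t\<^sup>2 * (v i * v j * A (t * v i) * A (t * v j)))"
        using t by (simp add: field_simps power2_eq_square)
      then show "q i j * ((1 / (t * v i) + t * v i * A (t * v i)) * (1 / (t * v j) + t * v j * A (t * v j))) =
         q i j / (v i * v j) / t\<^sup>2 + q i j * (v i / v j * A (t * v i) + v j / v i * A (t * v j) + t\<^sup>2 * (v i * v j * A (t * v i) * A (t * v j)))"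
        by (simp add: distrib_left)
    qed
    finally show ?thesis
      unfolding S_def R_def sum_divide_distrib by (simp only: sum.distrib add_diff_eq)
  qed
  \<comment> \<open>The summand with \<open>0\<^sup>2\<close> is the limit of the term carrying
    \<open>t\<^sup>2\<close>, kept in the shape that the limit rules produce.\<close>
  define R0 where "R0 = (\<Sum>i=1..N. \<Sum>j=1..N. q i j * (v i / v j * b + v j / v i * b + 0\<^sup>2 * (v i * v j * b * b))) - (\<Sum>j=1..N. (1 - gram j j) * (3 * b))"
  have R: "(R \<longlongrightarrow> R0) (at 0)"
    unfolding R_def R0_def by (intro tendsto_intros A B) auto
  have lim: "((\<lambda>t. S / t\<^sup>2) \<longlongrightarrow> E - R0) (at 0)"
  proof (rule Lim_transform_eventually[OF tendsto_diff[OF tendsto_const R]])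
    show "\<forall>\<^sub>F t in at 0. E - R t = S / t\<^sup>2"
      using const eventually_neq_at_within[of 0] by eventually_elim (use defect in auto)
  qed
  \<comment> \<open>Multiplying by \<open>t\<^sup>2\<close> isolates the constant S, which must
    therefore be the limit 0.\<close>
  have "((\<lambda>t. t\<^sup>2 * (S / t\<^sup>2)) \<longlongrightarrow> 0\<^sup>2 * (E - R0)) (at 0)"
    by (intro tendsto_intros lim)
  moreover have "\<forall>\<^sub>F t in at 0. t\<^sup>2 * (S / t\<^sup>2) = S"
    using eventually_neq_at_within[of 0] by eventually_elim auto
  ultimately have "((\<lambda>t::complex. S) \<longlongrightarrow> 0\<^sup>2 * (E - R0)) (at 0)" by (rule Lim_transform_eventually)
  then have "S = 0" by (simp add: tendsto_const_iff)
  with lim have "((\<lambda>t::complex. 0) \<longlongrightarrow> E - R0) (at 0)" by simp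
  then have "E = R0" by (simp add: tendsto_const_iff)
  \<comment> \<open>Summing over i first, the star relation collapses the Gram row to v j; what
    remains is 1 minus the diagonal entry, and the trace formula finishes.\<close>
  have q1: "(\<Sum>i=1..N. \<Sum>j=1..N. q i j * (v i / v j)) = of_nat N - of_nat (lattice_rank smul L)"
  proof -
    have "(\<Sum>i=1..N. q i j * (v i / v j)) = 1 - gram j j" if j: "j \<in> {1..N}" for j
    proof -
      have "(\<Sum>i=1..N. q i j * (v i / v j)) = (\<Sum>i=1..N. (gram i j * v i) / v j - (if i = j then gram j j else 0))"
        using z[OF j] by (intro sum.cong) (auto simp: q_def v_def left_diff_distrib)
      also have "\<dots> = (\<Sum>i=1..N. gram i j * v i) / v j - (\<Sum>i=1..N. if i = j then gram j j else 0)"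
        by (simp only: sum_subtractf sum_divide_distrib)
      also have "(\<Sum>i=1..N. gram i j * v i) = v j" by (simp only: v_def sum_gram)
      also have "(\<Sum>i=1..N. if i = j then gram j j else 0) = gram j j" using j by simp
      finally show ?thesis using z[OF j] by (simp add: v_def)
    qed
    then have "(\<Sum>j=1..N. \<Sum>i=1..N. q i j * (v i / v j)) = (\<Sum>j=1..N. 1 - gram j j)" by simp
    also have "\<dots> = of_nat N - of_nat (lattice_rank smul L)"
      by (simp add: sum_subtractf gram_trace[symmetric])
    finally show ?thesis by (subst sum.swap)
  qed
  have q2: "(\<Sum>i=1..N. \<Sum>j=1..N. q i j * (v j / v i)) = of_nat N - of_nat (lattice_rank smul L)"
  proof -
    have "(\<Sum>i=1..N. \<Sum>j=1..N. q i j * (v j / v i)) = (\<Sum>j=1..N. \<Sum>i=1..N. q i j * (v j / v i))" by (rule sum.swap)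
    also have "\<dots> = (\<Sum>j=1..N. \<Sum>i=1..N. q j i * (v j / v i))"
      by (intro sum.cong refl) (auto simp: q_def symmetric[of "s _" "s _"])
    finally show ?thesis using q1 by simp
  qed
  have "R0 = b * (\<Sum>i=1..N. \<Sum>j=1..N. q i j * (v i / v j)) + b * (\<Sum>i=1..N. \<Sum>j=1..N. q i j * (v j / v i)) - 3 * b * (\<Sum>j=1..N. 1 - gram j j)"
    unfolding R0_def by (simp add: sum_distrib_left sum.distrib algebra_simps)
  also have "(\<Sum>j=1..N. 1 - gram j j) = of_nat N - of_nat (lattice_rank smul L)"
    by (simp add: sum_subtractf gram_trace[symmetric])
  finally have "R0 = (of_nat (lattice_rank smul L) - of_nat N) * b"
    unfolding q1 q2 by (simp add: algebra_simps)
  with \<open>E = R0\<close> show ?thesis by (simp add: b_def)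
qed

end

section \<open>The common function of tau is a constant times a power of eta\<close>

lemma has_sum_sum:
  fixes f :: "'k \<Rightarrow> 'a \<Rightarrow> 'b :: topological_comm_monoid_add"
  assumes "finite K" "\<And>k. k \<in> K \<Longrightarrow> (f k has_sum S k) X"
  shows "((\<lambda>x. \<Sum>k\<in>K. f k x) has_sum (\<Sum>k\<in>K. S k)) X"
  using assms by (induction K rule: finite_induct) (auto intro!: has_sum_add)

context eutactic_lattice
begin

text \<open>\<open>fac\<close> is the form in which extremality enters: all reduced coefficients are
  constant multiples of the single function h. Differentiating h as the quotient of the product by a
  theta series with constant coefficients gives a differential equation for h.\<close>

lemma reduced_coeff_constant:
  assumes fac: "\<And>\<tau> x. Im \<tau> > 0 \<Longrightarrow> reduced_coeff \<tau> x = a x * reduced_coeff \<tau> w"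
  shows "\<exists>c. \<forall>\<tau>. Im \<tau> > 0 \<longrightarrow> eta \<tau> powi (int (lattice_rank smul L) - int N) * reduced_coeff \<tau> w = c"
proof -
  define h where "h = (\<lambda>\<tau>. reduced_coeff \<tau> w)"
  define X where "X = {x. a x \<noteq> 0}"
  have coeff: "theta_coeff \<tau> x = h \<tau> * (a x * e2pi (quad \<beta> x * \<tau>))" if "Im \<tau> > 0" for \<tau> x
    using fac[OF that, of x] by (simp add: theta_coeff_eq h_def)
  \<comment> \<open>A zero of h at some \<tau> would kill all Fourier coefficients there, and with
    them the product for every z.\<close>
  have h: "h \<tau> \<noteq> 0" if "Im \<tau> > 0" for \<tau>
  proof
    assume "h \<tau> = 0"
    then have "theta_coeff \<tau> x = 0" for x using coeff[OF that] by simp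
    then have "theta_prod \<tau> z = 0" for z
      using theta_prod_fourier[OF that, of z] has_sum_unique[OF _ has_sum_0] by force
    with exists_theta_prod_nonzero[OF that] show False by blast
  qed
  have X: "x \<in> rational_span smul L" if "x \<in> X" for x
  proof -
    have "theta_coeff \<i> x \<noteq> 0" using that h[of \<i>] by (simp add: coeff X_def)
    then show ?thesis using theta_coeff_nonzero_imp_shadow by (auto simp: shadow_def)
  qed
  define \<alpha> where "\<alpha> = (\<lambda>x. 2 * pi * Re (quad \<beta> x))"
  define b where "b = (\<lambda>y x. 2 * pi * Re (\<beta> x y))"
  \<comment> \<open>The directions in which the theta series is differentiated.
    \<open>exp_series\<close> demands real frequencies, and \<beta>(x, s_k) is rational on the
    support; direction 0 serves for the derivative in \<tau>.\<close>
  define D where "D = insert 0 (s ` {1..N})"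
  have \<alpha>: "of_real (\<alpha> x) = 2 * of_real pi * quad \<beta> x" if "x \<in> X" for x
    using quad_Re(1)[OF X[OF that]] by (simp add: \<alpha>_def)
  have b: "of_real (b y x) = 2 * of_real pi * \<beta> x y" if "x \<in> X" "y \<in> D" for x y
  proof -
    have "\<beta> x y = of_real (Re (\<beta> x y))"
    proof (cases "y = 0")
      case False
      then obtain j where j: "j \<in> {1..N}" "y = s j" using \<open>y \<in> D\<close> by (auto simp: D_def)
      obtain r where "\<beta> (s j) x = of_rat r" using star_pairing_rational[OF j(1) X[OF \<open>x \<in> X\<close>]] .
      moreover have "(of_rat r :: complex) = of_real (of_rat r)" by (cases r) (simp add: of_rat_rat)
      ultimately show ?thesis by (simp add: j(2) symmetric[of x])
    qed simp
    then show ?thesis by (simp add: b_def)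
  qed
  have ES: "exp_series X (\<lambda>x. a x * e2pi (\<beta> x z)) \<alpha> (b y)" if y: "y \<in> D" for y z
  proof
    show "0 \<le> \<alpha> x" if "x \<in> X" for x using quad_Re(2)[OF X[OF that]] by (simp add: \<alpha>_def)
    fix v t :: real assume v: "v > 0"
    \<comment> \<open>At \<tau> = i v and argument z + i t y the absolutely convergent Fourier
      series of the product has exactly the required real exponential weights, up to the constant |h
      \<tau>|.\<close>
    define \<tau> where "\<tau> = \<i> * of_real v"
    have \<tau>: "Im \<tau> > 0" using v by (simp add: \<tau>_def)
    have "(\<lambda>x. norm (theta_coeff \<tau> x * e2pi (\<beta> x (z + smul (\<i> * of_real t) y)))) summable_on X"
      by (rule summable_on_subset_banach[OF abs_summable_theta_coeff[OF \<tau>]]) simp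
    then have "(\<lambda>x. norm (1 / h \<tau>) * norm (theta_coeff \<tau> x * e2pi (\<beta> x (z + smul (\<i> * of_real t) y)))) summable_on X"
      by (rule summable_on_cmult_right)
    then show "(\<lambda>x. norm (a x * e2pi (\<beta> x z)) * exp (- \<alpha> x * v - b y x * t)) summable_on X"
    proof (rule summable_on_cong[THEN iffD1, rotated])
      fix x assume x: "x \<in> X"
      have 1: "norm (e2pi (quad \<beta> x * \<tau>)) = exp (- \<alpha> x * v)"
        unfolding norm_e2pi \<tau>_def by (subst quad_Re(1)[OF X[OF x]]) (simp add: \<alpha>_def)
      have "\<beta> x y = of_real (Re (\<beta> x y))" using b[OF x y] by (auto simp: b_def complex_eq_iff)
      then have 2: "norm (e2pi (\<beta> x (smul (\<i> * of_real t) y))) = exp (- b y x * t)"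
        unfolding norm_e2pi \<beta>_scale_right by (metis (no_types, lifting) Im_i_times Re_complex_of_real b_def mult.assoc mult.commute mult_minus_left of_real_mult)
      have "exp (- \<alpha> x * v - b y x * t) = exp (- \<alpha> x * v) * exp (- b y x * t)"
        by (simp flip: exp_add)
      then show "norm (1 / h \<tau>) * norm (theta_coeff \<tau> x * e2pi (\<beta> x (z + smul (\<i> * of_real t) y))) =
         norm (a x * e2pi (\<beta> x z)) * exp (- \<alpha> x * v - b y x * t)"
        using h[OF \<tau>] unfolding coeff[OF \<tau>] \<beta>_add_right e2pi_add norm_mult norm_divide 1 2 by simp
    qed
  qed
  \<comment> \<open>\<open>E y z \<tau> u\<close> is the theta series at z + u y. The base point z
    is absorbed into the coefficients, so one-variable derivatives in u suffice.\<close>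
  define E where "E = (\<lambda>y z. exp_series.exp_sum X (\<lambda>x. a x * e2pi (\<beta> x z)) \<alpha> (b y))"
  have E: "theta_prod \<tau> (z + smul u y) = h \<tau> * E y z \<tau> u" if \<tau>: "Im \<tau> > 0" and y: "y \<in> D" for \<tau> z u y
  proof -
    have "((\<lambda>x. theta_coeff \<tau> x * e2pi (\<beta> x (z + smul u y))) has_sum theta_prod \<tau> (z + smul u y)) X"
      using theta_prod_fourier[OF \<tau>, of "z + smul u y"]
      by (rule has_sum_cong_neutral[THEN iffD1, rotated -1]) (auto simp: coeff[OF \<tau>] X_def)
    also have "?this \<longleftrightarrow> ((\<lambda>x. h \<tau> * exp_series.exp_term (\<lambda>x. a x * e2pi (\<beta> x z)) \<alpha> (b y) \<tau> u x) has_sum theta_prod \<tau> (z + smul u y)) X"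
    proof (rule has_sum_cong)
      fix x assume x: "x \<in> X"
      have "e2pi (quad \<beta> x * \<tau>) * e2pi (\<beta> x (smul u y)) = exp (\<i> * (of_real (\<alpha> x) * \<tau> + of_real (b y x) * u))"
        unfolding \<alpha>[OF x] b[OF x y] by (simp add: e2pi_def \<beta>_bilinear algebra_simps flip: exp_add)
      then show "theta_coeff \<tau> x * e2pi (\<beta> x (z + smul u y)) = h \<tau> * exp_series.exp_term (\<lambda>x. a x * e2pi (\<beta> x z)) \<alpha> (b y) \<tau> u x"
        unfolding coeff[OF \<tau>] exp_series.exp_term_def[OF ES[OF y]] \<beta>_add_right e2pi_add by (simp only: mult_ac)
    qed
    finally show ?thesis
      using has_sum_cmult_right[OF exp_series.has_sum_exp_sum[OF ES[OF y] \<tau>], of "h \<tau>" z u]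
      unfolding E_def by (rule has_sum_unique)
  qed
  define E1 where "E1 = (\<lambda>y z. exp_series.exp_sum X (\<lambda>x. \<i> * of_real (b y x) * (a x * e2pi (\<beta> x z))) \<alpha> (b y))"
  define E2 where "E2 = (\<lambda>y z. exp_series.exp_sum X (\<lambda>x. \<i> * of_real (b y x) * (\<i> * of_real (b y x) * (a x * e2pi (\<beta> x z)))) \<alpha> (b y))"
  define E\<tau> where "E\<tau> = (\<lambda>z. exp_series.exp_sum X (\<lambda>x. \<i> * of_real (\<alpha> x) * (a x * e2pi (\<beta> x z))) \<alpha> (b 0))"
  note ES1 = exp_series.exp_series_mult_b[OF ES]
  note ES2 = exp_series.exp_series_mult_b[OF ES1]
  have D0: "0 \<in> D" and Dk: "k \<in> {1..N} \<Longrightarrow> s k \<in> D" for k by (auto simp: D_def)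
  note ES\<tau> = exp_series.exp_series_mult_\<alpha>[OF ES[OF D0]]
  have E_u: "(E y z \<tau> has_field_derivative E1 y z \<tau> u) (at u)" "(E1 y z \<tau> has_field_derivative E2 y z \<tau> u) (at u)"
    if "Im \<tau> > 0" "y \<in> D" for y z \<tau> u
    unfolding E_def E1_def E2_def
    using exp_series.exp_sum_deriv_u[OF ES[OF that(2)] that(1)] exp_series.exp_sum_deriv_u[OF ES1[OF that(2)] that(1)] by auto
  have E_\<tau>: "((\<lambda>\<tau>. E 0 z \<tau> 0) has_field_derivative E\<tau> z \<tau> 0) (at \<tau>)" if "Im \<tau> > 0" for z \<tau>
    unfolding E_def E\<tau>_def by (rule exp_series.exp_sum_deriv_\<tau>[OF ES[OF D0] that])
  \<comment> \<open>Termwise both operators multiply by -(2 pi)^2 \<beta>(x,x), by Parseval applied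
    to the squares of \<beta>(s_k, x).\<close>
  have heat: "4 * of_real pi * \<i> * E\<tau> z \<tau> 0 = (\<Sum>k=1..N. E2 (s k) z \<tau> 0)" if \<tau>: "Im \<tau> > 0" for z \<tau>
  proof (rule has_sum_unique)
    have alg1: "4 * p * \<i> * (\<i> * (2 * p * (Q / 2)) * A * e) = - (4 * p\<^sup>2) * Q * (A * e)"
      and alg2: "\<i> * (2 * p * Q) * (\<i> * (2 * p * Q) * A) * e = - (4 * p\<^sup>2) * (Q * Q) * (A * e)" for p Q A e :: complex
      by (simp_all add: power2_eq_square)
    let ?T = "\<lambda>k. exp_series.exp_term (\<lambda>x. \<i> * of_real (b (s k) x) * (\<i> * of_real (b (s k) x) * (a x * e2pi (\<beta> x z)))) \<alpha> (b (s k)) \<tau> 0"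
    let ?t = "\<lambda>x. a x * e2pi (\<beta> x z) * exp (\<i> * (of_real (\<alpha> x) * \<tau>))"
    have "((\<lambda>x. 4 * of_real pi * \<i> * exp_series.exp_term (\<lambda>x. \<i> * of_real (\<alpha> x) * (a x * e2pi (\<beta> x z))) \<alpha> (b 0) \<tau> 0 x) has_sum 4 * of_real pi * \<i> * E\<tau> z \<tau> 0) X"
      unfolding E\<tau>_def by (intro has_sum_cmult_right exp_series.has_sum_exp_sum[OF ES\<tau> \<tau>])
    moreover have eq1: "4 * of_real pi * \<i> * exp_series.exp_term (\<lambda>x. \<i> * of_real (\<alpha> x) * (a x * e2pi (\<beta> x z))) \<alpha> (b 0) \<tau> 0 x =
        - (4 * of_real pi ^ 2) * \<beta> x x * ?t x" if x: "x \<in> X" for x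
      unfolding exp_series.exp_term_def[OF ES\<tau>] \<alpha>[OF x] quad_def by (simp only: mult_zero_right add_0_right alg1)
    ultimately show "((\<lambda>x. - (4 * of_real pi ^ 2) * \<beta> x x * ?t x) has_sum 4 * of_real pi * \<i> * E\<tau> z \<tau> 0) X"
      using has_sum_cong[of X _ "\<lambda>x. - (4 * of_real pi ^ 2) * \<beta> x x * ?t x", OF eq1] by blast
    have "((\<lambda>x. \<Sum>k=1..N. ?T k x) has_sum
       (\<Sum>k=1..N. E2 (s k) z \<tau> 0)) X"
      unfolding E2_def by (intro has_sum_sum exp_series.has_sum_exp_sum[OF ES2[OF Dk] \<tau>]) auto
    moreover have eq2: "(\<Sum>k=1..N. ?T k x) =
        - (4 * of_real pi ^ 2) * \<beta> x x * ?t x" if x: "x \<in> X" for x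
    proof -
      have "?T k x =
        - (4 * of_real pi ^ 2) * (\<beta> (s k) x * \<beta> (s k) x) * ?t x" if k: "k \<in> {1..N}" for k
        unfolding exp_series.exp_term_def[OF ES2[OF Dk[OF k]]] b[OF x Dk[OF k]] symmetric[of x "s k"]
        by (simp only: mult_zero_right add_0_right alg2)
      then have "(\<Sum>k=1..N. ?T k x) =
        (\<Sum>k=1..N. - (4 * of_real pi ^ 2) * (\<beta> (s k) x * \<beta> (s k) x) * ?t x)"
        by (rule sum.cong[OF refl])
      also have "\<dots> = - (4 * of_real pi ^ 2) * \<beta> x x * ?t x"
        by (simp only: \<beta>_eutactic[of x x] sum_distrib_left[symmetric] sum_distrib_right[symmetric])
      finally show ?thesis .
    qed
    ultimately show "((\<lambda>x. - (4 * of_real pi ^ 2) * \<beta> x x * ?t x) has_sum (\<Sum>k=1..N. E2 (s k) z \<tau> 0)) X"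
      using has_sum_cong[of X _ "\<lambda>x. - (4 * of_real pi ^ 2) * \<beta> x x * ?t x", OF eq2] by blast
  qed
  \<comment> \<open>For h = product / E, the derivative of the numerator comes from the heat
    equation of the theta factors and that of E from \<open>heat\<close>, its second derivatives
    being those of the product divided by h. What does not cancel is the defect.\<close>
  have h_deriv: "(h has_field_derivative - (h \<tau> * heat_defect \<tau> z / (4 * of_real pi * \<i>))) (at \<tau>)"
    if \<tau>: "Im \<tau> > 0" and nz: "\<And>j. j \<in> {1..N} \<Longrightarrow> theta \<tau> (\<beta> (s j) z) \<noteq> 0" for \<tau> z
  proof -
    define P where "P = theta_prod \<tau> z"
    define B where "B = (\<Sum>j=1..N. theta_log 2 \<tau> (\<beta> (s j) z))"
    have P: "P \<noteq> 0" using nz by (auto simp: P_def theta_prod_def)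
    have E0: "theta_prod \<tau> z = h \<tau> * E 0 z \<tau> 0" if "Im \<tau> > 0" for \<tau>
      using E[OF that D0, of z 0] by simp
    have E0nz: "E 0 z \<tau> 0 \<noteq> 0" using P E0[OF \<tau>] by (auto simp: P_def)
    have E2k: "h \<tau> * E2 (s k) z \<tau> 0 = P * ((\<Sum>j=1..N. gram j k * (theta_log 1 \<tau> (\<beta> (s j) z)))\<^sup>2 +
        (\<Sum>j=1..N. gram j k ^ 2 * (theta_log 2 \<tau> (\<beta> (s j) z) -
           (theta_log 1 \<tau> (\<beta> (s j) z))\<^sup>2)))" if k: "k \<in> {1..N}" for k
    proof -
      define f where "f = (\<lambda>j u. theta \<tau> (\<beta> (s j) z + u * gram j k))"
      define f' where "f' = (\<lambda>j u. theta_deriv 1 \<tau> (\<beta> (s j) z + u * gram j k) * gram j k)"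
      define f'' where "f'' = (\<lambda>j. theta_deriv 2 \<tau> (\<beta> (s j) z) * gram j k * gram j k)"
      have prod: "(\<lambda>u. \<Prod>j=1..N. f j u) = (\<lambda>u. h \<tau> * E (s k) z \<tau> u)"
        using E[OF \<tau> Dk[OF k], of z] by (simp add: f_def theta_prod_def \<beta>_bilinear fun_eq_iff)
      have "h \<tau> * E2 (s k) z \<tau> 0 = (\<Prod>j=1..N. f j 0) * ((\<Sum>j=1..N. f' j 0 / f j 0)\<^sup>2 + (\<Sum>j=1..N. f'' j / f j 0 - (f' j 0 / f j 0)\<^sup>2))"
      proof (rule DERIV_prod_second)
        fix j u
        have lin: "((\<lambda>u. \<beta> (s j) z + u * gram j k) has_field_derivative gram j k) (at u)" for u
          by (auto intro!: derivative_eq_intros)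
        show "(f j has_field_derivative f' j u) (at u)"
          unfolding f_def f'_def by (rule DERIV_chain2[OF theta_DERIV[OF \<tau>] lin])
        have "(f' j has_field_derivative theta_deriv (Suc 1) \<tau> (\<beta> (s j) z + 0 * gram j k) * gram j k * gram j k) (at 0)"
          unfolding f'_def by (intro DERIV_cmult_right DERIV_chain2[OF theta_deriv_DERIV_u[OF \<tau>] lin])
        then show "(f' j has_field_derivative f'' j) (at 0)"
          by (simp add: f''_def numeral_2_eq_2)
        show "((\<lambda>u. \<Prod>j=1..N. f j u) has_field_derivative h \<tau> * E1 (s k) z \<tau> u) (at u)"
          unfolding prod by (intro DERIV_cmult E_u \<tau> Dk k)
        show "((\<lambda>u. h \<tau> * E1 (s k) z \<tau> u) has_field_derivative h \<tau> * E2 (s k) z \<tau> 0) (at 0)"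
          by (intro DERIV_cmult E_u \<tau> Dk k)
      qed (use nz in \<open>auto simp: f_def\<close>)
      also have "(\<Prod>j=1..N. f j 0) = P" by (simp add: f_def P_def theta_prod_def)
      also have "(\<Sum>j=1..N. f' j 0 / f j 0) = (\<Sum>j=1..N. gram j k * (theta_log 1 \<tau> (\<beta> (s j) z)))"
        by (simp add: f'_def f_def mult.commute)
      also have "(\<Sum>j=1..N. f'' j / f j 0 - (f' j 0 / f j 0)\<^sup>2) = (\<Sum>j=1..N. gram j k ^ 2 * (theta_log 2 \<tau> (\<beta> (s j) z) -
           (theta_log 1 \<tau> (\<beta> (s j) z))\<^sup>2))"
        by (rule sum.cong) (simp_all add: f''_def f'_def f_def power2_eq_square right_diff_distrib mult_ac)
      finally show ?thesis .
    qed
    have "h \<tau> * (\<Sum>k=1..N. E2 (s k) z \<tau> 0) = P * (heat_defect \<tau> z + B)"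
      unfolding sum_distrib_left heat_defect_def B_def by (simp add: E2k flip: sum_distrib_left)
    then have E\<tau>_eq: "h \<tau> * (4 * of_real pi * \<i> * E\<tau> z \<tau> 0) = P * (heat_defect \<tau> z + B)" by (simp only: heat[OF \<tau>])
    have P_deriv: "((\<lambda>\<tau>. theta_prod \<tau> z) has_field_derivative P * (B / (4 * of_real pi * \<i>))) (at \<tau>)"
    proof -
      have "((\<lambda>\<tau>. theta \<tau> (\<beta> (s j) z)) has_field_derivative theta_deriv 2 \<tau> (\<beta> (s j) z) / (4 * of_real pi * \<i>)) (at \<tau>)" for j
        using theta_deriv_DERIV_\<tau>[OF \<tau>, of 0 "\<beta> (s j) z"] by (simp add: theta_deriv_0_eq numeral_2_eq_2)
      then have "((\<lambda>\<tau>. theta_prod \<tau> z) has_field_derivative (\<Sum>j=1..N. theta_deriv 2 \<tau> (\<beta> (s j) z) / (4 * of_real pi * \<i>) * (\<Prod>i\<in>{1..N} - {j}. theta \<tau> (\<beta> (s i) z)))) (at \<tau>)"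
        unfolding theta_prod_def by (intro has_field_derivative_prod)
      also have "(\<Sum>j=1..N. theta_deriv 2 \<tau> (\<beta> (s j) z) / (4 * of_real pi * \<i>) * (\<Prod>i\<in>{1..N} - {j}. theta \<tau> (\<beta> (s i) z))) =
        (\<Sum>j=1..N. P * (theta_log 2 \<tau> (\<beta> (s j) z) / (4 * of_real pi * \<i>)))"
      proof (intro sum.cong refl)
        fix j assume j: "j \<in> {1..N}"
        have "P = theta \<tau> (\<beta> (s j) z) * (\<Prod>i\<in>{1..N} - {j}. theta \<tau> (\<beta> (s i) z))"
          unfolding P_def theta_prod_def using j by (intro prod.remove) auto
        then show "theta_deriv 2 \<tau> (\<beta> (s j) z) / (4 * of_real pi * \<i>) * (\<Prod>i\<in>{1..N} - {j}. theta \<tau> (\<beta> (s i) z)) =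
          P * (theta_log 2 \<tau> (\<beta> (s j) z) / (4 * of_real pi * \<i>))"
          using nz[OF j] by (simp only:) (simp add: field_simps)
      qed
      finally show ?thesis by (simp only: sum_distrib_left[symmetric] sum_divide_distrib[symmetric] B_def)
    qed
    have "((\<lambda>\<tau>. theta_prod \<tau> z / E 0 z \<tau> 0) has_field_derivative
       (P * (B / (4 * of_real pi * \<i>)) * E 0 z \<tau> 0 - P * E\<tau> z \<tau> 0) / (E 0 z \<tau> 0 * E 0 z \<tau> 0)) (at \<tau>)"
      unfolding P_def by (intro DERIV_divide P_deriv[unfolded P_def] E_\<tau> \<tau> E0nz)
    moreover have "\<forall>\<^sub>F \<tau>' in nhds \<tau>. h \<tau>' = theta_prod \<tau>' z / E 0 z \<tau>' 0"
    proof -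
      have "\<forall>\<^sub>F \<tau>' in nhds \<tau>. E 0 z \<tau>' 0 \<noteq> 0"
      proof (rule tendsto_imp_eventually_ne[OF _ E0nz])
        show "((\<lambda>\<tau>'. E 0 z \<tau>' 0) \<longlongrightarrow> E 0 z \<tau> 0) (nhds \<tau>)"
          using DERIV_isCont[OF E_\<tau>[OF \<tau>, of z]]
          unfolding isCont_def tendsto_at_iff_tendsto_nhds[of "\<lambda>\<tau>'. E 0 z \<tau>' 0" \<tau>] .
      qed
      moreover have "\<forall>\<^sub>F \<tau>' in nhds \<tau>. \<tau>' \<in> {\<tau>. Im \<tau> > 0}"
        using \<tau> by (intro eventually_nhds_in_open open_halfspace_Im_gt) auto
      ultimately show ?thesis by eventually_elim (simp add: E0)
    qed
    ultimately have "(h has_field_derivative (P * (B / (4 * of_real pi * \<i>)) * E 0 z \<tau> 0 - P * E\<tau> z \<tau> 0) / (E 0 z \<tau> 0 * E 0 z \<tau> 0)) (at \<tau>)"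
      by (subst DERIV_cong_ev[OF refl _ refl])
    also have "(P * (B / (4 * of_real pi * \<i>)) * E 0 z \<tau> 0 - P * E\<tau> z \<tau> 0) / (E 0 z \<tau> 0 * E 0 z \<tau> 0) = - (h \<tau> * heat_defect \<tau> z / (4 * of_real pi * \<i>))"
    proof -
      define e where "e = E 0 z \<tau> 0"
      define K where "K = 4 * of_real pi * \<i>"
      have K: "K \<noteq> 0" by (simp add: K_def)
      have Pe: "P = h \<tau> * e" using E0[OF \<tau>] by (simp add: P_def e_def)
      have "h \<tau> * (K * E\<tau> z \<tau> 0) = h \<tau> * (e * (heat_defect \<tau> z + B))" using E\<tau>_eq unfolding Pe K_def by (simp only: mult.assoc)
      then have "K * E\<tau> z \<tau> 0 = e * (heat_defect \<tau> z + B)" using h[OF \<tau>] by simp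
      then have E\<tau>_div: "E\<tau> z \<tau> 0 = e * (heat_defect \<tau> z + B) / K" using K by (simp add: field_simps)
      have "e \<noteq> 0" using E0nz by (simp add: e_def)
      then show ?thesis
        unfolding Pe e_def[symmetric] K_def[symmetric] E\<tau>_div using K by (simp add: field_simps)
    qed
    finally show ?thesis .
  qed
  obtain z0 where z0: "\<And>j. j \<in> {1..N} \<Longrightarrow> \<beta> (s j) z0 \<noteq> 0" using exists_nonorthogonal by blast
  define d where "d = int (lattice_rank smul L) - int N"
  have h': "(h has_field_derivative - (h \<tau> * (of_int d * (deriv eta \<tau> / eta \<tau>)))) (at \<tau>)" if \<tau>: "Im \<tau> > 0" for \<tau>
  proof -
    have ev: "\<forall>\<^sub>F t in at 0. t \<noteq> 0 \<and> (\<forall>j\<in>{1..N}. theta \<tau> (\<beta> (s j) (smul t z0)) \<noteq> 0)"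
      by (rule theta_prod_nonzero_near_0[OF \<tau> z0])
    then obtain t where t: "\<forall>j\<in>{1..N}. theta \<tau> (\<beta> (s j) (smul t z0)) \<noteq> 0"
      using eventually_happens[of _ "at (0::complex)"] trivial_limit_at by blast
    define H where "H = heat_defect \<tau> (smul t z0)"
    have H: "(h has_field_derivative - (h \<tau> * H / (4 * of_real pi * \<i>))) (at \<tau>)"
      unfolding H_def using t by (intro h_deriv[OF \<tau>]) auto
    \<comment> \<open>The derivative of h does not involve z, so the defect takes the same value at
      all admissible points of the ray and may be computed as t tends to 0.\<close>
    have "\<forall>\<^sub>F t in at 0. heat_defect \<tau> (smul t z0) = H"
      using ev
    proof eventually_elim
      case (elim t)
      then have "(h has_field_derivative - (h \<tau> * heat_defect \<tau> (smul t z0) / (4 * of_real pi * \<i>))) (at \<tau>)"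
        by (intro h_deriv[OF \<tau>]) auto
      from DERIV_unique[OF this H] h[OF \<tau>] show ?case by simp
    qed
    then have "H = (of_nat (lattice_rank smul L) - of_nat N) * (theta_deriv 3 \<tau> 0 / theta_deriv 1 \<tau> 0 / 3)"
      by (intro heat_defect_limit[where z = z0] \<tau> z0)
    \<comment> \<open>Here theta'''(0)/theta'(0) = 12 pi i eta'/eta enters.\<close>
    also have "\<dots> = of_int d * (deriv eta \<tau> / eta \<tau>) * (4 * of_real pi * \<i>)"
      unfolding eta_deriv[OF \<tau>] theta_deriv_1_0[OF \<tau>] using eta_nonzero[OF \<tau>]
      by (simp add: d_def field_simps power2_eq_square power3_eq_cube)
    finally show ?thesis using H by (simp add: mult.assoc)
  qed
  have "((\<lambda>\<tau>. eta \<tau> powi d * h \<tau>) has_field_derivative 0) (at \<tau> within upper_half_plane)" if \<tau>: "\<tau> \<in> upper_half_plane" for \<tau>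
  proof -
    have Im: "Im \<tau> > 0" using \<tau> by (simp add: upper_half_plane_def)
    have op: "open upper_half_plane" by (simp add: upper_half_plane_def open_halfspace_Im_gt)
    have "((\<lambda>\<tau>. eta \<tau> powi d) has_field_derivative of_int d * eta \<tau> powi (d - 1) * deriv eta \<tau>) (at \<tau>)"
      by (intro DERIV_power_int holomorphic_derivI[OF holomorphic_on_eta op \<tau>] disjI2 eta_nonzero Im)
    \<comment> \<open>The logarithmic derivatives of the two factors are d eta'/eta and -d
      eta'/eta.\<close>
    from DERIV_mult[OF this h'[OF Im]]
    have "((\<lambda>\<tau>. eta \<tau> powi d * h \<tau>) has_field_derivative 0) (at \<tau>)"
      using eta_nonzero[OF Im] by (simp add: power_int_diff field_simps)
    then show ?thesis by (rule has_field_derivative_at_within)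
  qed
  moreover have "convex upper_half_plane" by (simp add: upper_half_plane_def convex_halfspace_Im_gt)
  ultimately have "\<exists>c. \<forall>\<tau>\<in>upper_half_plane. eta \<tau> powi d * h \<tau> = c"
    by (intro has_field_derivative_zero_constant)
  then show ?thesis unfolding h_def d_def upper_half_plane_def by blast
qed

end

section \<open>Extremal stars\<close>

lemma prod_signs_unique:
  fixes s :: "nat \<Rightarrow> 'v::real_normed_vector"
  assumes nz: "\<And>j. j \<in> {1..N} \<Longrightarrow> s j \<noteq> 0"
    and sp: "signed_permutation N s g \<sigma> \<epsilon>" "signed_permutation N s g \<sigma>' \<epsilon>'"
  shows "(\<Prod>j=1..N. \<epsilon> j) = (\<Prod>j=1..N. \<epsilon>' j)"
proof -
  \<comment> \<open>As \<open>f\<close> is odd, \<open>\<Prod>\<epsilon>\<^sub>j\<close> is the quotient of \<open>\<Prod>f(g s\<^sub>j)\<close> by \<open>\<Prod>f(s\<^sub>j)\<close>.\<close>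
  define f :: "'v \<Rightarrow> int" where "f = (\<lambda>v. if v = (SOME u. u \<in> {v, - v}) then 1 else - 1)"
  have f_minus: "f (- v) = - f v" if "v \<noteq> 0" for v
  proof -
    have "(SOME u. u \<in> {v, - v}) \<in> {v, - v}" by (rule someI[of _ v]) simp
    moreover have "v \<noteq> - v" using that by (simp add: eq_neg_iff_add_eq_0 flip: scaleR_2)
    moreover have "{- v, - (- v)} = {v, - v}" by auto
    ultimately show ?thesis unfolding f_def by auto
  qed
  have f2: "f v * f v = 1" for v by (simp add: f_def)
  have eq: "(\<Prod>j=1..N. \<epsilon> j) = (\<Prod>j=1..N. f (g (s j))) * (\<Prod>j=1..N. f (s j))"
    if "signed_permutation N s g \<sigma> \<epsilon>" for \<sigma> \<epsilon>
  proof -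
    have \<sigma>: "\<sigma> permutes {1..N}" and \<epsilon>: "\<And>j. j \<in> {1..N} \<Longrightarrow> \<epsilon> j = 1 \<or> \<epsilon> j = - 1"
      and gs: "\<And>j. j \<in> {1..N} \<Longrightarrow> g (s j) = of_int (\<epsilon> j) *\<^sub>R s (\<sigma> j)"
      using that unfolding signed_permutation_def by auto
    have "f (g (s j)) = \<epsilon> j * f (s (\<sigma> j))" if j: "j \<in> {1..N}" for j
      using \<epsilon>[OF j] gs[OF j] f_minus[OF nz[of "\<sigma> j"]] permutes_in_image[OF \<sigma>, of j] j by auto
    then have "(\<Prod>j=1..N. f (g (s j))) = (\<Prod>j=1..N. \<epsilon> j) * (\<Prod>j=1..N. f (s (\<sigma> j)))"
      by (simp add: prod.distrib)
    also have "(\<Prod>j=1..N. f (s (\<sigma> j))) = (\<Prod>j=1..N. f (s j))"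
      by (rule prod.permute[OF \<sigma>, unfolded o_def, symmetric])
    finally show ?thesis
      by (simp add: mult.assoc f2 flip: prod.distrib)
  qed
  show ?thesis using eq[OF sp(1)] eq[OF sp(2)] by simp
qed

context eutactic_lattice
begin

definition jacobi_exponent :: int where
  "jacobi_exponent = int (lattice_rank smul L) - int N"

definition jacobi_product :: "complex \<Rightarrow> 'v \<Rightarrow> complex" where
  "jacobi_product \<tau> z = eta \<tau> powi jacobi_exponent * theta_prod \<tau> z"

lemma jacobi_product_fourier:
  assumes \<tau>: "Im \<tau> > 0"
    and c: "\<And>x. eta \<tau> powi jacobi_exponent * theta_coeff \<tau> x = c x * e2pi (quad \<beta> x * \<tau>)"
  shows "((\<lambda>x. c x * e2pi (quad \<beta> x * \<tau>) * e2pi (\<beta> x z)) has_sum jacobi_product \<tau> z) UNIV"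
proof -
  have "eta \<tau> powi jacobi_exponent * (theta_coeff \<tau> x * e2pi (\<beta> x z)) =
      c x * e2pi (quad \<beta> x * \<tau>) * e2pi (\<beta> x z)" for x
    by (simp only: mult.assoc[symmetric] c)
  with has_sum_cmult_right[OF theta_prod_fourier[OF \<tau>], of "eta \<tau> powi jacobi_exponent" z]
  show ?thesis by (simp only: jacobi_product_def)
qed

end

section \<open>The action of G on the classes and on the coefficients\<close>

locale extremal_star = eutactic_lattice smul L \<beta> N s
  for smul :: "complex \<Rightarrow> 'v::real_normed_vector \<Rightarrow> 'v" and L :: "'v set" and \<beta> and N s +
  fixes G :: "('v \<Rightarrow> 'v) set"
  assumes subgroup: "subgroup G (orthogonal_group smul L \<beta>)"
    and invariant: "invariant_up_to_signs G N s"
    and extremal: "extremal smul L \<beta> G N s"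
begin

lemma G_orthogonal: "g \<in> G \<Longrightarrow> g \<in> carrier (orthogonal_group smul L \<beta>)"
  using subgroup.subset[OF subgroup] by blast

lemma G_id: "id \<in> G"
  using subgroup.one_closed[OF subgroup] by (simp add: orthogonal_group_def)

lemma G_comp: "g \<in> G \<Longrightarrow> g' \<in> G \<Longrightarrow> g \<circ> g' \<in> G"
  using subgroup.m_closed[OF subgroup] by (simp add: orthogonal_group_def)

lemma G_linear: "g \<in> G \<Longrightarrow> Vector_Spaces.linear smul smul g"
  using G_orthogonal by (simp add: orthogonal_group_def)

lemma G_lattice: "g \<in> G \<Longrightarrow> x \<in> L \<Longrightarrow> g x \<in> L"
  using G_orthogonal by (auto simp: orthogonal_group_def bij_betw_def)

lemma G_add: "g \<in> G \<Longrightarrow> g (x + y) = g x + g y"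
  and G_scale: "g \<in> G \<Longrightarrow> g (smul c x) = smul c (g x)"
  and G_sum: "g \<in> G \<Longrightarrow> g (sum f A) = (\<Sum>a\<in>A. g (f a))"
proof -
  assume "g \<in> G"
  then interpret g: Vector_Spaces.linear smul smul g by (rule G_linear)
  show "g (x + y) = g x + g y" "g (smul c x) = smul c (g x)"
    "g (sum f A) = (\<Sum>a\<in>A. g (f a))"
    by (simp_all add: g.add g.scale g.sum)
qed

lemma G_quad: "g \<in> G \<Longrightarrow> quad \<beta> (g x) = quad \<beta> x"
  by (simp add: quad_def orthogonal_\<beta>[OF G_orthogonal])

lemma G_inj: "g \<in> G \<Longrightarrow> g x = g y \<Longrightarrow> x = y"
  by (rule orthogonal_inj[OF G_orthogonal])

lemma G_even: "g \<in> G \<Longrightarrow> x \<in> even_sublattice L \<beta> \<Longrightarrow> g x \<in> even_sublattice L \<beta>"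
  by (simp add: even_sublattice_def G_lattice G_quad)

text \<open>An element is determined by its values on the star, which spans, and each of these
  values is a star vector up to sign.\<close>

lemma finite_G: "finite G"
proof (rule finite_imageD)
  let ?E = "\<lambda>g. restrict (\<lambda>j. g (s j)) {1..N}"
  let ?V = "s ` {1..N} \<union> (\<lambda>j. - s j) ` {1..N}"
  show "finite (?E ` G)"
  proof (rule finite_subset)
    show "?E ` G \<subseteq> {1..N} \<rightarrow>\<^sub>E ?V"
    proof (rule image_subsetI)
      fix g assume "g \<in> G"
      then obtain \<sigma> \<epsilon> where sp: "signed_permutation N s g \<sigma> \<epsilon>"
        using invariant unfolding invariant_up_to_signs_def by blast
      have "g (s j) \<in> ?V" if j: "j \<in> {1..N}" for j
      proof -
        have "\<sigma> j \<in> {1..N}"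
          using sp j permutes_in_image[of \<sigma> "{1..N}" j] unfolding signed_permutation_def by blast
        moreover have "g (s j) = s (\<sigma> j) \<or> g (s j) = - s (\<sigma> j)"
          using sp j unfolding signed_permutation_def by force
        ultimately show ?thesis by blast
      qed
      then show "?E g \<in> {1..N} \<rightarrow>\<^sub>E ?V" by (intro restrict_PiE_iff[THEN iffD2] ballI)
    qed
    show "finite ({1..N} \<rightarrow>\<^sub>E ?V)" by (intro finite_PiE) auto
  qed
  show "inj_on ?E G"
  proof (rule inj_onI)
    fix g g' assume g: "g \<in> G" "g' \<in> G" and eq: "?E g = ?E g'"
    have "g (s j) = g' (s j)" if "j \<in> {1..N}" for j
      using fun_cong[OF eq, of j] that by simp
    then have "g (\<Sum>j=1..N. smul (\<beta> (s j) x) (s j)) = g' (\<Sum>j=1..N. smul (\<beta> (s j) x) (s j))" for x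
      using g by (simp add: G_sum G_scale)
    then show "g = g'" by (intro ext) (simp only: eutactic[symmetric])
  qed
qed

text \<open>Left translation by g is injective on the finite set G, hence onto, so it attains the
  identity.\<close>

lemma G_inverse:
  assumes "g \<in> G"
  obtains g' where "g' \<in> G" "\<And>x. g (g' x) = x" "\<And>x. g' (g x) = x"
proof -
  have "inj_on (\<lambda>h. g \<circ> h) G"
    by (rule inj_onI) (metis G_inj[OF assms] comp_apply ext)
  then have "(\<lambda>h. g \<circ> h) ` G = G"
    using finite_G G_comp[OF assms] by (intro endo_inj_surj) auto
  then obtain g' where g': "g' \<in> G" "g \<circ> g' = id" using G_id by (metis imageE)
  have 1: "g (g' x) = x" for x using g'(2) by (metis comp_apply id_apply)
  have "g' (g x) = x" for x using 1[of "g x"] G_inj[OF assms] by blast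
  with g'(1) 1 that show ?thesis by blast
qed

lemma sn_eq:
  assumes "signed_permutation N s g \<sigma> \<epsilon>"
  shows "sn N s g = (\<Prod>j=1..N. \<epsilon> j)"
  unfolding sn_def
proof (rule the_equality)
  fix p assume "\<exists>\<sigma> \<epsilon>. signed_permutation N s g \<sigma> \<epsilon> \<and> p = (\<Prod>j=1..N. \<epsilon> j)"
  with prod_signs_unique[OF star_nonzero _ assms] show "p = (\<Prod>j=1..N. \<epsilon> j)" by blast
qed (use assms in blast)

lemma sn_cases:
  assumes "g \<in> G"
  shows "sn N s g = 1 \<or> sn N s g = -1"
proof -
  obtain \<sigma> \<epsilon> where sp: "signed_permutation N s g \<sigma> \<epsilon>"
    using invariant assms unfolding invariant_up_to_signs_def by blast
  have "(\<Prod>j\<in>J. \<epsilon> j) = 1 \<or> (\<Prod>j\<in>J. \<epsilon> j) = -1" if "finite J" "J \<subseteq> {1..N}" for J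
    using that
  proof (induction J rule: finite_induct)
    case (insert j J)
    then have "(\<Prod>j\<in>J. \<epsilon> j) = 1 \<or> (\<Prod>j\<in>J. \<epsilon> j) = -1" by blast
    moreover have "\<epsilon> j = 1 \<or> \<epsilon> j = -1" using sp insert.prems unfolding signed_permutation_def by auto
    moreover have "(\<Prod>j\<in>insert j J. \<epsilon> j) = \<epsilon> j * (\<Prod>j\<in>J. \<epsilon> j)" using insert.hyps by simp
    ultimately show ?case by (elim disjE) simp_all
  qed simp
  then show ?thesis unfolding sn_eq[OF sp] by blast
qed

lemma theta_coeff_G:
  assumes "g \<in> G"
  shows "theta_coeff \<tau> (g x) = of_int (sn N s g) * theta_coeff \<tau> x"
proof -
  obtain \<sigma> \<epsilon> where sp: "signed_permutation N s g \<sigma> \<epsilon>"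
    using invariant assms unfolding invariant_up_to_signs_def by blast
  then show ?thesis
    unfolding sn_eq[OF sp] by (rule theta_coeff_signed_permutation[OF G_orthogonal[OF assms]])
qed

lemma reduced_coeff_G: "g \<in> G \<Longrightarrow> reduced_coeff \<tau> (g x) = of_int (sn N s g) * reduced_coeff \<tau> x"
  by (simp add: reduced_coeff_def theta_coeff_G G_quad)

lemma reduced_coeff_cong:
  assumes "coset x = coset y"
  shows "reduced_coeff \<tau> x = reduced_coeff \<tau> y"
proof -
  have "x - y \<in> even_sublattice L \<beta>" using assms by (simp add: coset_eq_iff)
  from theta_coeff_shift[OF this, of \<tau> y]
  have eq: "theta_coeff \<tau> x = e2pi ((quad \<beta> x - quad \<beta> y) * \<tau>) * theta_coeff \<tau> y" by simp
  have "reduced_coeff \<tau> x = theta_coeff \<tau> y * e2pi ((quad \<beta> x - quad \<beta> y) * \<tau> + - (quad \<beta> x * \<tau>))"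
    unfolding reduced_coeff_def eq e2pi_add by (simp only: mult_ac)
  also have "(quad \<beta> x - quad \<beta> y) * \<tau> + - (quad \<beta> x * \<tau>) = - (quad \<beta> y * \<tau>)" by (simp add: algebra_simps)
  finally show ?thesis by (simp add: reduced_coeff_def)
qed

lemma G_image_coset:
  assumes g: "g \<in> G"
  shows "g ` coset x = coset (g x)"
proof -
  obtain g' where g': "g' \<in> G" "\<And>x. g (g' x) = x" using G_inverse[OF g] by metis
  have "g ` even_sublattice L \<beta> = even_sublattice L \<beta>"
    using G_even[OF g] G_even[OF g'(1)] g'(2) by (auto intro!: image_eqI[of _ g "g' _"])
  then show ?thesis
    unfolding even_coset_def by (metis (no_types, lifting) G_add[OF g] image_cong image_image)
qed

text \<open>Existence of the extremal orbit supplies w; its uniqueness forces every x with nonzero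
  coefficient into that orbit.\<close>

lemma support_in_orbit:
  obtains w where "w \<in> shadow smul L \<beta>"
    "\<And>\<tau> x. reduced_coeff \<tau> x \<noteq> 0 \<Longrightarrow> \<exists>g\<in>G. coset x = coset (g w)"
proof -
  define orb where "orb = (\<lambda>C. {g ` C |g. g \<in> G})"
  have orbit: "Group_Action.orbit (orthogonal_group smul L \<beta> \<lparr>carrier := G\<rparr>) (\<lambda>g C. g ` C) C = orb C" for C
    by (simp add: Group_Action.orbit_def orb_def)
  have stab: "stabilizer (orthogonal_group smul L \<beta> \<lparr>carrier := G\<rparr>) (\<lambda>g C. g ` C) C = {g \<in> G. g ` C = C}" for C
    by (simp add: stabilizer_def)
  define P where "P = (\<lambda>O'. O' \<in> {orb C |C. C \<in> shadow_quotient smul L \<beta>} \<and>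
    (\<forall>C\<in>O'. {g \<in> G. g ` C = C} \<subseteq> {g \<in> G. sn N s g = 1}))"
  have "\<exists>!O'. P O'"
    using extremal unfolding extremal_def Let_def orbits_def orbit stab P_def .
  then obtain O' where O': "P O'" and uniq: "\<And>O''. P O'' \<Longrightarrow> O'' = O'"
    by (rule ex1E) blast
  obtain w where w: "w \<in> shadow smul L \<beta>" "O' = orb (coset w)"
    using O' unfolding P_def shadow_quotient_def by blast
  have "\<exists>g\<in>G. coset x = coset (g w)" if nz: "reduced_coeff \<tau> x \<noteq> 0" for \<tau> x
  proof -
    have "x \<in> shadow smul L \<beta>"
      using nz by (intro theta_coeff_nonzero_imp_shadow[of \<tau>]) (auto simp: reduced_coeff_def)
    then have "orb (coset x) \<in> {orb C |C. C \<in> shadow_quotient smul L \<beta>}"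
      unfolding shadow_quotient_def by blast
    \<comment> \<open>The condition concerns every class h x of the orbit. Its coefficient is that
      of x up to sign, hence nonzero, and an element g fixing the class multiplies it by sn
      g.\<close>
    moreover have "\<forall>C\<in>orb (coset x). {g \<in> G. g ` C = C} \<subseteq> {g \<in> G. sn N s g = 1}"
    proof (intro ballI subsetI)
      fix C g assume "C \<in> orb (coset x)" and "g \<in> {g \<in> G. g ` C = C}"
      then obtain h where "h \<in> G" "C = h ` coset x" and g: "g \<in> G" "g ` C = C"
        unfolding orb_def by blast
      then have h: "h \<in> G" "C = coset (h x)" using G_image_coset by simp_all
      have "coset (g (h x)) = coset (h x)"
        using g h G_image_coset[OF g(1), of "h x"] by simp
      then have "of_int (sn N s g) * reduced_coeff \<tau> (h x) = reduced_coeff \<tau> (h x)"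
        using reduced_coeff_cong reduced_coeff_G[OF g(1)] by metis
      moreover have "reduced_coeff \<tau> (h x) \<noteq> 0"
        using nz sn_cases[OF h(1)] by (auto simp: reduced_coeff_G[OF h(1)])
      ultimately have "sn N s g = 1" by simp
      with g show "g \<in> {g \<in> G. sn N s g = 1}" by simp
    qed
    ultimately have orb_eq: "orb (coset x) = orb (coset w)"
      using uniq[of "orb (coset x)"] w(2) unfolding P_def by simp
    have "coset x \<in> orb (coset x)"
      unfolding orb_def using G_id by (intro CollectI exI[of _ id]) auto
    then have "coset x \<in> orb (coset w)" by (simp only: orb_eq)
    then obtain g where "g \<in> G" "coset x = g ` coset w"
      unfolding orb_def by blast
    then show ?thesis using G_image_coset by blast
  qed
  with w(1) that show ?thesis by blast
qed

lemma jacobi_product_expansion: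
  obtains w c where "w \<in> shadow smul L \<beta>"
    "\<And>\<tau> x. Im \<tau> > 0 \<Longrightarrow> eta \<tau> powi jacobi_exponent * theta_coeff \<tau> x = c x * e2pi (quad \<beta> x * \<tau>)"
    "\<And>x. c x \<noteq> 0 \<Longrightarrow> x \<in> shadow smul L \<beta> \<and> (\<exists>g\<in>G. coset x = coset (g w))"
    "\<And>g x. g \<in> G \<Longrightarrow> coset x = coset w \<Longrightarrow> c (g x) = of_int (sn N s g) * c w"
proof -
  obtain w where w: "w \<in> shadow smul L \<beta>"
    and supp: "\<And>\<tau> x. reduced_coeff \<tau> x \<noteq> 0 \<Longrightarrow> \<exists>g\<in>G. coset x = coset (g w)"
    by (rule support_in_orbit) blast
  \<comment> \<open>The factor is sn g if the class of x is that of g w, and 0 off the orbit; in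
    both cases it is independent of \<tau>.\<close>
  have "\<exists>a. \<forall>\<tau>. reduced_coeff \<tau> x = a * reduced_coeff \<tau> w" for x
  proof (cases "\<exists>g\<in>G. coset x = coset (g w)")
    case True
    then obtain g where g: "g \<in> G" "coset x = coset (g w)" by blast
    then have "reduced_coeff \<tau> x = of_int (sn N s g) * reduced_coeff \<tau> w" for \<tau>
      using reduced_coeff_cong[OF g(2)] reduced_coeff_G[OF g(1)] by simp
    then show ?thesis by blast
  next
    case False
    then have "reduced_coeff \<tau> x = 0" for \<tau> using supp[of \<tau> x] by blast
    then have "reduced_coeff \<tau> x = 0 * reduced_coeff \<tau> w" for \<tau> by simp
    then show ?thesis by blast
  qed
  then obtain a where a: "\<And>\<tau> x. reduced_coeff \<tau> x = a x * reduced_coeff \<tau> w" by metis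
  obtain k where k: "\<And>\<tau>. Im \<tau> > 0 \<Longrightarrow> eta \<tau> powi jacobi_exponent * reduced_coeff \<tau> w = k"
    using reduced_coeff_constant[of a w] a unfolding jacobi_exponent_def by blast
  define c where "c = (\<lambda>x. k * a x)"
  have c: "eta \<tau> powi jacobi_exponent * reduced_coeff \<tau> x = c x" if "Im \<tau> > 0" for \<tau> x
    by (subst a) (simp add: c_def flip: k[OF that])
  show ?thesis
  proof (rule that[OF w])
    show "eta \<tau> powi jacobi_exponent * theta_coeff \<tau> x = c x * e2pi (quad \<beta> x * \<tau>)" if "Im \<tau> > 0" for \<tau> x
      using c[OF that, of x] by (simp add: theta_coeff_eq)
    show "x \<in> shadow smul L \<beta> \<and> (\<exists>g\<in>G. coset x = coset (g w))" if "c x \<noteq> 0" for x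
    proof
      have nz: "reduced_coeff \<i> x \<noteq> 0" using c[of \<i> x] that by auto
      then show "\<exists>g\<in>G. coset x = coset (g w)" by (rule supp)
      show "x \<in> shadow smul L \<beta>"
        using nz by (intro theta_coeff_nonzero_imp_shadow[of \<i>]) (auto simp: reduced_coeff_def)
    qed
    show "c (g x) = of_int (sn N s g) * c w" if "g \<in> G" "coset x = coset w" for g x
      using c[of \<i> "g x"] c[of \<i> w] reduced_coeff_G[OF that(1), of \<i> x] reduced_coeff_cong[OF that(2), of \<i>]
      by (simp add: mult.left_commute)
  qed
qed

text \<open>Double counting: adding the sums of F over all translates g K meets each y of the
  support exactly p times. Pulled back along g, the same total is the signed sum over K, whence the
  constant c w / p.\<close>

theorem jacobi_product_eq_theta_sum:
  "\<exists>\<gamma>. \<exists>w\<in>shadow smul L \<beta>. \<forall>\<tau>\<in>upper_half_plane. \<forall>z.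
     jacobi_product \<tau> z = \<gamma> * (\<Sum>\<^sub>\<infinity>x\<in>coset w. e2pi (quad \<beta> x * \<tau>) * (\<Sum>g\<in>G. of_int (sn N s g) * e2pi (\<beta> (g x) z)))"
proof -
  obtain w c where w: "w \<in> shadow smul L \<beta>"
    and c: "\<And>\<tau> x. Im \<tau> > 0 \<Longrightarrow> eta \<tau> powi jacobi_exponent * theta_coeff \<tau> x = c x * e2pi (quad \<beta> x * \<tau>)"
    and supp: "\<And>x. c x \<noteq> 0 \<Longrightarrow> x \<in> shadow smul L \<beta> \<and> (\<exists>g\<in>G. coset x = coset (g w))"
    and cG: "\<And>g x. g \<in> G \<Longrightarrow> coset x = coset w \<Longrightarrow> c (g x) = of_int (sn N s g) * c w"
    by (rule jacobi_product_expansion) blast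
  define K where "K = coset w"
  have mem: "y \<in> coset v \<longleftrightarrow> coset y = coset v" for y v
    unfolding coset_eq_iff by (auto simp: even_coset_def intro: image_eqI[of _ _ "y - v"])
  have gK: "y \<in> g ` K \<longleftrightarrow> coset y = coset (g w)" if "g \<in> G" for g y
    unfolding K_def G_image_coset[OF that] mem ..
  \<comment> \<open>The order of the stabilizer of the class of w. For y in the orbit the elements g
    with y in g K form a left coset of it; \<open>p > 0\<close> because it contains the
    identity.\<close>
  define p where "p = card {g \<in> G. coset (g w) = coset w}"
  have p: "card {g \<in> G. y \<in> g ` K} = p" if h: "h \<in> G" "coset y = coset (h w)" for h y
  proof -
    obtain h' where h': "h' \<in> G" "\<And>x. h (h' x) = x" "\<And>x. h' (h x) = x" using G_inverse[OF h(1)] by metis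
    have cancel: "coset (h x) = coset (h y) \<longleftrightarrow> coset x = coset y" if "h \<in> G" "h' \<in> G" "\<And>x. h' (h x) = x" for h h' x y
      using G_image_coset[OF that(1)] G_image_coset[OF that(2)] that(3) by metis
    have "bij_betw (\<lambda>g. h \<circ> g) {g \<in> G. coset (g w) = coset w} {g \<in> G. coset (g w) = coset (h w)}"
    proof (rule bij_betwI[where g = "\<lambda>g. h' \<circ> g"])
      show "(\<lambda>g. h \<circ> g) \<in> {g \<in> G. coset (g w) = coset w} \<rightarrow> {g \<in> G. coset (g w) = coset (h w)}"
        using G_comp[OF h(1)] cancel[OF h(1) h'(1,3)] by auto
      show "(\<lambda>g. h' \<circ> g) \<in> {g \<in> G. coset (g w) = coset (h w)} \<rightarrow> {g \<in> G. coset (g w) = coset w}"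
        using G_comp[OF h'(1)] cancel[OF h'(1) h(1) h'(2), of _ "h w"] h'(3) by auto
    qed (use h' in \<open>auto simp: fun_eq_iff\<close>)
    then have "p = card {g \<in> G. coset (g w) = coset (h w)}"
      unfolding p_def by (rule bij_betw_same_card)
    also have "{g \<in> G. coset (g w) = coset (h w)} = {g \<in> G. y \<in> g ` K}"
      using gK h(2) by auto
    finally show ?thesis ..
  qed
  have "p > 0"
    unfolding p_def card_gt_0_iff using finite_G G_id by (auto intro: exI[of _ id])
  have "jacobi_product \<tau> z = c w / of_nat p * (\<Sum>\<^sub>\<infinity>x\<in>K. e2pi (quad \<beta> x * \<tau>) * (\<Sum>g\<in>G. of_int (sn N s g) * e2pi (\<beta> (g x) z)))"
    if "\<tau> \<in> upper_half_plane" for \<tau> z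
  proof -
    have \<tau>: "Im \<tau> > 0" using that by (simp add: upper_half_plane_def)
    define F where "F = (\<lambda>x. c x * e2pi (quad \<beta> x * \<tau>) * e2pi (\<beta> x z))"
    have F: "(F has_sum jacobi_product \<tau> z) UNIV"
      unfolding F_def by (rule jacobi_product_fourier[OF \<tau> c[OF \<tau>]])
    have S: "(F has_sum infsum F (g ` K)) (g ` K)" for g
      using F by (intro has_sum_infsum summable_on_subset_banach[OF has_sum_imp_summable[OF F]]) auto
    have "((\<lambda>x. \<Sum>g\<in>G. F (g x)) has_sum (\<Sum>g\<in>G. infsum F (g ` K))) K"
    proof (rule has_sum_sum[OF finite_G])
      fix g assume g: "g \<in> G"
      then have "inj_on g K" using G_inj by (auto intro: inj_onI)
      then show "((\<lambda>x. F (g x)) has_sum infsum F (g ` K)) K"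
        using S[of g] by (simp add: has_sum_reindex o_def)
    qed
    moreover have "(\<Sum>g\<in>G. F (g x)) = c w * (e2pi (quad \<beta> x * \<tau>) * (\<Sum>g\<in>G. of_int (sn N s g) * e2pi (\<beta> (g x) z)))" if "x \<in> K" for x
    proof -
      have "F (g x) = c w * (e2pi (quad \<beta> x * \<tau>) * (of_int (sn N s g) * e2pi (\<beta> (g x) z)))" if "g \<in> G" for g
        using cG[OF that, of x] \<open>x \<in> K\<close> mem[of x w] by (simp add: F_def K_def G_quad[OF that])
      then show ?thesis by (simp add: sum_distrib_left)
    qed
    ultimately have "((\<lambda>x. c w * (e2pi (quad \<beta> x * \<tau>) * (\<Sum>g\<in>G. of_int (sn N s g) * e2pi (\<beta> (g x) z)))) has_sum (\<Sum>g\<in>G. infsum F (g ` K))) K"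
      by (simp cong: has_sum_cong)
    then have 1: "c w * (\<Sum>\<^sub>\<infinity>x\<in>K. e2pi (quad \<beta> x * \<tau>) * (\<Sum>g\<in>G. of_int (sn N s g) * e2pi (\<beta> (g x) z))) = (\<Sum>g\<in>G. infsum F (g ` K))"
      by (simp add: infsumI flip: infsum_cmult_right')
    \<comment> \<open>The same total, now counted on the side of y, with each translate extended by
      zero to the whole space.\<close>
    have "((\<lambda>y. \<Sum>g\<in>G. if y \<in> g ` K then F y else 0) has_sum (\<Sum>g\<in>G. infsum F (g ` K))) UNIV"
    proof (rule has_sum_sum[OF finite_G])
      fix g
      show "((\<lambda>y. if y \<in> g ` K then F y else 0) has_sum infsum F (g ` K)) UNIV"
        using S[of g] by (rule has_sum_cong_neutral[THEN iffD1, rotated -1]) auto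
    qed
    moreover have "(\<Sum>g\<in>G. if y \<in> g ` K then F y else 0) = of_nat p * F y" for y
    proof (cases "F y = 0")
      case True
      then show ?thesis by (simp add: sum.neutral)
    next
      case False
      then have "c y \<noteq> 0" by (auto simp: F_def)
      then obtain h where "h \<in> G" "coset y = coset (h w)" using supp by blast
      then have "card {g \<in> G. y \<in> g ` K} = p" by (rule p)
      then show ?thesis using finite_G by (simp add: sum.If_cases Int_def)
    qed
    ultimately have "((\<lambda>y. of_nat p * F y) has_sum (\<Sum>g\<in>G. infsum F (g ` K))) UNIV" by simp
    with has_sum_cmult_right[OF F, of "of_nat p"] have "of_nat p * jacobi_product \<tau> z = (\<Sum>g\<in>G. infsum F (g ` K))"
      using has_sum_unique by blast
    with 1 \<open>p > 0\<close> show ?thesis by (simp add: field_simps)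
  qed
  with w show ?thesis unfolding K_def by blast
qed

end

section \<open>Jacobi forms\<close>

lemma eta_T: "eta (\<tau> + 1) = e2pi (1 / 24) * eta \<tau>"
proof -
  have "e2pi (of_nat (Suc n) * (\<tau> + 1)) = e2pi (of_nat (Suc n) * \<tau>)" for n
    by (rule e2pi_eqI) (simp add: algebra_simps)
  then have "euler_prod (\<tau> + 1) = euler_prod \<tau>" unfolding euler_prod_def by (simp only:)
  then show ?thesis by (simp add: eta_eq add_divide_distrib e2pi_add)
qed

section \<open>Holomorphy in several variables\<close>

context integral_lattice
begin

definition complex_differentiable :: "(complex \<times> 'v \<Rightarrow> complex) \<Rightarrow> complex \<times> 'v \<Rightarrow> bool" where
  "complex_differentiable f p \<longleftrightarrow>
     (\<exists>D. (f has_derivative D) (at p) \<and> (\<forall>c t v. D (c * t, smul c v) = c * D (t, v)))"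

lemma complex_differentiable_mult:
  assumes "complex_differentiable f p" "complex_differentiable g p"
  shows "complex_differentiable (\<lambda>x. f x * g x) p"
proof -
  obtain D E where D: "(f has_derivative D) (at p)" "\<And>c t v. D (c * t, smul c v) = c * D (t, v)"
    and E: "(g has_derivative E) (at p)" "\<And>c t v. E (c * t, smul c v) = c * E (t, v)"
    using assms unfolding complex_differentiable_def by blast
  have "((\<lambda>x. f x * g x) has_derivative (\<lambda>h. f p * E h + D h * g p)) (at p)"
    using D(1) E(1) by (rule has_derivative_mult)
  then show ?thesis
    unfolding complex_differentiable_def
    by (intro exI[of _ "\<lambda>h. f p * E h + D h * g p"]) (auto simp: D(2) E(2) algebra_simps)
qed

lemma complex_differentiable_prod:
  assumes "finite A" "\<And>j. j \<in> A \<Longrightarrow> complex_differentiable (f j) p"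
  shows "complex_differentiable (\<lambda>x. \<Prod>j\<in>A. f j x) p"
  using assms
proof (induction A rule: finite_induct)
  case empty
  show ?case
    unfolding complex_differentiable_def by (intro exI[of _ "\<lambda>_. 0"]) (auto intro!: derivative_eq_intros)
next
  case (insert j A)
  then show ?case by (simp add: complex_differentiable_mult)
qed

lemma complex_differentiable_fst:
  assumes "(f has_field_derivative d) (at \<tau>)"
  shows "complex_differentiable (\<lambda>x. f (fst x)) (\<tau>, z)"
proof -
  have "((\<lambda>x. f (fst x)) has_derivative (\<lambda>h. d * fst h)) (at (\<tau>, z))"
    by (rule has_derivative_compose[OF has_derivative_fst[OF has_derivative_ident], of f "(*) d"])
      (use assms in \<open>simp add: has_field_derivative_def\<close>)
  then show ?thesis
    unfolding complex_differentiable_def by (intro exI[of _ "\<lambda>h. d * fst h"]) auto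
qed

lemma complex_differentiable_theta:
  assumes "Im \<tau> > 0"
  shows "complex_differentiable (\<lambda>x. theta (fst x) (\<beta> y (snd x))) (\<tau>, z)"
proof -
  define D where "D = (\<lambda>(t, w). theta_deriv 2 \<tau> (\<beta> y z) / (4 * of_real pi * \<i>) * t + theta_deriv 1 \<tau> (\<beta> y z) * w)"
  have bl: "bounded_linear (\<beta> y)" using linear by (rule bounded_linear_of_linear)
  have "((\<lambda>x. (fst x, \<beta> y (snd x))) has_derivative (\<lambda>h. (fst h, \<beta> y (snd h)))) (at (\<tau>, z))"
    by (intro has_derivative_Pair has_derivative_fst bounded_linear.has_derivative[OF bl] has_derivative_snd has_derivative_ident)
  moreover have "((\<lambda>(\<tau>, u). theta \<tau> u) has_derivative D) (at (fst (\<tau>, z), \<beta> y (snd (\<tau>, z))))"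
    unfolding D_def fst_conv snd_conv by (rule has_derivative_theta[OF assms])
  ultimately have "((\<lambda>x. (\<lambda>(\<tau>, u). theta \<tau> u) (fst x, \<beta> y (snd x))) has_derivative (\<lambda>h. D (fst h, \<beta> y (snd h)))) (at (\<tau>, z))"
    by (rule has_derivative_compose)
  then show ?thesis
    unfolding complex_differentiable_def
    by (intro exI[of _ "\<lambda>h. D (fst h, \<beta> y (snd h))"]) (auto simp: D_def \<beta>_scale_right algebra_simps)
qed

end

lemma of_rat_Ints_iff: "(of_rat x :: complex) \<in> \<int> \<longleftrightarrow> x \<in> \<int>"
proof
  assume "(of_rat x :: complex) \<in> \<int>"
  then obtain k where "of_rat x = (of_int k :: complex)" by (auto elim: Ints_cases)
  then have "(of_rat x :: complex) = of_rat (of_int k)" by simp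
  then have "x = of_int k" by (simp only: of_rat_eq_iff)
  then show "x \<in> \<int>" by simp
qed (auto elim!: Ints_cases)

section \<open>The defining conditions of a Jacobi form\<close>

context eutactic_lattice
begin

lemma holomorphic_jacobi_product: "holomorphic_on_jacobi_domain smul jacobi_product"
  unfolding holomorphic_on_jacobi_domain_def
proof (intro ballI allI)
  fix \<tau> z assume "\<tau> \<in> upper_half_plane"
  then have \<tau>: "Im \<tau> > 0" by (simp add: upper_half_plane_def)
  have op: "open upper_half_plane" by (simp add: upper_half_plane_def open_halfspace_Im_gt)
  have "((\<lambda>\<tau>. eta \<tau> powi jacobi_exponent) has_field_derivative of_int jacobi_exponent * eta \<tau> powi (jacobi_exponent - 1) * deriv eta \<tau>) (at \<tau>)"
    by (intro DERIV_power_int holomorphic_derivI[OF holomorphic_on_eta op \<open>\<tau> \<in> upper_half_plane\<close>] disjI2 eta_nonzero \<tau>)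
  then have "complex_differentiable (\<lambda>x. eta (fst x) powi jacobi_exponent * (\<Prod>j=1..N. theta (fst x) (\<beta> (s j) (snd x)))) (\<tau>, z)"
    by (intro complex_differentiable_mult complex_differentiable_prod complex_differentiable_theta[OF \<tau>])
      (auto intro: complex_differentiable_fst)
  then show "\<exists>D. ((\<lambda>(t, v). jacobi_product t v) has_derivative D) (at (\<tau>, z)) \<and> (\<forall>c t v. D (c * t, smul c v) = c * D (t, v))"
    by (simp add: complex_differentiable_def jacobi_product_def theta_prod_def case_prod_unfold)
qed

text \<open>The exponents of the theta factors add up by Parseval. The half-integral part agrees
  with beta(x + y) modulo Z because m_j + l_j and its square have the same parity.\<close>

lemma jacobi_product_elliptic:
  assumes x: "x \<in> L" and y: "y \<in> L"
  shows "jacobi_product \<tau> (z + smul \<tau> x + y) =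
    e2pi (quad \<beta> (x + y)) * e2pi (- \<tau> * quad \<beta> x - \<beta> x z) * jacobi_product \<tau> z"
proof -
  have "\<forall>j\<in>{1..N}. \<exists>k. \<beta> (s j) x = of_int k" "\<forall>j\<in>{1..N}. \<exists>k. \<beta> (s j) y = of_int k"
    using star_integral[OF _ x] star_integral[OF _ y] unfolding Ints_def by blast+
  then have "\<exists>m. \<forall>j\<in>{1..N}. \<beta> (s j) x = of_int (m j)" "\<exists>l. \<forall>j\<in>{1..N}. \<beta> (s j) y = of_int (l j)"
    by (auto intro: bchoice)
  then obtain m l where m: "\<And>j. j \<in> {1..N} \<Longrightarrow> \<beta> (s j) x = of_int (m j)" and l: "\<And>j. j \<in> {1..N} \<Longrightarrow> \<beta> (s j) y = of_int (l j)"
    by blast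
  have "theta_prod \<tau> (z + smul \<tau> x + y) = (\<Prod>j=1..N. e2pi ((of_int (m j) + of_int (l j)) / 2 - of_int (m j) ^ 2 * \<tau> / 2 - of_int (m j) * \<beta> (s j) z) * theta \<tau> (\<beta> (s j) z))"
    unfolding theta_prod_def
  proof (rule prod.cong)
    fix j assume j: "j \<in> {1..N}"
    have "\<beta> (s j) (z + smul \<tau> x + y) = \<beta> (s j) z + of_int (m j) * \<tau> + of_int (l j)"
      by (simp add: \<beta>_bilinear m[OF j] l[OF j])
    then show "theta \<tau> (\<beta> (s j) (z + smul \<tau> x + y)) = e2pi ((of_int (m j) + of_int (l j)) / 2 - of_int (m j) ^ 2 * \<tau> / 2 - of_int (m j) * \<beta> (s j) z) * theta \<tau> (\<beta> (s j) z)"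
      by (simp only: theta_quasiperiodic)
  qed simp
  also have "\<dots> = e2pi (\<Sum>j=1..N. (of_int (m j) + of_int (l j)) / 2 - of_int (m j) ^ 2 * \<tau> / 2 - of_int (m j) * \<beta> (s j) z) * theta_prod \<tau> z"
    by (simp only: prod.distrib e2pi_sum[OF finite_atLeastAtMost] theta_prod_def)
  also have "(\<Sum>j=1..N. (of_int (m j) + of_int (l j)) / 2 - of_int (m j) ^ 2 * \<tau> / 2 - of_int (m j) * \<beta> (s j) z) =
    (\<Sum>j=1..N. (of_int (m j) + of_int (l j)) / 2) + (- \<tau> * quad \<beta> x - \<beta> x z)"
    by (simp add: quad_def \<beta>_eutactic[of x] m sum_subtractf sum_negf power2_eq_square sum_distrib_left sum_divide_distrib mult_ac)
  also have "e2pi \<dots> = e2pi (quad \<beta> (x + y) + (- \<tau> * quad \<beta> x - \<beta> x z))"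
  proof (rule e2pi_eqI)
    have "quad \<beta> (x + y) = (\<Sum>j=1..N. \<beta> (s j) (x + y) * \<beta> (s j) (x + y)) / 2"
      unfolding quad_def by (rule arg_cong[OF \<beta>_eutactic])
    also have "\<dots> = (\<Sum>j=1..N. of_int ((m j + l j)\<^sup>2) / 2)"
      unfolding sum_divide_distrib by (rule sum.cong) (simp_all add: \<beta>_add_right m l power2_eq_square)
    finally have "quad \<beta> (x + y) = (\<Sum>j=1..N. of_int ((m j + l j)\<^sup>2) / 2)" .
    then have "(\<Sum>j=1..N. (of_int (m j) + of_int (l j)) / 2) - quad \<beta> (x + y) = (\<Sum>j=1..N. of_int ((m j + l j) - (m j + l j)\<^sup>2) / 2)"
      by (simp add: diff_divide_distrib flip: sum_subtractf)
    also have "\<dots> \<in> \<int>"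
    proof (rule Ints_sum)
      fix j
      have "even ((m j + l j) - (m j + l j)\<^sup>2)" by simp
      then obtain k where k: "(m j + l j) - (m j + l j)\<^sup>2 = 2 * k" by blast
      show "of_int ((m j + l j) - (m j + l j)\<^sup>2) / 2 \<in> (\<int> :: complex set)" unfolding k by simp
    qed
    finally show "(\<Sum>j=1..N. (of_int (m j) + of_int (l j)) / 2) + (- \<tau> * quad \<beta> x - \<beta> x z) - (quad \<beta> (x + y) + (- \<tau> * quad \<beta> x - \<beta> x z)) \<in> \<int>"
      by simp
  qed
  finally show ?thesis by (simp only: jacobi_product_def e2pi_add mult_ac)
qed

text \<open>With \<rho> = eta(A \<tau>)/eta(\<tau>), each theta factor contributes \<rho>^3/j, so
  the eta exponent is (n - N) + 3 N = n + 2 N and the power of j is -N. The quadratic exponents add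
  up to beta(z) by Parseval.\<close>

lemma jacobi_product_modular:
  assumes det: "a * d - b * c = (1::int)" and \<tau>: "\<tau> \<in> upper_half_plane"
  shows "jacobi_product (mobius a b c d \<tau>) (smul (1 / (of_int c * \<tau> + of_int d)) z) =
    e2pi (of_int c * quad \<beta> z / (of_int c * \<tau> + of_int d)) * (of_int c * \<tau> + of_int d) powi (- int N) *
    eta_multiplier (of_nat (lattice_rank smul L + 2 * N)) a b c d \<tau> * jacobi_product \<tau> z"
proof -
  define j where "j = of_int c * \<tau> + of_int d"
  define \<tau>' where "\<tau>' = mobius a b c d \<tau>"
  define \<rho> where "\<rho> = eta \<tau>' / eta \<tau>"
  have Im: "Im \<tau> > 0" using \<tau> by (simp add: upper_half_plane_def)
  have j: "j \<noteq> 0" and Im': "Im \<tau>' > 0"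
    using Im_mobius[OF det Im] by (auto simp: j_def \<tau>'_def)
  have mem: "mobius a b c d \<tau> \<in> upper_half_plane"
    using Im' by (simp add: \<tau>'_def upper_half_plane_def)
  have nz: "eta \<tau> \<noteq> 0" "eta \<tau>' \<noteq> 0" using eta_nonzero Im Im' by auto
  have "theta_prod \<tau>' (smul (1 / j) z) = (\<Prod>i=1..N. e2pi (of_int c * (\<beta> (s i) z)\<^sup>2 / (2 * j)) * (\<rho> ^ 3 / j) * theta \<tau> (\<beta> (s i) z))"
    unfolding theta_prod_def
  proof (rule prod.cong)
    fix i
    have "\<beta> (s i) (smul (1 / j) z) = \<beta> (s i) z / j" by (simp add: \<beta>_scale_right)
    then show "theta \<tau>' (\<beta> (s i) (smul (1 / j) z)) = e2pi (of_int c * (\<beta> (s i) z)\<^sup>2 / (2 * j)) * (\<rho> ^ 3 / j) * theta \<tau> (\<beta> (s i) z)"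
      using theta_modular[OF det Im, of "\<beta> (s i) z"] by (simp add: j_def \<tau>'_def \<rho>_def)
  qed simp
  also have "\<dots> = e2pi (\<Sum>i=1..N. of_int c * (\<beta> (s i) z)\<^sup>2 / (2 * j)) * (\<rho> ^ 3 / j) ^ N * theta_prod \<tau> z"
    by (simp only: prod.distrib prod_constant e2pi_sum[OF finite_atLeastAtMost] theta_prod_def) simp
  also have "(\<Sum>i=1..N. of_int c * (\<beta> (s i) z)\<^sup>2 / (2 * j)) = of_int c * quad \<beta> z / j"
    by (simp add: quad_def \<beta>_eutactic[of z z] power2_eq_square sum_distrib_left sum_divide_distrib)
  finally have theta: "theta_prod \<tau>' (smul (1 / j) z) = e2pi (of_int c * quad \<beta> z / j) * (\<rho> ^ 3 / j) ^ N * theta_prod \<tau> z" .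
  have eta: "eta \<tau>' powi jacobi_exponent = \<rho> powi jacobi_exponent * eta \<tau> powi jacobi_exponent"
    using nz by (simp add: \<rho>_def flip: power_int_mult_distrib)
  have "\<rho> powi jacobi_exponent * \<rho> ^ (3 * N) = \<rho> powi (jacobi_exponent + int (3 * N))"
    using nz by (subst power_int_add) (auto simp: \<rho>_def simp flip: power_int_of_nat)
  also have "jacobi_exponent + int (3 * N) = int (lattice_rank smul L + 2 * N)"
    by (simp add: jacobi_exponent_def)
  also have "\<rho> powi int (lattice_rank smul L + 2 * N) = eta_multiplier (of_nat (lattice_rank smul L + 2 * N)) a b c d \<tau>"
    unfolding eta_multiplier_def power_int_of_nat
    by (simp only: eta_power_of_nat[OF mem] eta_power_of_nat[OF \<tau>] \<rho>_def \<tau>'_def power_divide)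
  finally have mult: "\<rho> powi jacobi_exponent * \<rho> ^ (3 * N) = eta_multiplier (of_nat (lattice_rank smul L + 2 * N)) a b c d \<tau>" .
  have "(\<rho> ^ 3 / j) ^ N = \<rho> ^ (3 * N) * j powi (- int N)"
    by (simp add: power_mult_distrib power_inverse power_int_minus power_mult divide_inverse)
  then have "jacobi_product \<tau>' (smul (1 / j) z) = e2pi (of_int c * quad \<beta> z / j) * j powi (- int N) * (\<rho> powi jacobi_exponent * \<rho> ^ (3 * N)) * jacobi_product \<tau> z"
    unfolding jacobi_product_def theta eta by (simp only: mult_ac)
  then show ?thesis unfolding mult j_def \<tau>'_def .
qed

text \<open>Independence of c from \<tau> does double duty: it puts all Fourier exponents exactly at
  beta(x), and comparing \<tau> with \<tau> + 1 places them in h/24 + Z.\<close>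

lemma jacobi_product_in_jacobi_forms:
  assumes c: "\<And>\<tau> x. Im \<tau> > 0 \<Longrightarrow> eta \<tau> powi jacobi_exponent * theta_coeff \<tau> x = c x * e2pi (quad \<beta> x * \<tau>)"
  shows "jacobi_product \<in> jacobi_forms smul L \<beta> (of_nat (lattice_rank smul L) / 2) (of_nat (lattice_rank smul L + 2 * N))"
proof -
  define h :: rat where "h = of_nat (lattice_rank smul L + 2 * N)"
  define X where "X = {x. c x \<noteq> 0}"
  have shadow: "x \<in> shadow smul L \<beta>" if "x \<in> X" for x
    using that c[of \<i> x] by (intro theta_coeff_nonzero_imp_shadow[of \<i>]) (auto simp: X_def)
  have "\<exists>a. \<forall>x\<in>X. quad \<beta> x = of_rat (a x)"
  proof (intro bchoice ballI)
    fix x assume "x \<in> X"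
    then have "x \<in> rational_span smul L" using shadow by (auto simp: shadow_def)
    then show "\<exists>a. quad \<beta> x = of_rat a" using quad_rational by metis
  qed
  then obtain a where a: "\<And>x. x \<in> X \<Longrightarrow> quad \<beta> x = of_rat (a x)" by blast
  have a_int: "a x - h / 24 \<in> \<int>" if x: "x \<in> X" for x
  proof -
    have i: "Im (\<i> + 1) > 0" by simp
    \<comment> \<open>The coefficient at i + 1 is computed once from c and once from the translation
      rules of eta and theta; the ratio says e(beta(x)) = e((n - N)/24 + N/8), and this exponent is
      h/24.\<close>
    have "c x * e2pi (quad \<beta> x * \<i>) * e2pi (quad \<beta> x) = eta (\<i> + 1) powi jacobi_exponent * theta_coeff (\<i> + 1) x"
      unfolding c[OF i] by (simp add: distrib_left e2pi_add)
    also have "\<dots> = e2pi (1 / 24) powi jacobi_exponent * e2pi (of_nat N / 8) * (eta \<i> powi jacobi_exponent * theta_coeff \<i> x)"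
      by (simp add: eta_T theta_coeff_T power_int_mult_distrib)
    also have "e2pi (1 / 24) powi jacobi_exponent = e2pi (of_int jacobi_exponent / 24)"
    proof (cases "jacobi_exponent \<ge> 0")
      case True
      then show ?thesis
        using e2pi_of_nat_mult[of "nat jacobi_exponent" "1 / 24"] by (simp add: power_int_def)
    next
      case False
      then show ?thesis
        using e2pi_of_nat_mult[of "nat (- jacobi_exponent)" "1 / 24"] e2pi_minus[of "- of_int jacobi_exponent / 24"]
        by (simp add: power_int_def power_inverse)
    qed
    also have "eta \<i> powi jacobi_exponent * theta_coeff \<i> x = c x * e2pi (quad \<beta> x * \<i>)" by (rule c) simp
    finally have "e2pi (quad \<beta> x) = e2pi (of_int jacobi_exponent / 24 + of_nat N / 8)"
      using x by (simp add: X_def e2pi_add)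
    then have "quad \<beta> x - (of_int jacobi_exponent / 24 + of_nat N / 8) \<in> \<int>" by (simp only: e2pi_eq_iff)
    moreover have "quad \<beta> x - (of_int jacobi_exponent / 24 + of_nat N / 8) = of_rat (a x - h / 24)"
      by (simp add: a[OF x] h_def jacobi_exponent_def of_rat_diff of_rat_divide of_rat_add of_rat_mult field_simps)
    ultimately show ?thesis by (simp only: of_rat_Ints_iff)
  qed
  let ?S = "{(m, r). m - h / 24 \<in> \<int> \<and> r \<in> shadow smul L \<beta> \<and> Re (quad \<beta> r) \<le> of_rat m}"
  \<comment> \<open>The coefficients live on the pairs with m = beta(r) only, so the sum over pairs
    collapses to the sum over the support of c.\<close>
  define coeff where "coeff = (\<lambda>m r. if r \<in> X \<and> m = a r then c r else 0)"
  have "((\<lambda>(m, r). coeff m r * e2pi (of_rat m * \<tau>) * e2pi (\<beta> r z)) has_sum jacobi_product \<tau> z) ?S"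
    if \<tau>: "\<tau> \<in> upper_half_plane" for \<tau> z
  proof -
    have Im: "Im \<tau> > 0" using \<tau> by (simp add: upper_half_plane_def)
    have "((\<lambda>x. c x * e2pi (quad \<beta> x * \<tau>) * e2pi (\<beta> x z)) has_sum jacobi_product \<tau> z) UNIV"
      by (rule jacobi_product_fourier[OF Im c[OF Im]])
    then have "((\<lambda>x. c x * e2pi (quad \<beta> x * \<tau>) * e2pi (\<beta> x z)) has_sum jacobi_product \<tau> z) X"
      by (rule has_sum_cong_neutral[THEN iffD1, rotated -1]) (auto simp: X_def)
    also have "?this \<longleftrightarrow> ((\<lambda>x. (\<lambda>(m, r). coeff m r * e2pi (of_rat m * \<tau>) * e2pi (\<beta> r z)) (a x, x)) has_sum jacobi_product \<tau> z) X"
      by (rule has_sum_cong) (simp add: coeff_def a)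
    also have "\<dots> \<longleftrightarrow> ((\<lambda>(m, r). coeff m r * e2pi (of_rat m * \<tau>) * e2pi (\<beta> r z)) has_sum jacobi_product \<tau> z) ((\<lambda>x. (a x, x)) ` X)"
      by (subst has_sum_reindex) (auto simp: inj_on_def o_def)
    finally show ?thesis
    proof (rule has_sum_cong_neutral[THEN iffD1, rotated -1])
      fix p assume "p \<in> (\<lambda>x. (a x, x)) ` X - ?S"
      then obtain x where x: "x \<in> X" "(a x, x) \<notin> ?S" by blast
      have "quad \<beta> x = of_real (of_rat (a x))" using a[OF x(1)] by (cases "a x") (simp add: of_rat_rat)
      then have "(a x, x) \<in> ?S" using a_int[OF x(1)] shadow[OF x(1)] by simp
      with x(2) show "(case p of (m, r) \<Rightarrow> coeff m r * e2pi (of_rat m * \<tau>) * e2pi (\<beta> r z)) = 0" by blast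
    qed (auto simp: coeff_def)
  qed
  then have fourier: "\<exists>coeff. \<forall>\<tau>\<in>upper_half_plane. \<forall>z.
     ((\<lambda>(m, r). coeff m r * e2pi (of_rat m * \<tau>) * e2pi (\<beta> r z)) has_sum jacobi_product \<tau> z) ?S" by blast
  have "of_nat (lattice_rank smul L) / 2 - h / 2 = of_int (- int N)" by (simp add: h_def field_simps)
  then have "\<lfloor>of_nat (lattice_rank smul L) / 2 - h / 2\<rfloor> = - int N" by (simp only: floor_of_int)
  then show ?thesis
    unfolding jacobi_forms_def h_def[symmetric] Let_def
    using holomorphic_jacobi_product jacobi_product_modular jacobi_product_elliptic fourier
    by (simp add: h_def)
qed

end

theorem theorem9p2:
  fixes smul :: "complex \<Rightarrow> 'v::real_normed_vector \<Rightarrow> 'v"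
    and L :: "'v set" and \<beta> :: "'v \<Rightarrow> 'v \<Rightarrow> complex"
    and n N :: nat and s :: "nat \<Rightarrow> 'v" and G :: "('v \<Rightarrow> 'v) set"
  assumes "integral_lattice smul L \<beta>"
    and "lattice_rank smul L = n"
    and "eutactic_star smul L \<beta> N s"
    and "subgroup G (orthogonal_group smul L \<beta>)"
    and "invariant_up_to_signs G N s"
    and "extremal smul L \<beta> G N s"
  shows "(\<exists>\<gamma> :: complex. \<exists>w \<in> shadow smul L \<beta>. \<forall>\<tau>\<in>upper_half_plane. \<forall>z.
            eta \<tau> powi (int n - int N) * (\<Prod>j=1..N. theta \<tau> (\<beta> (s j) z)) =
            \<gamma> * (\<Sum>\<^sub>\<infinity>x\<in>even_coset L \<beta> w.
                   e2pi (quad \<beta> x * \<tau>) * (\<Sum>g\<in>G. of_int (sn N s g) * e2pi (\<beta> (g x) z))))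
       \<and> (\<lambda>\<tau> z. eta \<tau> powi (int n - int N) * (\<Prod>j=1..N. theta \<tau> (\<beta> (s j) z)))
           \<in> jacobi_forms smul L \<beta> (of_nat n / 2) (of_nat (n + 2 * N))"
proof -
  interpret extremal_star smul L \<beta> N s G
    using assms unfolding extremal_star_def eutactic_lattice_def extremal_star_axioms_def eutactic_lattice_axioms_def
    by blast
  have eq: "jacobi_product = (\<lambda>\<tau> z. eta \<tau> powi (int n - int N) * (\<Prod>j=1..N. theta \<tau> (\<beta> (s j) z)))"
    by (simp add: fun_eq_iff jacobi_product_def jacobi_exponent_def theta_prod_def assms(2))
  obtain c where "\<And>\<tau> x. Im \<tau> > 0 \<Longrightarrow> eta \<tau> powi jacobi_exponent * theta_coeff \<tau> x = c x * e2pi (quad \<beta> x * \<tau>)"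
    by (rule jacobi_product_expansion) blast
  then have "jacobi_product \<in> jacobi_forms smul L \<beta> (of_nat n / 2) (of_nat (n + 2 * N))"
    using jacobi_product_in_jacobi_forms assms(2) by blast
  with jacobi_product_eq_theta_sum show ?thesis unfolding eq by (intro conjI)
qed

end
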